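(* Let $F$ be a dyadic local field, $n\ge 3$ an odd integer, and $M$ an integral $\mathcal{O}_F$-lattice of rank $n+1$. Then $M$ is $n$-ADC if and only if $M$ is $\mathcal{O}_F$-maximal.
   Context: A dyadic local field is a finite extension of $\mathbb{Q}_2$. Integral lattices: finitely generated $\mathcal{O}_F$-submodules of non-degenerate quadratic spaces with norm ideal $\subseteq\mathcal{O}_F$. $M$ is $n$-ADC if for every integral lattice $N$ of rank $n$ with $FN$ represented by $FM$, $M$ represents $N$. $M$ is $\mathcal{O}_F$-maximal if $\mathfrak{n}(M)\subseteq\mathcal{O}_F$ and $M$ contains every lattice on $FM$ with norm in $\mathcal{O}_F$.
   Formalization: Maximal is taken in the usual sense (every lattice on FM with norm in O_F that contains M equals M), since literally containing every such lattice fails for M = H ⊥ H; the spaces FM and FN themselves are required to be non-degenerate. *)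

theory Defs
  imports
    "HOL-Computational_Algebra.Computational_Algebra"
    "HOL-Library.Function_Algebras"
begin

definition two_adic_abs :: "rat \<Rightarrow> real" where
  "two_adic_abs r = (if r = 0 then 0 else
     2 powi (int (multiplicity 2 (snd (quotient_of r))) - int (multiplicity 2 (fst (quotient_of r)))))"

text \<open>The set \<open>Q2\<close> with the absolute value \<open>nrm\<close> is the field of 2-adic numbers, that is, the
  completion of the rationals at the 2-adic absolute value. Only the values of \<open>nrm\<close> on \<open>Q2\<close> matter.\<close>

locale two_adic_numbers =
  fixes Q2 :: "'a::field_char_0 set" and nrm :: "'a \<Rightarrow> real"
  assumes zero_mem: "0 \<in> Q2" and one_mem: "1 \<in> Q2"
    and diff_mem: "\<lbrakk>x \<in> Q2; y \<in> Q2\<rbrakk> \<Longrightarrow> x - y \<in> Q2"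
    and mult_mem: "\<lbrakk>x \<in> Q2; y \<in> Q2\<rbrakk> \<Longrightarrow> x * y \<in> Q2"
    and inverse_mem: "x \<in> Q2 \<Longrightarrow> inverse x \<in> Q2"
    and nrm_nonneg: "x \<in> Q2 \<Longrightarrow> 0 \<le> nrm x"
    and nrm_eq_0_iff: "x \<in> Q2 \<Longrightarrow> nrm x = 0 \<longleftrightarrow> x = 0"
    and nrm_mult: "\<lbrakk>x \<in> Q2; y \<in> Q2\<rbrakk> \<Longrightarrow> nrm (x * y) = nrm x * nrm y"
    and nrm_triangle: "\<lbrakk>x \<in> Q2; y \<in> Q2\<rbrakk> \<Longrightarrow> nrm (x + y) \<le> nrm x + nrm y"
    and nrm_of_rat: "nrm (of_rat r) = two_adic_abs r"
    and rat_dense: "\<lbrakk>x \<in> Q2; 0 < e\<rbrakk> \<Longrightarrow> \<exists>r. nrm (x - of_rat r) < e"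
    and complete:
      "\<lbrakk>\<And>i. X i \<in> Q2; \<And>e. 0 < e \<Longrightarrow> \<exists>N. \<forall>i\<ge>N. \<forall>j\<ge>N. nrm (X i - X j) < e\<rbrakk>
        \<Longrightarrow> \<exists>l\<in>Q2. (\<lambda>i::nat. nrm (X i - l)) \<longlonglongrightarrow> 0"

text \<open>The dyadic local field is the whole type \<open>'a\<close>, a finite extension of \<open>Q2\<close>.\<close>

locale dyadic_local_field = two_adic_numbers Q2 nrm
  for Q2 :: "'a::field_char_0 set" and nrm :: "'a \<Rightarrow> real" +
  assumes finite_extension:
    "\<exists>S. finite S \<and> (\<forall>x. \<exists>c. (\<forall>b\<in>S. c b \<in> Q2) \<and> x = (\<Sum>b\<in>S. c b * b))"

definition two_adic_integers :: "'a::field_char_0 set \<Rightarrow> ('a \<Rightarrow> real) \<Rightarrow> 'a set" where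
  "two_adic_integers Q2 nrm = {x \<in> Q2. nrm x \<le> 1}"

definition ring_of_integers :: "'a::field_char_0 set \<Rightarrow> ('a \<Rightarrow> real) \<Rightarrow> 'a set" where
  "ring_of_integers Q2 nrm =
     {x. \<exists>p. lead_coeff p = 1 \<and> (\<forall>i. coeff p i \<in> two_adic_integers Q2 nrm) \<and> poly p x = 0}"

text \<open>Quadratic spaces are subspaces \<open>V\<close> of an ambient vector space with scalar multiplication
  \<open>sc\<close>; the symmetric bilinear form \<open>B\<close> matters on \<open>V\<close> only, and the quadratic map is \<open>Q x = B x x\<close>.\<close>

definition nondegenerate_quadratic_space ::
    "('a::field \<Rightarrow> 'v::ab_group_add \<Rightarrow> 'v) \<Rightarrow> 'v set \<Rightarrow> ('v \<Rightarrow> 'v \<Rightarrow> 'a) \<Rightarrow> bool" where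
  "nondegenerate_quadratic_space sc V B \<longleftrightarrow>
     vector_space sc \<and> (\<exists>S. finite S \<and> V = module.span sc S) \<and>
     (\<forall>x\<in>V. \<forall>y\<in>V. B x y = B y x) \<and>
     (\<forall>x\<in>V. \<forall>y\<in>V. \<forall>z\<in>V. B (x + y) z = B x z + B y z) \<and>
     (\<forall>c. \<forall>x\<in>V. \<forall>y\<in>V. B (sc c x) y = c * B x y) \<and>
     (\<forall>x\<in>V. (\<forall>y\<in>V. B x y = 0) \<longrightarrow> x = 0)"

text \<open>In the following \<open>R\<close> is the ring of integers, and \<open>module.span sc L\<close> is the space \<open>FL\<close>.\<close>

definition fg_submodule :: "'a::field set \<Rightarrow> ('a \<Rightarrow> 'v::ab_group_add \<Rightarrow> 'v) \<Rightarrow> 'v set \<Rightarrow> bool" where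
  "fg_submodule R sc L \<longleftrightarrow>
     (\<exists>S. finite S \<and> L = {\<Sum>v\<in>S. sc (c v) v | c. \<forall>v\<in>S. c v \<in> R})"

definition norm_ideal :: "'a::field set \<Rightarrow> ('v \<Rightarrow> 'v \<Rightarrow> 'a) \<Rightarrow> 'v set \<Rightarrow> 'a set" where
  "norm_ideal R B L =
     {\<Sum>x\<in>S. c x * B x x | S c. finite S \<and> S \<subseteq> L \<and> (\<forall>x\<in>S. c x \<in> R)}"

definition integral_lattice ::
    "'a::field set \<Rightarrow> ('a \<Rightarrow> 'v::ab_group_add \<Rightarrow> 'v) \<Rightarrow> ('v \<Rightarrow> 'v \<Rightarrow> 'a) \<Rightarrow> 'v set \<Rightarrow> bool" where
  "integral_lattice R sc B L \<longleftrightarrow>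
     nondegenerate_quadratic_space sc (module.span sc L) B \<and>
     fg_submodule R sc L \<and> norm_ideal R B L \<subseteq> R"

definition lattice_rank :: "('a::field \<Rightarrow> 'v::ab_group_add \<Rightarrow> 'v) \<Rightarrow> 'v set \<Rightarrow> nat" where
  "lattice_rank sc L = vector_space.dim sc (module.span sc L)"

definition is_representation ::
    "('a::field \<Rightarrow> 'w::ab_group_add \<Rightarrow> 'w) \<Rightarrow> ('w \<Rightarrow> 'w \<Rightarrow> 'a) \<Rightarrow> 'w set \<Rightarrow>
     ('a \<Rightarrow> 'v::ab_group_add \<Rightarrow> 'v) \<Rightarrow> ('v \<Rightarrow> 'v \<Rightarrow> 'a) \<Rightarrow> 'v set \<Rightarrow> ('w \<Rightarrow> 'v) \<Rightarrow> bool" where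
  "is_representation sc' B' W sc B V \<sigma> \<longleftrightarrow>
     \<sigma> ` W \<subseteq> V \<and>
     (\<forall>x\<in>W. \<forall>y\<in>W. \<sigma> (x + y) = \<sigma> x + \<sigma> y) \<and>
     (\<forall>c. \<forall>x\<in>W. \<sigma> (sc' c x) = sc c (\<sigma> x)) \<and>
     (\<forall>x\<in>W. B (\<sigma> x) (\<sigma> x) = B' x x)"

definition space_represents ::
    "('a::field \<Rightarrow> 'v::ab_group_add \<Rightarrow> 'v) \<Rightarrow> ('v \<Rightarrow> 'v \<Rightarrow> 'a) \<Rightarrow> 'v set \<Rightarrow>
     ('a \<Rightarrow> 'w::ab_group_add \<Rightarrow> 'w) \<Rightarrow> ('w \<Rightarrow> 'w \<Rightarrow> 'a) \<Rightarrow> 'w set \<Rightarrow> bool" where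
  "space_represents sc B V sc' B' W \<longleftrightarrow> (\<exists>\<sigma>. is_representation sc' B' W sc B V \<sigma>)"

definition lattice_represents ::
    "('a::field \<Rightarrow> 'v::ab_group_add \<Rightarrow> 'v) \<Rightarrow> ('v \<Rightarrow> 'v \<Rightarrow> 'a) \<Rightarrow> 'v set \<Rightarrow>
     ('a \<Rightarrow> 'w::ab_group_add \<Rightarrow> 'w) \<Rightarrow> ('w \<Rightarrow> 'w \<Rightarrow> 'a) \<Rightarrow> 'w set \<Rightarrow> bool" where
  "lattice_represents sc B M sc' B' N \<longleftrightarrow>
     (\<exists>\<sigma>. is_representation sc' B' (module.span sc' N) sc B (module.span sc M) \<sigma> \<and> \<sigma> ` N \<subseteq> M)"

definition fun_scale :: "'a::field \<Rightarrow> (nat \<Rightarrow> 'a) \<Rightarrow> nat \<Rightarrow> 'a" where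
  "fun_scale c f = (\<lambda>i. c * f i)"

text \<open>A definition cannot quantify over types, so \<open>N\<close> ranges over the lattices in the space of all
  sequences, with arbitrary forms. Since every finite-dimensional space embeds there, nothing is
  lost: lemma \<open>n_ADC_any_space\<close> below recovers the property for \<open>N\<close> in an arbitrary vector space.\<close>

definition n_ADC ::
    "'a::field set \<Rightarrow> ('a \<Rightarrow> 'v::ab_group_add \<Rightarrow> 'v) \<Rightarrow> ('v \<Rightarrow> 'v \<Rightarrow> 'a) \<Rightarrow> nat \<Rightarrow> 'v set \<Rightarrow> bool" where
  "n_ADC R sc B n M \<longleftrightarrow>
     (\<forall>B' (N :: (nat \<Rightarrow> 'a) set).
        integral_lattice R fun_scale B' N \<and> lattice_rank fun_scale N = n \<and>
        space_represents sc B (module.span sc M) fun_scale B' (module.span fun_scale N)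
        \<longrightarrow> lattice_represents sc B M fun_scale B' N)"

text \<open>Maximality with respect to inclusion among the lattices on \<open>FM\<close> with norm in \<open>R\<close>.\<close>

definition maximal_lattice ::
    "'a::field set \<Rightarrow> ('a \<Rightarrow> 'v::ab_group_add \<Rightarrow> 'v) \<Rightarrow> ('v \<Rightarrow> 'v \<Rightarrow> 'a) \<Rightarrow> 'v set \<Rightarrow> bool" where
  "maximal_lattice R sc B M \<longleftrightarrow>
     integral_lattice R sc B M \<and>
     (\<forall>L. fg_submodule R sc L \<and> module.span sc L = module.span sc M \<and>
          norm_ideal R B L \<subseteq> R \<and> M \<subseteq> L \<longrightarrow> L = M)"

lemma vector_space_fun_scale: "vector_space (fun_scale :: 'a::field \<Rightarrow> _)"
  by unfold_locales (auto simp: fun_scale_def fun_eq_iff algebra_simps)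

lemma coordinates_exist:
  fixes sc' :: "'a::field \<Rightarrow> 'w::ab_group_add \<Rightarrow> 'w"
  assumes vs: "vector_space sc'" and fin: "finite S" and W: "W = module.span sc' S"
  obtains \<phi> :: "'w \<Rightarrow> nat \<Rightarrow> 'a" where "Vector_Spaces.linear sc' fun_scale \<phi>" "inj_on \<phi> W"
proof -
  interpret vector_space sc' by (rule vs)
  interpret F: vector_space "fun_scale :: 'a \<Rightarrow> _" by (rule vector_space_fun_scale)
  interpret P: vector_space_pair sc' "fun_scale :: 'a \<Rightarrow> _" ..
  obtain T where T: "T \<subseteq> S" "independent T" "span T = W"
    using maximal_independent_subset[of S] span_mono span_span W
    by (metis span_minimal subset_antisym subspace_span)
  have fT: "finite T" using T(1) fin finite_subset by blast
  obtain e :: "'w \<Rightarrow> nat" where e: "inj_on e T"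
    using fT finite_imp_inj_to_nat_seg by blast
  define u :: "'w \<Rightarrow> nat \<Rightarrow> 'a" where "u t = (\<lambda>i. if i = e t then 1 else 0)" for t
  define \<phi> where "\<phi> = P.construct T u"
  have lin: "Vector_Spaces.linear sc' fun_scale \<phi>"
    unfolding \<phi>_def by (rule P.linear_construct[OF T(2)])
  have bas: "\<phi> t = u t" if "t \<in> T" for t
    unfolding \<phi>_def by (rule P.construct_basis[OF T(2) that])
  interpret L: Vector_Spaces.linear sc' fun_scale \<phi> by (rule lin)
  have zero: "x = 0" if x: "x \<in> W" "\<phi> x = 0" for x
  proof -
    obtain c where c: "x = (\<Sum>t\<in>T. sc' (c t) t)"
      using x(1) T(3) span_finite[OF fT] by auto
    have ph: "\<phi> x = (\<Sum>t\<in>T. fun_scale (c t) (u t))"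
      unfolding c by (simp add: L.sum L.scale bas)
    have ap: "(\<Sum>t\<in>A. g t) i = (\<Sum>t\<in>A. g t i)" if "finite A" for A and g :: "'w \<Rightarrow> nat \<Rightarrow> 'a" and i
      using that by (induction A rule: finite_induct) auto
    have "c s = 0" if s: "s \<in> T" for s
    proof -
      have "0 = (\<Sum>t\<in>T. fun_scale (c t) (u t) (e s))"
        using ph x(2) ap[OF fT] by (metis zero_fun_apply)
      also have "\<dots> = (\<Sum>t\<in>T. if t = s then c s else 0)"
        by (rule sum.cong) (use e s in \<open>auto simp: fun_scale_def u_def inj_on_def\<close>)
      also have "\<dots> = c s" using fT s by simp
      finally show ?thesis by simp
    qed
    then show ?thesis unfolding c by simp
  qed
  have "inj_on \<phi> W"
  proof (rule inj_onI)
    fix x y assume "x \<in> W" "y \<in> W" "\<phi> x = \<phi> y"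
    then have "x - y = 0" using zero[of "x - y"] W span_diff L.diff by auto
    then show "x = y" by simp
  qed
  with lin show ?thesis by (rule that)
qed

lemma n_ADC_any_space:
  fixes sc' :: "'a::field \<Rightarrow> 'w::ab_group_add \<Rightarrow> 'w"
  assumes R: "0 \<in> R" "1 \<in> R" and adc: "n_ADC R sc B n M"
    and N: "integral_lattice R sc' B' N" and rk: "lattice_rank sc' N = n"
    and rep: "space_represents sc B (module.span sc M) sc' B' (module.span sc' N)"
  shows "lattice_represents sc B M sc' B' N"
proof -
  have nq: "nondegenerate_quadratic_space sc' (module.span sc' N) B'"
    using N by (simp add: integral_lattice_def)
  have vs: "vector_space sc'" using nq by (simp add: nondegenerate_quadratic_space_def)
  interpret vector_space sc' by (rule vs)
  interpret F: vector_space "fun_scale :: 'a \<Rightarrow> _" by (rule vector_space_fun_scale)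
  interpret P: vector_space_pair sc' "fun_scale :: 'a \<Rightarrow> _" ..
  obtain S where S: "finite S" "span N = span S"
    using nq by (auto simp: nondegenerate_quadratic_space_def)
  obtain \<phi> :: "'w \<Rightarrow> nat \<Rightarrow> 'a" where lin: "Vector_Spaces.linear sc' fun_scale \<phi>"
    and inj: "inj_on \<phi> (span N)"
    using coordinates_exist[OF vs S] .
  interpret L: Vector_Spaces.linear sc' fun_scale \<phi> by (rule lin)
  define \<psi> where "\<psi> = inv_into (span N) \<phi>"
  have \<psi>\<phi> [simp]: "\<psi> (\<phi> x) = x" if "x \<in> span N" for x
    using that inj by (simp add: \<psi>_def)
  define C where "C f g = B' (\<psi> f) (\<psi> g)" for f g
  have sp: "F.span (\<phi> ` X) = \<phi> ` span X" for X
    by (rule L.span_image)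
  have NS: "x \<in> span N" if "x \<in> N" for x using that by (rule span_base)
  have add [simp]: "\<psi> (\<phi> x + \<phi> y) = x + y" if "x \<in> span N" "y \<in> span N" for x y
    using that \<psi>\<phi>[of "x + y"] by (simp add: L.add span_add)
  have scl [simp]: "\<psi> (fun_scale c (\<phi> x)) = sc' c x" if "x \<in> span N" for x c
    using that \<psi>\<phi>[of "sc' c x"] by (simp add: L.scale span_scale)
  have zr: "\<phi> x = 0 \<longleftrightarrow> x = 0" if "x \<in> span N" for x
    using that inj span_zero by (metis L.zero \<psi>\<phi>)
  have nq': "nondegenerate_quadratic_space fun_scale (F.span (\<phi> ` N)) C"
  proof -
    have "F.span (\<phi> ` N) = F.span (\<phi> ` S)" "finite (\<phi> ` S)"
      using S by (simp_all add: sp)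
    then have "\<exists>S. finite S \<and> F.span (\<phi> ` N) = F.span S" by blast
    then show ?thesis
      using nq unfolding nondegenerate_quadratic_space_def
      by (auto simp: vector_space_fun_scale sp C_def zr)
  qed
  have fg': "fg_submodule R fun_scale (\<phi> ` N)"
  proof -
    obtain T where T: "finite T" and NT: "N = {\<Sum>v\<in>T. sc' (c v) v | c. \<forall>v\<in>T. c v \<in> R}"
      using N by (auto simp: integral_lattice_def fg_submodule_def)
    have True: "T \<subseteq> span N"
    proof
      fix t assume t: "t \<in> T"
      have "t = (\<Sum>v\<in>T. sc' (if v = t then 1 else 0) v)"
        using T t by (simp add: if_distrib[of "\<lambda>c. sc' c _"] cong: if_cong)
      then have "t \<in> N" unfolding NT using R by (intro CollectI exI[of _ "\<lambda>v. if v = t then 1 else 0"]) auto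
      then show "t \<in> span N" by (rule NS)
    qed
    have ij: "inj_on \<phi> T" using inj True inj_on_subset by blast
    have "\<phi> ` N = {\<Sum>v\<in>\<phi> ` T. fun_scale (c v) v | c. \<forall>v\<in>\<phi> ` T. c v \<in> R}" (is "_ = ?X")
    proof (intro equalityI subsetI)
      fix y assume "y \<in> \<phi> ` N"
      then obtain c where c: "y = \<phi> (\<Sum>v\<in>T. sc' (c v) v)" "\<forall>v\<in>T. c v \<in> R"
        unfolding NT by auto
      have "y = (\<Sum>v\<in>\<phi> ` T. fun_scale (c (\<psi> v)) v)"
        unfolding c(1) using True ij
        by (auto simp: L.sum L.scale sum.reindex intro!: sum.cong)
      moreover have "\<forall>v\<in>\<phi> ` T. c (\<psi> v) \<in> R" using c(2) True by auto
      ultimately show "y \<in> ?X" by (intro CollectI exI[of _ "\<lambda>v. c (\<psi> v)"]) auto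
    next
      fix y assume "y \<in> ?X"
      then obtain c where c: "y = (\<Sum>v\<in>\<phi> ` T. fun_scale (c v) v)" "\<forall>v\<in>\<phi> ` T. c v \<in> R"
        by auto
      have "y = \<phi> (\<Sum>v\<in>T. sc' (c (\<phi> v)) v)"
        unfolding c(1) using ij by (simp add: L.sum L.scale sum.reindex)
      moreover have "(\<Sum>v\<in>T. sc' (c (\<phi> v)) v) \<in> N"
        unfolding NT using c(2) by (intro CollectI exI[of _ "\<lambda>v. c (\<phi> v)"]) auto
      ultimately show "y \<in> \<phi> ` N" by blast
    qed
    then show ?thesis unfolding fg_submodule_def using T by blast
  qed
  have nm: "norm_ideal R C (\<phi> ` N) \<subseteq> norm_ideal R B' N"
  proof
    fix a assume "a \<in> norm_ideal R C (\<phi> ` N)"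
    then obtain T c where a: "a = (\<Sum>x\<in>T. c x * C x x)" "finite T" "T \<subseteq> \<phi> ` N" "\<forall>x\<in>T. c x \<in> R"
      by (auto simp: norm_ideal_def)
    then obtain U where U: "U \<subseteq> N" "finite U" "T = \<phi> ` U" by (meson finite_subset_image)
    have ij: "inj_on \<phi> U" using inj U(1) NS by (meson inj_on_subset subsetI subsetD)
    have "a = (\<Sum>x\<in>U. c (\<phi> x) * B' x x)"
      unfolding a(1) U(3) using U(1) NS ij
      by (auto simp: sum.reindex C_def subset_iff intro!: sum.cong)
    moreover have "\<forall>x\<in>U. c (\<phi> x) \<in> R" using a(4) U(3) by auto
    ultimately show "a \<in> norm_ideal R B' N"
      unfolding norm_ideal_def using U by (intro CollectI exI[of _ U] exI[of _ "\<lambda>x. c (\<phi> x)"]) auto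
  qed
  have il: "integral_lattice R fun_scale C (\<phi> ` N)"
    using nq' fg' nm N unfolding integral_lattice_def by auto
  have "F.dim (\<phi> ` span N) = dim (span N)"
  proof -
    obtain T where T: "T \<subseteq> span N" "independent T" "span N \<subseteq> span T" "card T = dim (span N)"
      using basis_exists[of "span N"] by blast
    have eq: "span T = span N"
      using T(1,3) span_minimal subspace_span by blast
    have ind: "F.independent (\<phi> ` T)"
      using P.linear_independent_injective_image[OF lin T(2)] inj eq by simp
    have "F.dim (\<phi> ` T) = card (\<phi> ` T)" by (rule F.dim_eq_card_independent[OF ind])
    also have "\<dots> = card T" using inj T(1) inj_on_subset card_image by blast
    finally show ?thesis using T(4) eq sp[of T] F.dim_span[of "\<phi> ` T"] by simp
  qed
  then have rk': "lattice_rank fun_scale (\<phi> ` N) = n"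
    using rk by (simp add: lattice_rank_def sp)
  have rp: "space_represents sc B (module.span sc M) fun_scale C (F.span (\<phi> ` N))"
  proof -
    obtain \<sigma> where "is_representation sc' B' (span N) sc B (module.span sc M) \<sigma>"
      using rep by (auto simp: space_represents_def)
    then have "is_representation fun_scale C (F.span (\<phi> ` N)) sc B (module.span sc M) (\<sigma> \<circ> \<psi>)"
      unfolding is_representation_def by (auto simp: sp C_def)
    then show ?thesis by (auto simp: space_represents_def)
  qed
  obtain \<tau> where \<tau>: "is_representation fun_scale C (F.span (\<phi> ` N)) sc B (module.span sc M) \<tau>"
    "\<tau> ` \<phi> ` N \<subseteq> M"
    using adc il rk' rp unfolding n_ADC_def lattice_represents_def by blast
  have "is_representation sc' B' (span N) sc B (module.span sc M) (\<tau> \<circ> \<phi>)"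
    using \<tau>(1) unfolding is_representation_def by (auto simp: sp C_def L.add L.scale)
  then show ?thesis
    unfolding lattice_represents_def using \<tau>(2) by (intro exI[of _ "\<tau> \<circ> \<phi>"]) auto
qed

end

theory Submission
  imports Defs
begin

text \<open>
  Write \<open>q x = B x x\<close>, \<open>b = 2 B\<close>, let \<open>p\<close> be a uniformizer of the ring of integers \<open>R\<close>, and put
  \<open>n = 2 l + 1\<close>. A maximal lattice represents everything its space represents, because maximal
  lattices on a space are isometric: each is a sum of hyperbolic planes and the set of integral
  vectors of the anisotropic complement (a lattice by Hensel's lemma), and reflections move any
  family of hyperbolic planes to any other one of the same size.

  Conversely let \<open>M\<close> be \<open>n\<close>-ADC and \<open>L \<supseteq> M\<close> maximal. Since the residue field is perfect of
  characteristic 2, \<open>L = K \<bottom> P\<close> with \<open>K\<close> unimodular for \<open>b\<close> of rank \<open>2 l\<close> and \<open>P\<close> binary, where either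
  \<open>P\<close> contains vectors \<open>u\<close>, \<open>e\<close> with \<open>q u\<close> a unit and \<open>q e\<close> of valuation 1, or \<open>P\<close> is \<open>p\<close>-modular.
  In the first case \<open>M\<close> represents \<open>K \<bottom> \<langle>q u\<rangle>\<close> and \<open>K \<bottom> \<langle>q e\<rangle>\<close>. The unimodular part splits off,
  so unless \<open>M\<close> is unimodular, the complement of \<open>K\<close> in \<open>M\<close> contains an Eisenstein form, hence all
  integral vectors of its space. In the second case \<open>M\<close> represents \<open>K \<bottom> \<langle>q e\<rangle>\<close> and
  \<open>K' \<bottom> \<langle>z\<rangle> \<bottom> P\<close> with \<open>z\<close> a unit and \<open>K'\<close> unimodular of rank \<open>2 l - 2\<close>; the latter forces \<open>P\<close> into the
  radical of \<open>M\<close> modulo \<open>p\<close>, so that the complement of \<open>K\<close> in \<open>M\<close> is \<open>p\<close>-modular and \<open>M = L\<close>.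
\<close>

section \<open>Modules over discrete valuation rings\<close>

text \<open>The absolute value of \<open>Q2\<close> is never extended to the field: that the ring of
  integers is a discrete valuation ring is derived from integrality, and completeness enters only
  through coordinates in \<open>Z2\<close>. In the converse direction, each use of the ADC property
  yields its own copy of K in M, and two such copies need not coincide. What links them is the
  radical of \<open>b\<close> modulo \<open>p\<close>. A vector of M that pairs into
  \<open>p R\<close> with all of M becomes orthogonal to any given frame in M after subtracting
  \<open>p\<close> times a vector of M. This leaves \<open>q\<close> unchanged modulo
  \<open>p\<close>, and leaves \<open>b\<close> of two such vectors unchanged modulo the square of
  \<open>p\<close>, so vectors obtained from one representation can be moved next to the frame of
  another. The parity of the rank enters through the complement of a frame: maximality allows at
  most three generators there, so an even rank leaves exactly two. The bound on n gives
  \<open>l \<ge> 1\<close>, hence a pair of K from which the unit vector z of the second case is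
  taken.\<close>

text \<open>The inductive form admits infinite \<open>S\<close>, such as a whole module with one
  vector adjoined. For finite \<open>S\<close> it agrees with the sums in
  \<open>fg_submodule\<close>, by \<open>rspan_finite\<close>.\<close>

inductive_set rspan :: "'a::field set \<Rightarrow> ('a \<Rightarrow> 'v::ab_group_add \<Rightarrow> 'v) \<Rightarrow> 'v set \<Rightarrow> 'v set"
  for R :: "'a set" and sc :: "'a \<Rightarrow> 'v \<Rightarrow> 'v" and S :: "'v set" where
  zero: "0 \<in> rspan R sc S"
| step: "\<lbrakk>v \<in> S; c \<in> R; w \<in> rspan R sc S\<rbrakk> \<Longrightarrow> sc c v + w \<in> rspan R sc S"

text \<open>Valuations are expressed by membership: \<open>x / p \<in> R\<close> is divisibility by
  \<open>p\<close>, and for \<open>x \<in> R\<close> its negation says that \<open>x\<close> is a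
  unit. The field of fractions may be smaller than the type, as for \<open>Z2\<close> inside an
  extension of \<open>Q2\<close>.\<close>

locale dvr_subring =
  fixes R :: "'a::field set" and p :: 'a
  assumes zero_in [simp]: "0 \<in> R" and one_in [simp]: "1 \<in> R"
    and diff_in: "\<lbrakk>x \<in> R; y \<in> R\<rbrakk> \<Longrightarrow> x - y \<in> R"
    and mult_in: "\<lbrakk>x \<in> R; y \<in> R\<rbrakk> \<Longrightarrow> x * y \<in> R"
    and p_in [simp]: "p \<in> R" and p_nonzero [simp]: "p \<noteq> 0" and inverse_p: "inverse p \<notin> R"
    and factor: "\<lbrakk>x \<in> R; x \<noteq> 0\<rbrakk> \<Longrightarrow> \<exists>k u. u \<in> R \<and> inverse u \<in> R \<and> u \<noteq> 0 \<and> x = p ^ k * u"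
begin

lemma uminus_in: "x \<in> R \<Longrightarrow> - x \<in> R"
  using diff_in[of 0 x] by simp

lemma add_in: "\<lbrakk>x \<in> R; y \<in> R\<rbrakk> \<Longrightarrow> x + y \<in> R"
  using diff_in[of x "- y"] uminus_in by simp

lemma power_in: "x \<in> R \<Longrightarrow> x ^ k \<in> R"
  by (induction k) (auto intro: mult_in)

lemma sum_in: "(\<And>i. i \<in> I \<Longrightarrow> f i \<in> R) \<Longrightarrow> sum f I \<in> R"
  by (induction I rule: infinite_finite_induct) (auto intro: add_in)

lemma of_nat_in: "of_nat k \<in> R"
  by (induction k) (auto intro: add_in)

lemma numeral_in: "numeral k \<in> R"
  using of_nat_in[of "numeral k"] by simp

lemmas ring_in = add_in diff_in mult_in uminus_in power_in numeral_in

lemma unit_or_dvd: "x \<in> R \<Longrightarrow> x / p \<in> R \<or> (x \<noteq> 0 \<and> inverse x \<in> R)"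
proof (cases "x = 0")
  case False
  assume "x \<in> R"
  then obtain k u where k: "u \<in> R" "inverse u \<in> R" "u \<noteq> 0" "x = p ^ k * u" using factor False by blast
  show ?thesis
  proof (cases k)
    case 0 then show ?thesis using k by auto
  next
    case (Suc j)
    then have "x / p = p ^ j * u" using k by simp
    then show ?thesis using k by (simp add: ring_in)
  qed
qed simp

lemma not_unit_and_dvd: "x / p \<in> R \<Longrightarrow> inverse x \<in> R \<Longrightarrow> x \<noteq> 0 \<Longrightarrow> False"
  using mult_in[of "x / p" "inverse x"] inverse_p by (simp add: field_simps)

lemma dvd_imp_in: "x / p \<in> R \<Longrightarrow> x \<in> R"
  using mult_in[OF p_in, of "x / p"] by simp

end

locale dvr_module = dvr_subring R p + vector_space sc
  for R :: "'a::field set" and p :: 'a and sc :: "'a \<Rightarrow> 'v::ab_group_add \<Rightarrow> 'v"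
begin

definition submod :: "'v set \<Rightarrow> bool" where
  "submod L \<longleftrightarrow> 0 \<in> L \<and> (\<forall>x\<in>L. \<forall>y\<in>L. x + y \<in> L) \<and> (\<forall>c\<in>R. \<forall>x\<in>L. sc c x \<in> L)"

abbreviation rsp :: "'v set \<Rightarrow> 'v set" where "rsp \<equiv> rspan R sc"

lemma submodD:
  assumes "submod L"
  shows "0 \<in> L" "x \<in> L \<Longrightarrow> y \<in> L \<Longrightarrow> x + y \<in> L" "c \<in> R \<Longrightarrow> x \<in> L \<Longrightarrow> sc c x \<in> L"
    "x \<in> L \<Longrightarrow> y \<in> L \<Longrightarrow> x - y \<in> L"
proof -
  show a: "0 \<in> L" "x \<in> L \<Longrightarrow> y \<in> L \<Longrightarrow> x + y \<in> L" "c \<in> R \<Longrightarrow> x \<in> L \<Longrightarrow> sc c x \<in> L" for x y c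
    using assms by (auto simp: submod_def)
  show "x \<in> L \<Longrightarrow> y \<in> L \<Longrightarrow> x - y \<in> L"
    using a(2)[of x "sc (-1) y"] a(3)[of "-1" y] uminus_in[of 1] by simp
qed

lemma submod_sum: "submod L \<Longrightarrow> (\<And>i. i \<in> I \<Longrightarrow> f i \<in> L) \<Longrightarrow> sum f I \<in> L"
  by (induction I rule: infinite_finite_induct) (auto simp: submodD)

lemma rspan_minimal: "submod L \<Longrightarrow> S \<subseteq> L \<Longrightarrow> rsp S \<subseteq> L"
proof
  fix x assume "submod L" "S \<subseteq> L" "x \<in> rsp S"
  from this(3,1,2) show "x \<in> L"
    by (induction rule: rspan.induct) (auto simp: submodD)
qed

lemma submod_rspan: "submod (rsp S)"
  unfolding submod_def
proof (intro conjI ballI)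
  show "0 \<in> rsp S" by (rule rspan.zero)
  show "x + y \<in> rsp S" if "x \<in> rsp S" "y \<in> rsp S" for x y
    using that(1) by induction (auto simp: that add.assoc intro: rspan.step)
  show "sc c x \<in> rsp S" if "c \<in> R" "x \<in> rsp S" for c x
    using that(2) by induction
      (auto simp: that(1) scale_right_distrib mult_in intro: rspan.zero intro!: rspan.step[of _ S _ R _ sc])
qed

lemmas rspan_add = submodD(2)[OF submod_rspan]
  and rspan_scale = submodD(3)[OF submod_rspan]
  and rspan_diff = submodD(4)[OF submod_rspan]
  and rspan_sum = submod_sum[OF submod_rspan]

lemma rspan_base: "v \<in> S \<Longrightarrow> v \<in> rsp S"
  using rspan.step[of v S 1 R 0 sc] rspan.zero[of R sc] by simp

lemma rspan_superset: "S \<subseteq> rsp S"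
  using rspan_base by blast

lemma rspan_mono: "S \<subseteq> T \<Longrightarrow> rsp S \<subseteq> rsp T"
  by (rule rspan_minimal[OF submod_rspan]) (use rspan_base in blast)

lemma rspan_insert: "x \<in> rsp (insert v S) \<longleftrightarrow> (\<exists>c\<in>R. \<exists>w\<in>rsp S. x = sc c v + w)"
proof
  assume "x \<in> rsp (insert v S)"
  then show "\<exists>c\<in>R. \<exists>w\<in>rsp S. x = sc c v + w"
  proof induction
    case zero show ?case by (intro bexI[of _ 0]) (auto intro: rspan.zero)
  next
    case (step v' c w)
    then obtain d w' where w: "d \<in> R" "w' \<in> rsp S" "w = sc d v + w'" by auto
    show ?case
    proof (cases "v' = v")
      case True
      then show ?thesis using w step
        by (intro bexI[of _ "c + d"] bexI[of _ w']) (auto simp: scale_left_distrib add_in)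
    next
      case False
      then show ?thesis using w step
        by (intro bexI[of _ d] bexI[of _ "sc c v' + w'"]) (auto intro: rspan.step)
    qed
  qed
next
  assume "\<exists>c\<in>R. \<exists>w\<in>rsp S. x = sc c v + w"
  then show "x \<in> rsp (insert v S)"
    using rspan_mono[of S "insert v S"] by (auto intro: rspan.step)
qed

lemma rspan_empty: "rsp {} = {0}"
  using rspan_minimal[of "{0}" "{}"] rspan.zero[of R sc "{}"] by (auto simp: submod_def)

lemma rspan_finite:
  assumes "finite S"
  shows "rsp S = {\<Sum>v\<in>S. sc (c v) v | c. \<forall>v\<in>S. c v \<in> R}" (is "_ = ?X S")
  using assms
proof (induction S rule: finite_induct)
  case empty
  then show ?case by (auto simp: rspan_empty)
next
  case (insert s S)
  show ?case
  proof (intro equalityI subsetI)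
    fix x assume "x \<in> rsp (insert s S)"
    then obtain d w where d: "d \<in> R" "w \<in> rsp S" "x = sc d s + w" by (auto simp: rspan_insert)
    then obtain c where c: "w = (\<Sum>v\<in>S. sc (c v) v)" "\<forall>v\<in>S. c v \<in> R"
      using insert.IH by auto
    have "(\<Sum>v\<in>S. sc (c v) v) = (\<Sum>v\<in>S. sc ((c(s := d)) v) v)"
      by (rule sum.cong) (use insert in auto)
    then show "x \<in> ?X (insert s S)"
      using c d insert.hyps by (intro CollectI exI[of _ "c(s := d)"]) auto
  next
    fix x assume "x \<in> ?X (insert s S)"
    then obtain c where "x = (\<Sum>v\<in>insert s S. sc (c v) v)" "\<forall>v\<in>insert s S. c v \<in> R" by auto
    then show "x \<in> rsp (insert s S)"
      by (simp only:) (intro rspan_sum rspan_scale rspan_base, auto)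
  qed
qed

lemma fg_submodule_iff: "fg_submodule R sc L \<longleftrightarrow> (\<exists>S. finite S \<and> L = rsp S)"
  unfolding fg_submodule_def proof (intro iffI; elim exE conjE)
  fix S assume S: "finite S" "L = {\<Sum>v\<in>S. sc (c v) v | c. \<forall>v\<in>S. c v \<in> R}"
  then have "L = rsp S" by (simp only: rspan_finite)
  then show "\<exists>S. finite S \<and> L = rsp S" using S(1) by blast
next
  fix S assume S: "finite S" "L = rsp S"
  then have "L = {\<Sum>v\<in>S. sc (c v) v | c. \<forall>v\<in>S. c v \<in> R}" by (simp only: rspan_finite)
  then show "\<exists>S. finite S \<and> L = {\<Sum>v\<in>S. sc (c v) v | c. \<forall>v\<in>S. c v \<in> R}" using S(1) by blast
qed

text \<open>The coordinate functionals \<open>f i\<close> are eliminated one at a time: an element of \<open>L\<close> on which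
  \<open>f i\<close> has least valuation generates \<open>L\<close> modulo the kernel of \<open>f i\<close>.\<close>

lemma finitely_generated_by_functionals:
  assumes "finite I" "submod L"
    and "\<And>i x y. i \<in> I \<Longrightarrow> f i (x + y) = f i x + f i y"
    and "\<And>i c x. i \<in> I \<Longrightarrow> f i (sc c x) = c * f i x"
    and "\<And>i x. i \<in> I \<Longrightarrow> x \<in> L \<Longrightarrow> f i x \<in> R"
    and "\<And>x. x \<in> L \<Longrightarrow> (\<And>i. i \<in> I \<Longrightarrow> f i x = 0) \<Longrightarrow> x = 0"
  shows "\<exists>T. finite T \<and> L = rsp T"
  using assms
proof (induction I arbitrary: L rule: finite_induct)
  case empty
  then have "L = rsp {}" by (auto simp: rspan_empty submod_def)
  then show ?case by blast
next
  case (insert i I)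
  note L = insert.prems(1) and fadd = insert.prems(2)[of i, simplified]
    and fsc = insert.prems(3)[of i, simplified]
  show ?case
  proof (cases "\<forall>x\<in>L. f i x = 0")
    case True
    show ?thesis
    proof (rule insert.IH[OF L])
      show "x = 0" if "x \<in> L" "\<And>j. j \<in> I \<Longrightarrow> f j x = 0" for x
        using insert.prems(5)[of x] that True by blast
    qed (simp_all add: insert.prems)
  next
    case False
    have ex: "\<exists>k x. x \<in> L \<and> f i x = p ^ k"
    proof -
      obtain x where x: "x \<in> L" "f i x \<noteq> 0" using False by blast
      then obtain k u where k: "u \<in> R" "inverse u \<in> R" "u \<noteq> 0" "f i x = p ^ k * u"
        using factor[of "f i x"] insert.prems(4)[of i x] by auto
      then have "f i (sc (inverse u) x) = p ^ k" by (simp add: fsc)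
      then show ?thesis using submodD(3)[OF L k(2) x(1)] by blast
    qed
    define k where "k = (LEAST k. \<exists>x. x \<in> L \<and> f i x = p ^ k)"
    obtain x0 where x0: "x0 \<in> L" "f i x0 = p ^ k"
      using LeastI_ex[OF ex] unfolding k_def by blast
    have dv: "\<exists>d\<in>R. f i x = d * p ^ k" if x: "x \<in> L" for x
    proof (cases "f i x = 0")
      case False
      then obtain j u where j: "u \<in> R" "inverse u \<in> R" "u \<noteq> 0" "f i x = p ^ j * u"
        using factor[of "f i x"] insert.prems(4)[of i x] x by auto
      then have "f i (sc (inverse u) x) = p ^ j" by (simp add: fsc)
      then have "k \<le> j" unfolding k_def using submodD(3)[OF L j(2) x] by (intro Least_le) blast
      then have "p ^ j = p ^ (j - k) * p ^ k" by (simp flip: power_add)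
      then have "f i x = (p ^ (j - k) * u) * p ^ k"
        unfolding j(4) by (simp only: ac_simps)
      then show ?thesis by (rule bexI) (simp add: ring_in j(1))
    qed (auto intro: bexI[of _ 0])
    have f0: "f i 0 = 0" using fsc[of 0 0] by simp
    have "submod {x \<in> L. f i x = 0}"
      using L unfolding submod_def by (auto simp: fadd fsc f0)
    then have "\<exists>T. finite T \<and> {x \<in> L. f i x = 0} = rsp T"
    proof (rule insert.IH)
      show "x = 0" if "x \<in> {x \<in> L. f i x = 0}" "\<And>j. j \<in> I \<Longrightarrow> f j x = 0" for x
        using insert.prems(5)[of x] that by blast
    qed (simp_all add: insert.prems)
    then obtain T where T: "finite T" "{x \<in> L. f i x = 0} = rsp T" by blast
    have "L = rsp (insert x0 T)"
    proof (intro equalityI subsetI)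
      fix x assume x: "x \<in> L"
      then obtain d where d: "d \<in> R" "f i x = d * p ^ k" using dv by blast
      have "x - sc d x0 \<in> L" using x x0 d submodD[OF L] by blast
      moreover have "f i (x - sc d x0) = 0"
        using fadd[of "x - sc d x0" "sc d x0"] d x0 by (simp add: fsc)
      ultimately have "x - sc d x0 \<in> rsp T" using T by blast
      then show "x \<in> rsp (insert x0 T)" unfolding rspan_insert using d(1) by (intro bexI[of _ d] bexI[of _ "x - sc d x0"]) auto
    next
      fix x assume "x \<in> rsp (insert x0 T)"
      then obtain c w where "c \<in> R" "w \<in> {x \<in> L. f i x = 0}" "x = sc c x0 + w"
        unfolding T(2) by (auto simp: rspan_insert)
      then show "x \<in> L" using x0 submodD[OF L] by simp
    qed
    then show ?thesis using T(1) by blast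
  qed
qed

text \<open>The generators may be dependent, so \<open>L\<close> has no coordinates of its own. It
  is lifted to the module \<open>L'\<close> of coefficient families on \<open>S\<close>, whose
  coordinates are the functionals required above, and recovered as the image under
  \<open>ev\<close>.\<close>

lemma submod_of_finitely_generated:
  assumes S: "finite S" and L: "submod L" "L \<subseteq> rsp S"
  shows "\<exists>T. finite T \<and> L = rsp T"
proof -
  interpret FS: dvr_module R p "\<lambda>c (f :: 'v \<Rightarrow> 'a) i. c * f i"
    by unfold_locales (auto simp: fun_eq_iff algebra_simps)
  define ev where "ev c = (\<Sum>v\<in>S. sc (c v) v)" for c
  define L' where "L' = {c. (\<forall>v. v \<notin> S \<longrightarrow> c v = 0) \<and> (\<forall>v\<in>S. c v \<in> R) \<and> ev c \<in> L}"
  have ev_add: "ev (c + d) = ev c + ev d" for c d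
    by (simp add: ev_def scale_left_distrib sum.distrib)
  have ev_sc: "ev (\<lambda>i. a * c i) = sc a (ev c)" for a c
    by (simp add: ev_def scale_sum_right)
  have ev0: "ev 0 = 0" by (simp add: ev_def)
  have "FS.submod L'"
    unfolding FS.submod_def L'_def
    by (auto simp: ev_add ev_sc ev0 add_in mult_in submodD[OF L(1)])
  then have "\<exists>T. finite T \<and> L' = FS.rsp T"
    by (rule FS.finitely_generated_by_functionals[OF S, of L' "\<lambda>v c. c v"])
      (auto simp: L'_def fun_eq_iff)
  then obtain T where T: "finite T" "L' = FS.rsp T" by blast
  have "L = ev ` L'"
  proof (intro equalityI subsetI)
    fix x assume x: "x \<in> L"
    then obtain c where c: "x = (\<Sum>v\<in>S. sc (c v) v)" "\<forall>v\<in>S. c v \<in> R"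
      using L(2) rspan_finite[OF S] by auto
    have "x = ev (\<lambda>v. if v \<in> S then c v else 0)"
      unfolding c ev_def by (rule sum.cong) auto
    then show "x \<in> ev ` L'" using c x by (intro image_eqI) (auto simp: L'_def)
  qed (auto simp: L'_def)
  also have "ev ` L' = ev ` FS.rsp T" using T(2) by simp
  also have "ev ` FS.rsp T = rsp (ev ` T)"
  proof (intro equalityI subsetI)
    fix x assume "x \<in> ev ` FS.rsp T"
    then obtain c where c: "c \<in> FS.rsp T" "x = ev c" by blast
    from c(1) have "ev c \<in> rsp (ev ` T)"
    proof induction
      case zero show ?case unfolding ev0 by (rule rspan.zero)
    next
      case (step v c w)
      then show ?case unfolding ev_add ev_sc by (intro rspan.step) auto
    qed
    then show "x \<in> rsp (ev ` T)" using c by simp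
  next
    fix x assume "x \<in> rsp (ev ` T)"
    then show "x \<in> ev ` FS.rsp T"
    proof induction
      case zero show ?case using ev0 rspan.zero by (metis image_eqI)
    next
      case (step v c w)
      then obtain t d where "t \<in> T" "v = ev t" "d \<in> FS.rsp T" "w = ev d" by blast
      then have "sc c v + w = ev ((\<lambda>i. c * t i) + d)" "(\<lambda>i. c * t i) + d \<in> FS.rsp T"
        unfolding ev_add ev_sc by (simp, intro rspan.step[OF _ step(2)])
      then show ?case by blast
    qed
  qed
  finally have "L = rsp (ev ` T)" .
  then show ?thesis using T(1) by blast
qed

text \<open>Gaussian elimination over a discrete valuation ring: pivoting on a coefficient of least
  valuation keeps all quotients in \<open>R\<close>. The coefficient prime to \<open>p\<close> makes
  the relation nontrivial modulo \<open>p\<close>.\<close>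

lemma relation_with_unit_coefficient:
  assumes "finite S" "finite I" "card S < card I" "\<And>i. i \<in> I \<Longrightarrow> f i \<in> rsp S"
  shows "\<exists>c. (\<forall>i\<in>I. c i \<in> R) \<and> (\<Sum>i\<in>I. sc (c i) (f i)) = 0 \<and> (\<exists>i\<in>I. c i / p \<notin> R)"
  using assms
proof (induction S arbitrary: I f rule: finite_induct)
  case empty
  then obtain i where "i \<in> I" by (metis card_gt_0_iff all_not_in_conv card.empty)
  moreover have "f j = 0" if "j \<in> I" for j using empty that by (auto simp: rspan_empty)
  ultimately show ?case using inverse_p by (intro exI[of _ "\<lambda>_. 1"]) (auto simp: inverse_eq_divide)
next
  case (insert s S)
  have "\<exists>a w. a \<in> R \<and> w \<in> rsp S \<and> f i = sc a s + w" if "i \<in> I" for i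
    using insert.prems(3)[OF that] by (auto simp: rspan_insert)
  then obtain a w where aw: "\<And>i. i \<in> I \<Longrightarrow> a i \<in> R \<and> w i \<in> rsp S \<and> f i = sc (a i) s + w i"
    by metis
  show ?case
  proof (cases "\<forall>i\<in>I. a i = 0")
    case True
    have "f i \<in> rsp S" if "i \<in> I" for i using aw True that by auto
    then show ?thesis using insert.IH[of I f] insert.prems insert.hyps by auto
  next
    case False
    define P where "P k \<longleftrightarrow> (\<exists>i\<in>I. \<exists>u. u \<in> R \<and> inverse u \<in> R \<and> u \<noteq> 0 \<and> a i = p ^ k * u)" for k
    have "\<exists>k. P k" using False factor aw unfolding P_def by metis
    then have Pk: "P (LEAST k. P k)" by (rule LeastI_ex)
    then obtain i0 u where i0: "i0 \<in> I" "u \<in> R" "inverse u \<in> R" "u \<noteq> 0" "a i0 = p ^ (LEAST k. P k) * u"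
      unfolding P_def by blast
    have "\<exists>d\<in>R. a i = d * a i0" if i: "i \<in> I" for i
    proof (cases "a i = 0")
      case False
      then obtain j v where v: "v \<in> R" "inverse v \<in> R" "v \<noteq> 0" "a i = p ^ j * v"
        using factor aw i by blast
      then have "P j" unfolding P_def using i by blast
      then have le: "(LEAST k. P k) \<le> j" by (rule Least_le)
      show ?thesis
      proof (intro bexI)
        show "a i = (p ^ (j - (LEAST k. P k)) * v * inverse u) * a i0"
          using le i0 v by (simp add: field_simps power_add[symmetric])
      qed (use v i0 in \<open>auto intro!: ring_in\<close>)
    qed (auto intro: bexI[of _ 0])
    then obtain d where d: "\<And>i. i \<in> I \<Longrightarrow> d i \<in> R \<and> a i = d i * a i0" by metis
    define g where "g i = f i - sc (d i) (f i0)" for i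
    have "g i \<in> rsp S" if "i \<in> I - {i0}" for i
    proof -
      have "g i = w i - sc (d i) (w i0)"
        using aw[of i] aw[of i0] d[of i] that i0 by (simp add: g_def scale_right_distrib)
      then show ?thesis using aw d that i0 by (auto intro!: rspan_diff rspan_scale)
    qed
    moreover have "card S < card (I - {i0})" using insert.prems insert.hyps i0 by simp
    ultimately obtain c where c: "\<forall>i\<in>I - {i0}. c i \<in> R" "(\<Sum>i\<in>I - {i0}. sc (c i) (g i)) = 0"
      "\<exists>i\<in>I - {i0}. c i / p \<notin> R"
      using insert.IH[of "I - {i0}" g] insert.prems by auto
    \<comment> \<open>The pivot gets the coefficient that compensates the multiples of
      \<open>f i0\<close> subtracted in the \<open>g i\<close>. All others are kept, and with them
      the one that \<open>p\<close> does not divide.\<close>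
    define c' where "c' = c(i0 := - (\<Sum>i\<in>I - {i0}. c i * d i))"
    have "(\<Sum>i\<in>I. sc (c' i) (f i)) = sc (c' i0) (f i0) + (\<Sum>i\<in>I - {i0}. sc (c' i) (f i))"
      using i0 insert.prems by (simp add: sum.remove)
    also have "(\<Sum>i\<in>I - {i0}. sc (c' i) (f i)) = (\<Sum>i\<in>I - {i0}. sc (c i) (g i) + sc (c i * d i) (f i0))"
      by (rule sum.cong) (auto simp: c'_def g_def scale_right_diff_distrib)
    also have "\<dots> = sc (\<Sum>i\<in>I - {i0}. c i * d i) (f i0)"
      using c by (simp add: sum.distrib scale_sum_left)
    finally have "(\<Sum>i\<in>I. sc (c' i) (f i)) = 0" by (simp add: c'_def)
    moreover have "\<forall>i\<in>I. c' i \<in> R"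
      using c d by (auto simp: c'_def intro!: uminus_in sum_in mult_in)
    moreover have "\<exists>i\<in>I. c' i / p \<notin> R" using c(3) by (auto simp: c'_def)
    ultimately show ?thesis by blast
  qed
qed

end

text \<open>The interface between arithmetic and lattice theory. \<open>residue_square\<close> says
  that the residue field is perfect, and \<open>two\<close> that it has characteristic 2. Modulo
  \<open>p\<close> the polynomial in \<open>hensel\<close> has 0 as a simple root; only the
  existence of some root is recorded.\<close>

locale dyadic_dvr = dvr_subring R p for R :: "'a::field_char_0 set" and p :: 'a +
  assumes fraction: "\<exists>k. p ^ k * x \<in> R"
    and two: "2 / p \<in> R"
    and residue_square: "a \<in> R \<Longrightarrow> \<exists>t\<in>R. (a - t\<^sup>2) / p \<in> R"
    and hensel: "\<lbrakk>a \<in> R; c \<in> R\<rbrakk> \<Longrightarrow> \<exists>s. a * s\<^sup>2 + s + p * c = 0"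

section \<open>The 2-adic integers\<close>

lemma two_adic_abs_le_1_iff: "two_adic_abs r \<le> 1 \<longleftrightarrow> (\<exists>a b. odd b \<and> r = of_int a / of_int b)"
proof -
  obtain m d where md: "quotient_of r = (m, d)" by (cases "quotient_of r")
  then have d: "d > 0" "coprime m d" "r = of_int m / of_int d"
    using quotient_of_denom_pos quotient_of_coprime quotient_of_div by blast+
  have den: "odd d" if r: "odd b" "r = of_int a / of_int b" for a b
  proof
    assume "even d"
    have "b \<noteq> 0" using r by auto
    then have "(of_int (m * b) :: rat) = of_int (a * d)" using d r by (simp add: field_simps)
    then have "m * b = a * d" by (simp only: of_int_eq_iff)
    then have "d dvd b" using d(2) coprime_dvd_mult_right_iff[of d m b] by (simp add: coprime_commute)
    then show False using \<open>even d\<close> r(1) by (meson dvd_trans)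
  qed
  show ?thesis
  proof
    assume *: "\<exists>a b. odd b \<and> r = of_int a / of_int b"
    then have "odd d" using den by blast
    then have "multiplicity 2 d = 0" by (simp add: not_dvd_imp_multiplicity_0)
    then show "two_adic_abs r \<le> 1"
      unfolding two_adic_abs_def md by (simp add: power_int_minus inverse_le_1_iff)
  next
    assume r: "two_adic_abs r \<le> 1"
    show "\<exists>a b. odd b \<and> r = of_int a / of_int b"
    proof (cases "even d")
      case True
      then have "odd m" using d(2) coprime_common_divisor[of m d 2] by auto
      then have "multiplicity 2 m = 0" by (simp add: not_dvd_imp_multiplicity_0)
      moreover have "multiplicity 2 d > 0"
        using True d(1) by (simp add: multiplicity_gt_zero_iff)
      moreover have "r \<noteq> 0" using \<open>odd m\<close> d by auto
      ultimately have "two_adic_abs r = 2 ^ multiplicity 2 d" "multiplicity 2 d \<ge> 1"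
        unfolding two_adic_abs_def md by auto
      then have "two_adic_abs r \<ge> 2"
        using power_increasing[of 1 "multiplicity 2 d" "2::real"] by simp
      then show ?thesis using r by simp
    next
      case False then show ?thesis using d by blast
    qed
  qed
qed

lemma two_adic_abs_powi: "r \<noteq> 0 \<Longrightarrow> \<exists>j. two_adic_abs r = 2 powi j"
  unfolding two_adic_abs_def by auto

context two_adic_numbers
begin

abbreviation "Z2 \<equiv> two_adic_integers Q2 nrm"

lemma uminus_mem: "x \<in> Q2 \<Longrightarrow> - x \<in> Q2"
  using diff_mem[OF zero_mem] by simp

lemma add_mem: "x \<in> Q2 \<Longrightarrow> y \<in> Q2 \<Longrightarrow> x + y \<in> Q2"
  using diff_mem[of x "- y"] uminus_mem by simp

lemma divide_mem: "x \<in> Q2 \<Longrightarrow> y \<in> Q2 \<Longrightarrow> x / y \<in> Q2"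
  using mult_mem inverse_mem by (simp add: divide_inverse)

lemma of_nat_mem: "of_nat k \<in> Q2"
  by (induction k) (auto intro: zero_mem one_mem add_mem)

lemma of_int_mem: "of_int k \<in> Q2"
  by (cases k) (auto intro: of_nat_mem uminus_mem simp del: of_nat_Suc)

lemma of_rat_mem: "of_rat r \<in> Q2"
proof -
  obtain m d where "quotient_of r = (m, d)" by (cases "quotient_of r")
  then have "r = of_int m / of_int d" by (rule quotient_of_div)
  then show ?thesis by (simp add: of_rat_divide of_int_mem divide_mem)
qed

lemma two_power_mem: "2 ^ k \<in> Q2"
  using of_nat_mem[of "2 ^ k"] by simp

lemma nrm_1: "nrm 1 = 1"
  using nrm_mult[OF one_mem one_mem] nrm_eq_0_iff[OF one_mem] by simp

lemma nrm_minus: assumes "x \<in> Q2" shows "nrm (- x) = nrm x"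
proof -
  have m: "-1 \<in> Q2" using uminus_mem one_mem by blast
  have "nrm (-1) * nrm (-1) = 1" using nrm_mult[OF m m] nrm_1 by simp
  then have "nrm (-1) = 1" using nrm_nonneg[OF m] power2_eq_1_iff[of "nrm (-1)"] by (auto simp: power2_eq_square)
  then show ?thesis using nrm_mult[OF m assms] by simp
qed

lemma nrm_divide: assumes "x \<in> Q2" "y \<in> Q2" "y \<noteq> 0" shows "nrm (x / y) = nrm x / nrm y"
  using nrm_mult[OF divide_mem[OF assms(1,2)] assms(2)] nrm_eq_0_iff[OF assms(2)] assms(3)
  by (simp add: field_simps)

lemma nrm_diff_commute: "x \<in> Q2 \<Longrightarrow> y \<in> Q2 \<Longrightarrow> nrm (x - y) = nrm (y - x)"
  using nrm_minus[of "x - y"] diff_mem by simp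

lemma nrm_2_power: "nrm (2 ^ k) = 1 / 2 ^ k"
proof -
  have "nrm (of_rat 2) = 1 / 2" unfolding nrm_of_rat
  proof -
    have "quotient_of 2 = (2, 1)" using quotient_of_int[of 2] by simp
    then show "two_adic_abs 2 = 1 / 2" by (simp add: two_adic_abs_def power_int_minus)
  qed
  then have 2: "nrm 2 = 1 / 2" by simp
  show ?thesis
  proof (induction k)
    case 0 then show ?case by (simp add: nrm_1)
  next
    case (Suc k)
    then show ?case using nrm_mult[of 2 "2 ^ k"] two_power_mem[of k] two_power_mem[of 1] 2 by simp
  qed
qed

lemma of_rat_in_Z2_iff: "of_rat r \<in> Z2 \<longleftrightarrow> (\<exists>a b. odd b \<and> r = of_int a / of_int b)"
  by (simp add: two_adic_integers_def of_rat_mem nrm_of_rat two_adic_abs_le_1_iff)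

text \<open>The norm of a nonzero rational is a power of 2, so a rational of norm below 2 has norm
  at most 1.\<close>

lemma Z2_approx:
  assumes "x \<in> Z2" "0 < e" "e < 1"
  shows "\<exists>r. of_rat r \<in> Z2 \<and> nrm (x - of_rat r) < e"
proof -
  have x: "x \<in> Q2" "nrm x \<le> 1" using assms by (auto simp: two_adic_integers_def)
  obtain r where r: "nrm (x - of_rat r) < e" using rat_dense x assms by blast
  have "nrm (of_rat r) \<le> nrm (of_rat r - x) + nrm x"
    using nrm_triangle[of "of_rat r - x" x] diff_mem of_rat_mem x by simp
  then have "nrm (of_rat r) < 2"
    using r x assms nrm_diff_commute[OF x(1) of_rat_mem, of r] by simp
  moreover have "two_adic_abs r \<le> 1" if "two_adic_abs r < 2"
  proof (cases "r = 0")
    case False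
    then obtain j where j: "two_adic_abs r = 2 powi j" using two_adic_abs_powi by blast
    then have "(2::real) powi j < 2 powi 1" using that by simp
    then have "j < 1" using power_int_increasing[of 1 j "2::real"] by (meson linorder_not_le one_le_numeral order_trans not_less)
    then show ?thesis using j power_int_increasing[of j 0 "2::real"] by simp
  qed (simp add: two_adic_abs_def)
  ultimately have "of_rat r \<in> Z2"
    by (simp add: two_adic_integers_def of_rat_mem nrm_of_rat)
  then show ?thesis using r by blast
qed

lemma rat_add_Z2: "of_rat r \<in> Z2 \<Longrightarrow> of_rat s \<in> Z2 \<Longrightarrow> of_rat (r + s) \<in> Z2"
proof -
  assume "of_rat r \<in> Z2" "of_rat s \<in> Z2"
  then obtain a b c d where "odd b" "r = of_int a / of_int b" "odd d" "s = of_int c / of_int d"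
    unfolding of_rat_in_Z2_iff by blast
  moreover have "r + s = of_int (a * d + c * b) / of_int (b * d)"
  proof -
    have "b \<noteq> 0" "d \<noteq> 0" using calculation by auto
    then show ?thesis using calculation by (simp add: field_simps)
  qed
  ultimately show ?thesis unfolding of_rat_in_Z2_iff
    by (intro exI[of _ "a * d + c * b"] exI[of _ "b * d"]) auto
qed

text \<open>Only the ordinary triangle inequality is assumed. For rationals with odd denominator
  closure under addition is arithmetic; approximation carries it over, the norm of the sum exceeding
  1 by at most the total error.\<close>

lemma Z2_add: assumes "x \<in> Z2" "y \<in> Z2" shows "x + y \<in> Z2"
proof -
  have xy: "x \<in> Q2" "y \<in> Q2" using assms by (auto simp: two_adic_integers_def)
  have "nrm (x + y) \<le> 1 + e" if "0 < e" for e
  proof -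
    define e' where "e' = min (e / 2) (1 / 2)"
    have e': "0 < e'" "e' < 1" "2 * e' \<le> e" using that by (auto simp: e'_def)
    obtain r where r: "of_rat r \<in> Z2" "nrm (x - of_rat r) < e'" using Z2_approx[OF assms(1)] e' by blast
    obtain s where s: "of_rat s \<in> Z2" "nrm (y - of_rat s) < e'" using Z2_approx[OF assms(2)] e' by blast
    have "nrm (of_rat (r + s)) \<le> 1" using rat_add_Z2[OF r(1) s(1)] by (simp add: two_adic_integers_def)
    moreover have "x + y = of_rat (r + s) + ((x - of_rat r) + (y - of_rat s))" by (simp add: of_rat_add)
    then have "nrm (x + y) \<le> nrm (of_rat (r + s)) + nrm ((x - of_rat r) + (y - of_rat s))"
      using nrm_triangle[of "of_rat (r + s)" "(x - of_rat r) + (y - of_rat s)"] xy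
      by (simp only: of_rat_mem add_mem diff_mem)
    moreover have "nrm ((x - of_rat r) + (y - of_rat s)) \<le> nrm (x - of_rat r) + nrm (y - of_rat s)"
      using xy by (intro nrm_triangle diff_mem of_rat_mem)
    ultimately show ?thesis using r s e' by linarith
  qed
  then have "nrm (x + y) \<le> 1" by (rule field_le_epsilon)
  then show ?thesis using xy by (simp add: two_adic_integers_def add_mem)
qed

lemma Z2_uminus: "x \<in> Z2 \<Longrightarrow> - x \<in> Z2"
  by (simp add: two_adic_integers_def uminus_mem nrm_minus)

lemma Z2_mult: "x \<in> Z2 \<Longrightarrow> y \<in> Z2 \<Longrightarrow> x * y \<in> Z2"
  by (simp add: two_adic_integers_def mult_mem nrm_mult nrm_nonneg mult_le_one)

text \<open>A rational \<open>r\<close> close enough to \<open>x\<close> has the same norm: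
  \<open>x / r\<close> and \<open>r / x\<close> both differ from 1 by an element of
  \<open>Z2\<close>, so both lie in \<open>Z2\<close>.\<close>

lemma nrm_powi: assumes x: "x \<in> Q2" "x \<noteq> 0" shows "\<exists>j. nrm x = 2 powi j"
proof -
  have n: "nrm x > 0" using nrm_nonneg nrm_eq_0_iff x by (metis less_eq_real_def)
  obtain r where r: "nrm (x - of_rat r) < nrm x / 2" using rat_dense[of x "nrm x / 2"] x n by auto
  have "nrm x \<le> nrm (x - of_rat r) + nrm (of_rat r)"
    using nrm_triangle[of "x - of_rat r" "of_rat r"] x diff_mem of_rat_mem by simp
  then have rn: "nrm (of_rat r) > nrm x / 2" using r by simp
  then have r0: "r \<noteq> 0" using n nrm_eq_0_iff[OF zero_mem] by auto
  have 1: "1 \<in> Z2" by (simp add: two_adic_integers_def one_mem nrm_1)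
  have "(x - of_rat r) / of_rat r \<in> Z2"
    using r rn r0 x n by (simp add: two_adic_integers_def diff_mem divide_mem of_rat_mem nrm_divide divide_le_eq_1)
  from Z2_add[OF 1 this] have "x / of_rat r \<in> Z2" using r0 by (simp add: field_simps)
  then have le1: "nrm x \<le> nrm (of_rat r)"
    using r0 x rn n by (simp add: two_adic_integers_def nrm_divide of_rat_mem divide_le_eq)
  have "(of_rat r - x) / x \<in> Z2"
    using r x n nrm_diff_commute[OF x(1) of_rat_mem, of r]
    by (simp add: two_adic_integers_def diff_mem divide_mem of_rat_mem nrm_divide)
  from Z2_add[OF 1 this] have "of_rat r / x \<in> Z2" using x by (simp add: field_simps)
  then have "nrm (of_rat r) \<le> nrm x"
    using x n by (simp add: two_adic_integers_def nrm_divide of_rat_mem divide_le_eq)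
  with le1 show ?thesis using two_adic_abs_powi[OF r0] by (simp add: nrm_of_rat)
qed

lemma Z2_dvr: "dvr_subring Z2 2"
proof
  show "0 \<in> Z2" "1 \<in> Z2" using nrm_eq_0_iff[OF zero_mem]
    by (auto simp: two_adic_integers_def zero_mem one_mem nrm_1)
  show "x - y \<in> Z2" if "x \<in> Z2" "y \<in> Z2" for x y
    using Z2_add[OF that(1) Z2_uminus[OF that(2)]] by simp
  show "x * y \<in> Z2" if "x \<in> Z2" "y \<in> Z2" for x y using Z2_mult that .
  show "2 \<in> Z2" using two_power_mem[of 1] nrm_2_power[of 1] by (simp add: two_adic_integers_def)
  show "(2::'a) \<noteq> 0" by simp
  show "inverse 2 \<notin> Z2"
    using nrm_divide[OF one_mem two_power_mem[of 1]] nrm_2_power[of 1]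
    by (simp add: two_adic_integers_def nrm_1 inverse_eq_divide)
  show "\<exists>k u. u \<in> Z2 \<and> inverse u \<in> Z2 \<and> u \<noteq> 0 \<and> x = 2 ^ k * u" if x0: "x \<in> Z2" "x \<noteq> 0" for x
  proof -
    have x: "x \<in> Q2" "nrm x \<le> 1" using that by (auto simp: two_adic_integers_def)
    obtain j where j: "nrm x = 2 powi j" using nrm_powi[OF x(1) x0(2)] by blast
    then have "(2::real) powi j \<le> 2 powi 0" using x by simp
    then have j0: "j \<le> 0" using power_int_strict_increasing[of 0 j "2::real"] by fastforce
    define k where "k = nat (- j)"
    have k: "nrm x = 1 / 2 ^ k"
    proof -
      have "j = - int k" using j0 by (simp add: k_def)
      then show ?thesis using j by (simp add: power_int_minus divide_inverse)
    qed
    define u where "u = x / 2 ^ k"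
    have u: "nrm u = 1" "u \<in> Q2" "u \<noteq> 0"
      using k x two_power_mem that by (auto simp: u_def nrm_divide nrm_2_power divide_mem)
    moreover have "nrm (inverse u) = 1"
      using nrm_divide[OF one_mem u(2,3)] u by (simp add: nrm_1 inverse_eq_divide)
    moreover have "x = 2 ^ k * u" by (simp add: u_def)
    ultimately show ?thesis
      by (intro exI[of _ k] exI[of _ u]) (auto simp: two_adic_integers_def inverse_mem)
  qed
qed

sublocale Z2: dvr_module Z2 "2 :: 'a" "(*)"
  by (intro dvr_module.intro Z2_dvr vector_space.intro) (simp_all add: algebra_simps)

text \<open>For the regular module, \<open>scale_scale\<close> is associativity reversed and makes the simplifier loop.\<close>

declare Z2.scale_scale [simp del]

lemma nrm_le_iff: "x / 2 ^ k \<in> Z2 \<longleftrightarrow> x \<in> Q2 \<and> nrm x \<le> 1 / 2 ^ k"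
proof -
  have "x / 2 ^ k \<in> Q2 \<longleftrightarrow> x \<in> Q2"
    using divide_mem[OF _ two_power_mem] mult_mem[OF _ two_power_mem, of "x / 2 ^ k" k] by auto
  then show ?thesis
    by (auto simp: two_adic_integers_def nrm_divide two_power_mem nrm_2_power field_simps)
qed

text \<open>The residue field has two elements, told apart by the parity of the numerator of an
  approximating rational.\<close>

lemma Z2_residue: assumes "x \<in> Z2" shows "x / 2 \<in> Z2 \<or> (x - 1) / 2 \<in> Z2"
proof -
  obtain r where r: "of_rat r \<in> Z2" "nrm (x - of_rat r) < 1 / 2"
    using Z2_approx[OF assms, of "1 / 2"] by auto
  have x: "x \<in> Q2" using assms by (simp add: two_adic_integers_def)
  have xr: "(x - of_rat r) / 2 \<in> Z2"
    using nrm_le_iff[of "x - of_rat r" 1] r x by (simp add: diff_mem of_rat_mem)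
  obtain a b where ab: "odd b" "r = of_int a / of_int b" using r(1) of_rat_in_Z2_iff by blast
  then have b: "b \<noteq> 0" by auto
  show ?thesis
  proof (cases "even a")
    case True
    then obtain c where "a = 2 * c" by auto
    then have "of_rat (r / 2) \<in> Z2" unfolding of_rat_in_Z2_iff using ab by (intro exI[of _ c] exI[of _ b]) auto
    from Z2_add[OF this xr] show ?thesis by (simp add: of_rat_divide diff_divide_distrib)
  next
    case False
    then have "even (a - b)" using ab(1) by simp
    then obtain c where "a - b = 2 * c" by (rule evenE)
    then have "a = 2 * c + b" by simp
    then have "(r - 1) / 2 = of_int c / of_int b" using ab b by (simp add: field_simps)
    then have "of_rat ((r - 1) / 2) \<in> Z2" unfolding of_rat_in_Z2_iff using ab by blast
    from Z2_add[OF this xr] show ?thesis by (simp add: of_rat_divide of_rat_diff diff_divide_distrib)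
  qed
qed

text \<open>Completeness in algebraic form: the sum of a 2-adic series is characterized by
  congruences modulo powers of 2. All later convergence arguments use this form.\<close>

lemma Z2_series:
  assumes d: "\<And>j. d j \<in> Z2"
  shows "\<exists>l\<in>Z2. \<forall>n. (l - (\<Sum>j<n. 2 ^ j * d j)) / 2 ^ n \<in> Z2"
proof -
  define X where "X n = (\<Sum>j<n. 2 ^ j * d j)" for n
  have X: "X n \<in> Z2" for n unfolding X_def by (intro Z2.sum_in Z2.mult_in Z2.power_in Z2.numeral_in d)
  then have XQ: "X n \<in> Q2" for n by (simp add: two_adic_integers_def)
  have dif: "(X (n + m) - X n) / 2 ^ n \<in> Z2" for n m
  proof (induction m)
    case (Suc m)
    have "(X (n + Suc m) - X n) / 2 ^ n = (X (n + m) - X n) / 2 ^ n + 2 ^ m * d (n + m)"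
    proof -
      have "X (n + Suc m) - X n = (X (n + m) - X n) + 2 ^ n * (2 ^ m * d (n + m))"
        by (simp add: X_def power_add)
      then show ?thesis by (simp only: add_divide_distrib) simp
    qed
    then show ?case using Suc d by (simp add: Z2.ring_in)
  qed simp
  have close: "nrm (X i - X j) \<le> 1 / 2 ^ n" if "n \<le> i" "n \<le> j" for i j n
  proof -
    have "((X i - X n) / 2 ^ n) - ((X j - X n) / 2 ^ n) \<in> Z2"
      using dif[of n "i - n"] dif[of n "j - n"] that by (intro Z2.diff_in) auto
    then have "(X i - X j) / 2 ^ n \<in> Z2" by (simp add: diff_divide_distrib)
    then show ?thesis by (simp add: nrm_le_iff)
  qed
  have "\<exists>N. \<forall>i\<ge>N. \<forall>j\<ge>N. nrm (X i - X j) < e" if e: "0 < e" for e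
  proof -
    obtain N where "(1 / 2 :: real) ^ N < e" using real_arch_pow_inv[OF e, of "1 / 2"] by auto
    then have "nrm (X i - X j) < e" if "i \<ge> N" "j \<ge> N" for i j
      using close[OF that] by (simp add: power_divide)
    then show ?thesis by blast
  qed
  then obtain l where l: "l \<in> Q2" "(\<lambda>i. nrm (X i - l)) \<longlonglongrightarrow> 0"
    using complete[of X] XQ by blast
  have all: "(l - X n) / 2 ^ n \<in> Z2" for n
  proof -
    have "eventually (\<lambda>i. nrm (X i - l) < 1 / 2 ^ n \<and> n \<le> i) sequentially"
      using order_tendstoD(2)[OF l(2), of "1 / 2 ^ n"] by (simp add: eventually_conj eventually_ge_at_top)
    then obtain i where i: "nrm (X i - l) < 1 / 2 ^ n" "n \<le> i"
      using eventually_happens'[OF sequentially_bot] by blast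
    then have "(X i - l) / 2 ^ n \<in> Z2" using nrm_le_iff l XQ diff_mem by simp
    moreover have "(X i - X n) / 2 ^ n \<in> Z2" using dif[of n "i - n"] i by simp
    ultimately have "(X i - X n) / 2 ^ n - (X i - l) / 2 ^ n \<in> Z2" by (rule Z2.diff_in[rotated])
    then show ?thesis by (simp add: diff_divide_distrib)
  qed
  then have "l \<in> Z2" using all[of 0] by (simp add: X_def)
  then show ?thesis using all unfolding X_def by blast
qed

end

section \<open>The ring of integers of a dyadic local field\<close>

context dyadic_local_field
begin

declare Z2.scale_scale [simp del]

abbreviation "Oint \<equiv> ring_of_integers Q2 nrm"
abbreviation "zsp \<equiv> Z2.rsp"

section \<open>Integral elements form a ring with the whole field as fractions\<close>

lemma zsp_mult:
  assumes "w \<in> zsp S" "v \<in> zsp T"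
  shows "w * v \<in> zsp ((\<lambda>(s, t). s * t) ` (S \<times> T))" (is "_ \<in> zsp ?P")
  using assms(1)
proof (induction rule: rspan.induct)
  case (step s c w)
  have "s * v \<in> zsp ?P" using assms(2)
  proof (induction rule: rspan.induct)
    case (step t d w)
    have "s * (d * t + w) = d * (s * t) + s * w" by (simp add: algebra_simps)
    moreover have "s * t \<in> ?P" using step(1) \<open>s \<in> S\<close> by (intro image_eqI[of _ _ "(s, t)"]) simp_all
    then have "d * (s * t) + s * w \<in> zsp ?P" using step(2,4) by (rule rspan.step)
    ultimately show ?case by (simp only:)
  qed (simp add: rspan.zero)
  then have "c * (s * v) + w * v \<in> zsp ?P"
    using step by (intro Z2.rspan_add Z2.rspan_scale[of c "s * v"])
  then show ?case by (simp add: algebra_simps)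
qed (simp add: rspan.zero)

lemma zsp_powers_closed: "x ^ n \<in> zsp S"
  if x: "1 \<in> zsp S" "\<And>s. s \<in> S \<Longrightarrow> x * s \<in> zsp S"
proof (induction n)
  case (Suc n)
  from this have "x * x ^ n \<in> zsp S"
  proof (induction rule: rspan.induct)
    case (step v c w)
    have "x * (c * v + w) = c * (x * v) + x * w" by (simp add: algebra_simps)
    then show ?case using step x(2) by (simp add: Z2.rspan_add Z2.rspan_scale)
  qed (simp add: rspan.zero)
  then show ?case by simp
qed (use x in simp)

text \<open>This criterion makes sums and products easy, since products of generators generate
  again. For the converse, the module of all powers lies in a finitely generated one, so it is
  generated by powers up to some \<open>K\<close>; writing \<open>x ^ Suc K\<close> in terms of
  these gives a monic equation.\<close>

lemma integral_iff_powers: "x \<in> Oint \<longleftrightarrow> (\<exists>S. finite S \<and> (\<forall>k. x ^ k \<in> zsp S))"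
proof
  assume "x \<in> Oint"
  then obtain f where f: "lead_coeff f = 1" "\<And>i. coeff f i \<in> Z2" "poly f x = 0"
    by (auto simp: ring_of_integers_def)
  define d where "d = degree f"
  define S where "S = (\<lambda>i. x ^ i) ` {..<d}"
  have eq: "x ^ d = - (\<Sum>i<d. coeff f i * x ^ i)"
    using f(1,3) by (simp add: poly_altdef d_def lessThan_Suc_atMost[symmetric] add_eq_0_iff)
  have "d \<noteq> 0" using eq by (intro notI) simp
  have base: "x ^ i \<in> zsp S" if "i < d" for i using that by (auto simp: S_def intro!: Z2.rspan_base)
  have "x ^ d = (\<Sum>i<d. (- coeff f i) * x ^ i)" unfolding eq by (simp add: sum_negf)
  then have top: "x ^ d \<in> zsp S"
    by (simp only:) (intro Z2.rspan_sum Z2.rspan_scale Z2.uminus_in base f(2), simp)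
  have "x ^ k \<in> zsp S" for k
  proof (rule zsp_powers_closed)
    show "1 \<in> zsp S" using base[of 0] \<open>d \<noteq> 0\<close> by simp
    fix s assume "s \<in> S"
    then obtain i where i: "i < d" "s = x ^ i" by (auto simp: S_def)
    then show "x * s \<in> zsp S" using base[of "Suc i"] top by (cases "Suc i = d") auto
  qed
  then show "\<exists>S. finite S \<and> (\<forall>k. x ^ k \<in> zsp S)" by (intro exI[of _ S]) (auto simp: S_def)
next
  assume "\<exists>S. finite S \<and> (\<forall>k. x ^ k \<in> zsp S)"
  then obtain S where S: "finite S" "\<And>k. x ^ k \<in> zsp S" by blast
  define W where "W K = zsp ((\<lambda>k. x ^ k) ` {..K})" for K
  have "zsp (range (\<lambda>k. x ^ k)) \<subseteq> zsp S"
    by (rule Z2.rspan_minimal[OF Z2.submod_rspan]) (use S(2) in auto)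
  then obtain T where T: "finite T" "zsp (range (\<lambda>k. x ^ k)) = zsp T"
    using Z2.submod_of_finitely_generated[OF S(1) Z2.submod_rspan] by metis
  have mono: "W K \<subseteq> W L" if "K \<le> L" for K L
    unfolding W_def using that by (intro Z2.rspan_mono) auto
  have inW: "\<exists>K. w \<in> W K" if "w \<in> zsp (range (\<lambda>k. x ^ k))" for w
    using that
  proof (induction rule: rspan.induct)
    case zero show ?case by (auto simp: W_def intro: rspan.zero)
  next
    case (step v c w)
    then obtain k K where k: "v = x ^ k" "w \<in> W K" by auto
    have "v \<in> W (max k K)" unfolding W_def k by (auto intro!: Z2.rspan_base)
    moreover have "w \<in> W (max k K)" using k mono[of K "max k K"] by auto
    ultimately show ?case unfolding W_def
      using step(2) by (intro exI[of _ "max k K"]) (simp add: Z2.rspan_add Z2.rspan_scale)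
  qed
  have "\<exists>K. T' \<subseteq> W K" if "finite T'" "T' \<subseteq> zsp T" for T'
    using that
  proof (induction T' rule: finite_induct)
    case (insert t T')
    then obtain K where K: "T' \<subseteq> W K" by blast
    obtain L where L: "t \<in> W L" using inW insert T by blast
    have "insert t T' \<subseteq> W (max K L)" using K L mono[of K "max K L"] mono[of L "max K L"] by auto
    then show ?case by blast
  qed simp
  from this[OF T(1) Z2.rspan_superset] obtain K where "T \<subseteq> W K" by blast
  then have "zsp T \<subseteq> W K" unfolding W_def by (rule Z2.rspan_minimal[OF Z2.submod_rspan])
  moreover have "x ^ Suc K \<in> zsp T" unfolding T(2)[symmetric] by (rule Z2.rspan_base) (rule rangeI)
  ultimately have "x ^ Suc K \<in> W K" by blast
  moreover have "\<exists>c. (\<forall>i. c i \<in> Z2) \<and> w = (\<Sum>i\<le>K. c i * x ^ i)" if "w \<in> W K" for w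
    using that unfolding W_def
  proof (induction rule: rspan.induct)
    case zero show ?case by (intro exI[of _ "\<lambda>_. 0"]) simp
  next
    case (step v c w)
    then obtain d i where d: "\<forall>i. d i \<in> Z2" "w = (\<Sum>i\<le>K. d i * x ^ i)" "i \<le> K" "v = x ^ i" by auto
    have "(\<Sum>j\<le>K. ((\<lambda>j. d j + (if j = i then c else 0)) j) * x ^ j) =
      (\<Sum>j\<le>K. d j * x ^ j) + (\<Sum>j\<le>K. if j = i then c * x ^ j else 0)"
      by (subst sum.distrib[symmetric]) (rule sum.cong, auto simp: algebra_simps)
    then show ?case using d step(2)
      by (intro exI[of _ "\<lambda>j. d j + (if j = i then c else 0)"]) (auto intro!: Z2.add_in)
  qed
  ultimately obtain c where c: "\<And>i. c i \<in> Z2" "x ^ Suc K = (\<Sum>i\<le>K. c i * x ^ i)" by blast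
  define g where "g = (\<Sum>i\<le>K. monom (c i) i)"
  have gc: "coeff g i = (if i \<le> K then c i else 0)" for i
    by (simp add: g_def coeff_sum)
  define f where "f = monom 1 (Suc K) - g"
  have "coeff f (Suc K) = 1" by (simp add: f_def gc)
  moreover have "degree f \<le> Suc K" by (rule degree_le) (auto simp: f_def gc)
  ultimately have "lead_coeff f = 1" by (metis le_antisym le_degree zero_neq_one)
  moreover have "\<forall>i. coeff f i \<in> Z2" using c(1) by (auto simp: f_def gc Z2.diff_in Z2.uminus_in)
  moreover have "poly f x = 0" using c(2) by (simp add: f_def g_def poly_monom poly_sum)
  ultimately show "x \<in> Oint" by (auto simp: ring_of_integers_def)
qed

lemma Oint_mult: assumes "x \<in> Oint" "y \<in> Oint" shows "x * y \<in> Oint"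
proof -
  obtain S T where ST: "finite S" "\<And>k. x ^ k \<in> zsp S" "finite T" "\<And>k. y ^ k \<in> zsp T"
    using assms unfolding integral_iff_powers by blast
  have "(x * y) ^ k \<in> zsp ((\<lambda>(s, t). s * t) ` (S \<times> T))" for k
    unfolding power_mult_distrib by (rule zsp_mult[OF ST(2,4)])
  then show ?thesis unfolding integral_iff_powers using ST(1,3)
    by (intro exI[of _ "(\<lambda>(s, t). s * t) ` (S \<times> T)"]) simp
qed

lemma Oint_add: assumes "x \<in> Oint" "y \<in> Oint" shows "x + y \<in> Oint"
proof -
  obtain S T where ST: "finite S" "\<And>k. x ^ k \<in> zsp S" "finite T" "\<And>k. y ^ k \<in> zsp T"
    using assms unfolding integral_iff_powers by blast
  have "(x + y) ^ k \<in> zsp ((\<lambda>(s, t). s * t) ` (S \<times> T))" for k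
    unfolding binomial_ring mult.assoc
    by (intro Z2.rspan_sum Z2.rspan_scale zsp_mult ST Z2.of_nat_in)
  then show ?thesis unfolding integral_iff_powers using ST(1,3)
    by (intro exI[of _ "(\<lambda>(s, t). s * t) ` (S \<times> T)"]) simp
qed

lemma Z2_subset_Oint: assumes "c \<in> Z2" shows "c \<in> Oint"
proof -
  have "c ^ k \<in> zsp {1}" for k
    using Z2.rspan_scale[OF Z2.power_in[OF assms] Z2.rspan_base[of 1 "{1}"], of k] by simp
  then show ?thesis unfolding integral_iff_powers by (intro exI[of _ "{1}"]) simp
qed

lemma Oint_diff: "x \<in> Oint \<Longrightarrow> y \<in> Oint \<Longrightarrow> x - y \<in> Oint"
  using Oint_add[of x "(- 1) * y"] Oint_mult[of "-1" y] Z2_subset_Oint[OF Z2.uminus_in[OF Z2.one_in]] by simp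

lemma Oint_0: "0 \<in> Oint" and Oint_1: "1 \<in> Oint" and Oint_2: "2 \<in> Oint"
  using Z2_subset_Oint Z2.zero_in Z2.one_in Z2.p_in by blast+

lemma Oint_uminus: "x \<in> Oint \<Longrightarrow> - x \<in> Oint"
  using Oint_diff[OF Oint_0] by simp

lemma Oint_power: "x \<in> Oint \<Longrightarrow> x ^ k \<in> Oint"
  by (induction k) (auto intro: Oint_mult Oint_1)

lemma Oint_sum: "(\<And>i. i \<in> I \<Longrightarrow> f i \<in> Oint) \<Longrightarrow> sum f I \<in> Oint"
  by (induction I rule: infinite_finite_induct) (auto intro: Oint_add Oint_0)

lemmas Oint_ring = Oint_add Oint_diff Oint_mult Oint_uminus Oint_power Oint_0 Oint_1 Oint_2

lemma zsp_subset_Oint: "X \<subseteq> Oint \<Longrightarrow> zsp X \<subseteq> Oint"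
  by (rule Z2.rspan_minimal) (auto simp: Z2.submod_def intro: Oint_ring Z2_subset_Oint)

text \<open>Multiplying a monic equation of degree \<open>d\<close> for 1/2 by
  \<open>2 ^ (d - 1)\<close> leaves 1/2 as leading term and turns all others into elements of
  \<open>Z2\<close>.\<close>

lemma half_not_integral: "inverse 2 \<notin> Oint"
proof
  assume "inverse 2 \<in> Oint"
  then obtain f where f: "lead_coeff f = 1" "\<And>i. coeff f i \<in> Z2" "poly f (inverse 2) = 0"
    by (auto simp: ring_of_integers_def)
  define d where "d = degree f"
  have eq: "inverse 2 ^ d = - (\<Sum>i<d. coeff f i * inverse 2 ^ i)"
    using f(1,3) by (simp add: poly_altdef d_def lessThan_Suc_atMost[symmetric] add_eq_0_iff)
  have "d \<noteq> 0" using eq by (intro notI) simp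
  then obtain e where e: "d = Suc e" by (cases d) auto
  have "inverse 2 = 2 ^ e * inverse (2::'a) ^ d" unfolding e by (simp add: power_one_over)
  also have "\<dots> = - (\<Sum>i<d. coeff f i * (2 ^ e * inverse 2 ^ i))"
    unfolding eq by (simp add: sum_distrib_left mult.left_commute)
  also have "\<dots> = - (\<Sum>i<d. coeff f i * 2 ^ (e - i))"
  proof (intro arg_cong[of _ _ uminus] sum.cong refl arg_cong2[where f = "(*)"])
    fix i assume "i \<in> {..<d}"
    then have "(2::'a) ^ (e - i) = 2 ^ e / 2 ^ i" by (intro power_diff) (auto simp: e)
    then show "2 ^ e * inverse 2 ^ i = (2::'a) ^ (e - i)"
      by (simp only: divide_inverse power_inverse)
  qed
  also have "\<dots> \<in> Z2" using f(2) by (intro Z2.uminus_in Z2.sum_in Z2.mult_in Z2.power_in Z2.p_in)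
  finally show False using Z2.inverse_p by blast
qed

lemma uniform_power:
  assumes "finite I" "\<And>i. i \<in> I \<Longrightarrow> c i \<in> Q2"
  shows "\<exists>N. \<forall>i\<in>I. 2 ^ N * c i \<in> Z2"
  using assms
proof (induction I rule: finite_induct)
  case (insert i I)
  then obtain N where N: "\<forall>i\<in>I. 2 ^ N * c i \<in> Z2" by auto
  have ci: "c i \<in> Q2" using insert by auto
  have "\<exists>K. 2 ^ K * c i \<in> Z2"
  proof -
    obtain K where "nrm (c i) < 2 ^ K" using real_arch_pow[of 2 "nrm (c i)"] by auto
    then have "2 ^ K * c i \<in> Z2"
      using ci by (simp add: two_adic_integers_def mult_mem two_power_mem nrm_mult nrm_2_power)
    then show ?thesis by blast
  qed
  then obtain K where K: "2 ^ K * c i \<in> Z2" by blast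
  have "2 ^ K * (2 ^ N * c j) \<in> Z2" if "j \<in> I" for j
    using N that by (simp add: Z2.ring_in)
  moreover have "2 ^ N * (2 ^ K * c i) \<in> Z2" using K by (simp add: Z2.ring_in)
  ultimately show ?case
    by (intro exI[of _ "N + K"]) (auto simp: power_add mult.assoc mult.left_commute)
qed auto

text \<open>Clearing the denominators of the structure constants of a spanning set gives
  \<open>S'\<close> whose products stay in \<open>zsp S'\<close>. A large multiple \<open>y\<close>
  of \<open>x\<close> lies in \<open>zsp S'\<close>, so all its powers lie in
  \<open>zsp (insert 1 S')\<close>.\<close>

lemma multiple_integral: "\<exists>N. 2 ^ N * x \<in> Oint"
proof -
  obtain S where S: "finite S" "\<And>x. \<exists>c. (\<forall>b\<in>S. c b \<in> Q2) \<and> x = (\<Sum>b\<in>S. c b * b)"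
    using finite_extension by blast
  then obtain c where c: "\<And>x b. b \<in> S \<Longrightarrow> c x b \<in> Q2" "\<And>x. x = (\<Sum>b\<in>S. c x b * b)" by metis
  have "\<exists>N. \<forall>i\<in>S \<times> S \<times> S. 2 ^ N * (\<lambda>(s, t, b). c (s * t) b) i \<in> Z2"
    by (rule uniform_power) (use S c in auto)
  then obtain N where N: "\<And>s t b. s \<in> S \<Longrightarrow> t \<in> S \<Longrightarrow> b \<in> S \<Longrightarrow> 2 ^ N * c (s * t) b \<in> Z2" by fastforce
  define S' where "S' = (\<lambda>b. 2 ^ N * b) ` S"
  have mult: "s * t \<in> zsp S'" if st: "s \<in> S'" "t \<in> S'" for s t
  proof -
    obtain a b where ab: "a \<in> S" "s = 2 ^ N * a" "b \<in> S" "t = 2 ^ N * b" using st by (auto simp: S'_def)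
    have "s * t = 2 ^ N * (2 ^ N * (a * b))" using ab by (simp add: algebra_simps)
    also have "\<dots> = 2 ^ N * (2 ^ N * (\<Sum>k\<in>S. c (a * b) k * k))" using c(2)[of "a * b"] by simp
    also have "\<dots> = (\<Sum>k\<in>S. (2 ^ N * c (a * b) k) * (2 ^ N * k))"
      by (simp add: sum_distrib_left algebra_simps)
    also have "\<dots> \<in> zsp S'"
      using N ab by (intro Z2.rspan_sum Z2.rspan_scale Z2.rspan_base) (auto simp: S'_def)
    finally show ?thesis .
  qed
  obtain K where K: "\<forall>b\<in>S. 2 ^ K * c x b \<in> Z2" using uniform_power[of S "c x"] S(1) c(1) by blast
  define y where "y = 2 ^ (K + N) * x"
  have "y = 2 ^ (K + N) * (\<Sum>b\<in>S. c x b * b)" using c(2)[of x] by (simp add: y_def)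
  also have "\<dots> = (\<Sum>b\<in>S. (2 ^ K * c x b) * (2 ^ N * b))"
    by (simp add: sum_distrib_left power_add algebra_simps)
  also have "\<dots> \<in> zsp S'"
    using K by (intro Z2.rspan_sum Z2.rspan_scale Z2.rspan_base) (auto simp: S'_def)
  finally have y: "y \<in> zsp S'" .
  have ys: "y * s \<in> zsp S'" if "s \<in> S'" for s
  proof -
    have "y * s \<in> zsp ((\<lambda>(s, t). s * t) ` (S' \<times> S'))"
      by (rule zsp_mult[OF y Z2.rspan_base[OF that]])
    moreover have "zsp ((\<lambda>(s, t). s * t) ` (S' \<times> S')) \<subseteq> zsp S'"
      by (rule Z2.rspan_minimal[OF Z2.submod_rspan]) (use mult in auto)
    ultimately show ?thesis by blast
  qed
  have "y ^ k \<in> zsp (insert 1 S')" for k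
  proof (rule zsp_powers_closed)
    show "1 \<in> zsp (insert 1 S')" by (auto intro: Z2.rspan_base)
    show "y * s \<in> zsp (insert 1 S')" if "s \<in> insert 1 S'" for s
      using that y ys Z2.rspan_mono[OF subset_insertI[of S' 1]] by auto
  qed
  then have "y \<in> Oint" unfolding integral_iff_powers using S(1) by (intro exI[of _ "insert 1 S'"]) (auto simp: S'_def)
  then show ?thesis unfolding y_def by blast
qed

lemma Oint_separated: assumes "\<And>n. x / 2 ^ n \<in> Oint" shows "x = 0"
proof (rule ccontr)
  assume x: "x \<noteq> 0"
  obtain N where N: "2 ^ N * inverse x \<in> Oint" using multiple_integral by blast
  have "(2 ^ N * inverse x) * (x / 2 ^ Suc N) \<in> Oint" using N assms Oint_mult by blast
  moreover have "(2 ^ N * inverse x) * (x / 2 ^ Suc N) = inverse 2" using x by (simp add: field_simps)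
  ultimately show False using half_not_integral by simp
qed

section \<open>Finite generation of the ring of integers over the 2-adic integers\<close>

lemma zsp_series:
  assumes X: "finite X" and w: "\<And>j. w j \<in> zsp X"
  shows "\<exists>l\<in>zsp X. \<forall>n. (l - (\<Sum>j<n. 2 ^ j * w j)) / 2 ^ n \<in> zsp X"
proof -
  have "\<exists>c. (\<forall>x\<in>X. c x \<in> Z2) \<and> w j = (\<Sum>x\<in>X. c x * x)" for j
    using w[of j] unfolding Z2.rspan_finite[OF X] by auto
  then obtain c where c: "\<And>j x. x \<in> X \<Longrightarrow> c j x \<in> Z2" "\<And>j. w j = (\<Sum>x\<in>X. c j x * x)" by metis
  have "\<exists>l\<in>Z2. \<forall>n. (l - (\<Sum>j<n. 2 ^ j * c j x)) / 2 ^ n \<in> Z2" if "x \<in> X" for x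
    by (rule Z2_series) (use c that in auto)
  then obtain l where l: "\<And>x. x \<in> X \<Longrightarrow> l x \<in> Z2"
    "\<And>x n. x \<in> X \<Longrightarrow> (l x - (\<Sum>j<n. 2 ^ j * c j x)) / 2 ^ n \<in> Z2" by metis
  have "((\<Sum>x\<in>X. l x * x) - (\<Sum>j<n. 2 ^ j * w j)) / 2 ^ n \<in> zsp X" for n
  proof -
    have "(\<Sum>j<n. 2 ^ j * w j) = (\<Sum>x\<in>X. (\<Sum>j<n. 2 ^ j * c j x) * x)"
      unfolding c(2) sum_distrib_left sum_distrib_right
      by (subst sum.swap) (simp add: mult.assoc)
    then have "((\<Sum>x\<in>X. l x * x) - (\<Sum>j<n. 2 ^ j * w j)) / 2 ^ n
      = (\<Sum>x\<in>X. ((l x - (\<Sum>j<n. 2 ^ j * c j x)) / 2 ^ n) * x)"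
      by (simp add: sum_subtractf[symmetric] sum_divide_distrib left_diff_distrib[symmetric])
    also have "\<dots> \<in> zsp X" using l by (intro Z2.rspan_sum Z2.rspan_scale Z2.rspan_base)
    finally show ?thesis .
  qed
  moreover have "(\<Sum>x\<in>X. l x * x) \<in> zsp X" using l by (intro Z2.rspan_sum Z2.rspan_scale Z2.rspan_base)
  ultimately show ?thesis by blast
qed

text \<open>These sets are lifts of families in \<open>Oint\<close> modulo 2 that are linearly
  independent over the field with two elements.\<close>

definition independent_mod_2 :: "'a set \<Rightarrow> bool" where
  "independent_mod_2 X \<longleftrightarrow> finite X \<and> X \<subseteq> Oint \<and>
     (\<forall>c. (\<forall>x\<in>X. c x \<in> Z2) \<and> (\<Sum>x\<in>X. c x * x) / 2 \<in> Oint \<longrightarrow> (\<forall>x\<in>X. c x / 2 \<in> Z2))"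

text \<open>A multiple of \<open>X\<close> lies in a module with \<open>card S\<close> generators.
  If \<open>X\<close> were larger, it would satisfy a relation with a coefficient prime to 2; its
  value 0 is divisible by 2, against independence.\<close>

lemma independent_mod_2_bounded: "\<exists>d. \<forall>X. independent_mod_2 X \<longrightarrow> card X \<le> d"
proof -
  obtain S where S: "finite S" "\<And>x. \<exists>c. (\<forall>b\<in>S. c b \<in> Q2) \<and> x = (\<Sum>b\<in>S. c b * b)"
    using finite_extension by blast
  then obtain c where c: "\<And>x b. b \<in> S \<Longrightarrow> c x b \<in> Q2" "\<And>x. x = (\<Sum>b\<in>S. c x b * b)" by metis
  have "card X \<le> card S" if X: "independent_mod_2 X" for X
  proof (rule ccontr)
    assume big: "\<not> card X \<le> card S"
    have fX: "finite X" using X by (simp add: independent_mod_2_def)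
    have "\<exists>N. \<forall>i\<in>X \<times> S. 2 ^ N * (\<lambda>(x, b). c x b) i \<in> Z2"
      by (rule uniform_power) (use S fX c in auto)
    then obtain N where N: "\<And>x b. x \<in> X \<Longrightarrow> b \<in> S \<Longrightarrow> 2 ^ N * c x b \<in> Z2" by fastforce
    have "2 ^ N * x \<in> zsp S" if "x \<in> X" for x
    proof -
      have "2 ^ N * x = 2 ^ N * (\<Sum>b\<in>S. c x b * b)" using c(2)[of x] by simp
      also have "\<dots> = (\<Sum>b\<in>S. (2 ^ N * c x b) * b)" by (simp add: sum_distrib_left mult.assoc)
      also have "\<dots> \<in> zsp S" using N that by (intro Z2.rspan_sum Z2.rspan_scale Z2.rspan_base)
      finally show ?thesis .
    qed
    then obtain a where a: "\<forall>x\<in>X. a x \<in> Z2" "(\<Sum>x\<in>X. a x * (2 ^ N * x)) = 0" "\<exists>x\<in>X. a x / 2 \<notin> Z2"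
      using Z2.relation_with_unit_coefficient[OF S(1) fX, of "\<lambda>x. 2 ^ N * x"] big by auto
    have "2 ^ N * (\<Sum>x\<in>X. a x * x) = 0" using a(2) by (simp add: sum_distrib_left mult.left_commute)
    then have "(\<Sum>x\<in>X. a x * x) / 2 \<in> Oint" using Oint_0 by simp
    then show False using a X by (auto simp: independent_mod_2_def)
  qed
  then show ?thesis by blast
qed

text \<open>An independent family of greatest size spans \<open>Oint\<close> modulo 2, and
  successive approximation turns this into generation, because 2-adic series with terms in
  \<open>zsp X\<close> converge there.\<close>

lemma Oint_finitely_generated: "\<exists>X. finite X \<and> Oint = zsp X"
proof -
  obtain d where d: "\<And>X. independent_mod_2 X \<Longrightarrow> card X \<le> d" using independent_mod_2_bounded by blast
  have "independent_mod_2 {}" by (simp add: independent_mod_2_def)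
  then obtain X where X: "independent_mod_2 X" "\<And>Y. independent_mod_2 Y \<Longrightarrow> card Y \<le> card X"
    using ex_has_greatest_nat[of independent_mod_2 "{}" card "Suc d"] d by (metis le_imp_less_Suc)
  have fX: "finite X" "X \<subseteq> Oint" using X by (auto simp: independent_mod_2_def)
  have approx: "\<exists>w\<in>zsp X. (y - w) / 2 \<in> Oint" if y: "y \<in> Oint" for y
  proof (cases "y \<in> X")
    case True
    then show ?thesis using Oint_0 by (intro bexI[of _ y]) (auto intro: Z2.rspan_base)
  next
    case False
    then have "\<not> independent_mod_2 (insert y X)" using X(2)[of "insert y X"] fX by auto
    then obtain c where c: "\<forall>x\<in>insert y X. c x \<in> Z2" "(\<Sum>x\<in>insert y X. c x * x) / 2 \<in> Oint"
      "\<exists>x\<in>insert y X. c x / 2 \<notin> Z2"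
      using fX y by (auto simp: independent_mod_2_def)
    have s: "(c y * y + (\<Sum>x\<in>X. c x * x)) / 2 \<in> Oint" using c(2) False fX by simp
    have "c y / 2 \<notin> Z2"
    proof
      assume "c y / 2 \<in> Z2"
      then have "(c y / 2) * y \<in> Oint" using y Z2_subset_Oint Oint_mult by blast
      from Oint_diff[OF s this] have "(\<Sum>x\<in>X. c x * x) / 2 \<in> Oint" by (simp add: add_divide_distrib)
      then have "\<forall>x\<in>X. c x / 2 \<in> Z2" using X(1) c(1) unfolding independent_mod_2_def by blast
      then show False using c(3) \<open>c y / 2 \<in> Z2\<close> by blast
    qed
    then have u: "c y \<noteq> 0" "inverse (c y) \<in> Z2" using Z2.unit_or_dvd[of "c y"] c(1) by auto
    have "inverse (c y) * ((c y * y + (\<Sum>x\<in>X. c x * x)) / 2) \<in> Oint"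
      using s u Z2_subset_Oint Oint_mult by blast
    moreover have "inverse (c y) * ((c y * y + (\<Sum>x\<in>X. c x * x)) / 2)
      = (y - (- inverse (c y) * (\<Sum>x\<in>X. c x * x))) / 2"
      using u by (simp add: field_simps)
    moreover have "- inverse (c y) * (\<Sum>x\<in>X. c x * x) \<in> zsp X"
      using c(1) u by (intro Z2.rspan_scale[OF Z2.uminus_in] Z2.rspan_sum Z2.rspan_scale Z2.rspan_base) auto
    ultimately show ?thesis by (intro bexI[of _ "- inverse (c y) * (\<Sum>x\<in>X. c x * x)"]) (simp_all only:)
  qed
  then obtain g where g: "\<And>y. y \<in> Oint \<Longrightarrow> g y \<in> zsp X \<and> (y - g y) / 2 \<in> Oint" by metis
  have "y \<in> zsp X" if y: "y \<in> Oint" for y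
  proof -
    \<comment> \<open>The remainders of the expansion: \<open>y\<close> is the sum of
      \<open>2 ^ j * g (z j)\<close> over \<open>j < n\<close>, plus
      \<open>2 ^ n * z n\<close>.\<close>
    define z where "z = rec_nat y (\<lambda>_ y. (y - g y) / 2)"
    have z: "z 0 = y" "z (Suc j) = (z j - g (z j)) / 2" for j by (simp_all add: z_def)
    have zO: "z j \<in> Oint" for j by (induction j) (auto simp: z y g)
    obtain l where l: "l \<in> zsp X" "\<And>n. (l - (\<Sum>j<n. 2 ^ j * g (z j))) / 2 ^ n \<in> zsp X"
      using zsp_series[OF fX(1), of "\<lambda>j. g (z j)"] g zO by blast
    have part: "y - (\<Sum>j<n. 2 ^ j * g (z j)) = 2 ^ n * z n" for n
    proof (induction n)
      case (Suc n)
      have "y - (\<Sum>j<Suc n. 2 ^ j * g (z j)) = 2 ^ n * z n - 2 ^ n * g (z n)" using Suc by (simp add: algebra_simps)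
      then show ?case by (simp add: z algebra_simps)
    qed (simp add: z)
    have "(y - l) / 2 ^ n \<in> Oint" for n
    proof -
      have "(y - l) / 2 ^ n = (y - (\<Sum>j<n. 2 ^ j * g (z j))) / 2 ^ n - (l - (\<Sum>j<n. 2 ^ j * g (z j))) / 2 ^ n"
        by (simp add: diff_divide_distrib)
      also have "\<dots> = z n - (l - (\<Sum>j<n. 2 ^ j * g (z j))) / 2 ^ n" unfolding part by simp
      also have "\<dots> \<in> Oint" using zO l(2) zsp_subset_Oint[OF fX(2)] by (intro Oint_diff) auto
      finally show ?thesis .
    qed
    then have "y = l" using Oint_separated[of "y - l"] by simp
    then show ?thesis using l by simp
  qed
  then show ?thesis using fX zsp_subset_Oint by (intro exI[of _ X]) blast
qed

section \<open>Hensel's lemma, powers modulo 2 and units\<close>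

text \<open>The iteration of \<open>z \<mapsto> - 1 - a * c * z * z\<close> contracts by the factor
  \<open>c\<close>. No uniformizer is available yet, so \<open>c\<close> is called small if some
  power of it is divisible by 2; then \<open>h\<close> iterations gain a factor 2.\<close>

lemma Oint_hensel:
  assumes a: "a \<in> Oint" and c: "c \<in> Oint" "c ^ h / 2 \<in> Oint"
  shows "\<exists>t\<in>Oint. a * c * t\<^sup>2 + t + 1 = 0"
proof -
  obtain X where X: "finite X" "Oint = zsp X" using Oint_finitely_generated by blast
  define t where "t n = ((\<lambda>z. - 1 - a * c * z\<^sup>2) ^^ n) 0" for n
  have t: "t 0 = 0" "t (Suc n) = - 1 - a * c * (t n)\<^sup>2" for n by (simp_all add: t_def)
  have tO: "t n \<in> Oint" for n by (induction n) (auto simp: t intro!: Oint_ring a c)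
  have step: "\<exists>d\<in>Oint. t (Suc n) - t n = c ^ n * d" for n
  proof (induction n)
    case 0 show ?case using Oint_ring by (auto simp: t)
  next
    case (Suc n)
    then obtain d where d: "d \<in> Oint" "t (Suc n) - t n = c ^ n * d" by blast
    have "t (Suc (Suc n)) - t (Suc n) = - a * c * (t (Suc n) - t n) * (t (Suc n) + t n)"
      unfolding t(2)[of "Suc n"] by (simp add: t(2)[of n] power2_eq_square algebra_simps)
    also have "\<dots> = c ^ Suc n * (- a * d * (t (Suc n) + t n))" unfolding d(2) by simp
    finally show ?case by (rule bexI) (intro Oint_ring d tO a)
  qed
  have far: "\<exists>d\<in>Oint. t (n + m) - t n = c ^ n * d" for n m
  proof (induction m)
    case 0 show ?case using Oint_0 by (auto intro: bexI[of _ 0])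
  next
    case (Suc m)
    then obtain d where d: "d \<in> Oint" "t (n + m) - t n = c ^ n * d" by blast
    obtain e where e: "e \<in> Oint" "t (Suc (n + m)) - t (n + m) = c ^ (n + m) * e" using step by blast
    have "t (n + Suc m) - t n = (t (Suc (n + m)) - t (n + m)) + (t (n + m) - t n)" by simp
    also have "\<dots> = c ^ n * (c ^ m * e + d)" unfolding d e by (simp add: power_add algebra_simps)
    finally show ?case by (rule bexI) (intro Oint_ring d e c)
  qed
  have pow: "c ^ (h * n) / 2 ^ n \<in> Oint" for n
    using Oint_power[OF c(2), of n] by (simp add: power_mult power_divide)
  have del: "(t (h * m + k) - t (h * m)) / 2 ^ m \<in> Oint" for m k
  proof -
    obtain d where "d \<in> Oint" "t (h * m + k) - t (h * m) = c ^ (h * m) * d" using far by blast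
    then show ?thesis using Oint_mult[OF pow[of m], of d] by (simp add: field_simps)
  qed
  \<comment> \<open>Blocks of \<open>h\<close> iterations supply the terms of a 2-adic series whose
    partial sums are the iterates \<open>t (h * n)\<close>.\<close>
  define w where "w m = (t (h * m + h) - t (h * m)) / 2 ^ m" for m
  have "\<exists>l\<in>zsp X. \<forall>n. (l - (\<Sum>j<n. 2 ^ j * w j)) / 2 ^ n \<in> zsp X"
    by (rule zsp_series[OF X(1)]) (use del X w_def in auto)
  then obtain l where l: "l \<in> Oint" "\<And>n. (l - (\<Sum>j<n. 2 ^ j * w j)) / 2 ^ n \<in> Oint" using X(2) by blast
  have sm: "(\<Sum>j<n. 2 ^ j * w j) = t (h * n)" for n
    by (induction n) (simp_all add: t w_def add.commute)
  have "(a * c * l\<^sup>2 + l + 1) / 2 ^ n \<in> Oint" for n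
  proof -
    define G T where "G = (2::'a) ^ n" and "T = t (h * n)"
    define e where "e = (l - T) / G"
    have G: "G \<noteq> 0" by (simp add: G_def)
    have e: "e \<in> Oint" "l = T + G * e" using l(2)[of n] G by (auto simp: sm e_def T_def G_def)
    define f where "f = (t (h * n + 1) - T) / G"
    have f: "f \<in> Oint" "t (h * n + 1) = T + G * f" using del[of n 1] G by (auto simp: f_def T_def G_def)
    have "T + G * f = - 1 - a * c * T\<^sup>2" using f(2) t(2)[of "h * n"] by (simp add: T_def)
    then have "a * c * l\<^sup>2 + l + 1 = G * (- f + e * (a * c * (l + T) + 1))"
      using e(2) by algebra
    then have "(a * c * l\<^sup>2 + l + 1) / 2 ^ n = - f + e * (a * c * (l + T) + 1)"
      unfolding G_def by simp
    also have "\<dots> \<in> Oint" unfolding T_def by (intro Oint_ring a c e f l tO)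
    finally show ?thesis .
  qed
  then have "a * c * l\<^sup>2 + l + 1 = 0" by (rule Oint_separated)
  then show ?thesis using l by blast
qed

text \<open>Coefficients may be replaced by 0 or 1 modulo 2. For a generating set \<open>X\<close>
  of \<open>Oint\<close> the subset sums thus represent all classes, so \<open>Oint\<close> modulo 2
  is finite.\<close>

lemma residue_subset:
  assumes X: "finite X" and y: "y \<in> zsp X"
  shows "\<exists>A\<subseteq>X. (y - \<Sum>A) / 2 \<in> zsp X"
proof -
  obtain c where c: "\<And>x. x \<in> X \<Longrightarrow> c x \<in> Z2" "y = (\<Sum>x\<in>X. c x * x)"
    using y unfolding Z2.rspan_finite[OF X] by auto
  define A where "A = {x \<in> X. c x / 2 \<notin> Z2}"
  have "\<Sum>A = (\<Sum>x\<in>X. (if x \<in> A then 1 else 0) * x)"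
    using X by (subst sum.mono_neutral_cong_left[of X A]) (auto simp: A_def)
  then have "(y - \<Sum>A) / 2 = (\<Sum>x\<in>X. ((c x - (if x \<in> A then 1 else 0)) / 2) * x)"
    unfolding c(2) by (simp add: sum_subtractf[symmetric] sum_divide_distrib left_diff_distrib[symmetric])
  also have "\<dots> \<in> zsp X"
  proof (intro Z2.rspan_sum Z2.rspan_scale Z2.rspan_base)
    fix x assume "x \<in> X"
    then show "(c x - (if x \<in> A then 1 else 0)) / 2 \<in> Z2"
      using Z2_residue[OF c(1)[of x]] by (auto simp: A_def)
  qed
  finally show ?thesis by (intro exI[of _ A]) (auto simp: A_def)
qed

text \<open>By the pigeonhole principle the powers of \<open>x\<close> modulo 2 are periodic with
  period \<open>m\<close> from the exponent \<open>i\<close> on. Any positive multiple of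
  \<open>m\<close> that is at least \<open>i\<close> is then the exponent of an idempotent.\<close>

lemma power_idempotent_mod_2:
  assumes x: "x \<in> Oint"
  shows "\<exists>k>0. (x ^ k * x ^ k - x ^ k) / 2 \<in> Oint"
proof -
  obtain X where X: "finite X" "Oint = zsp X" using Oint_finitely_generated by blast
  have "\<exists>A. A \<subseteq> X \<and> (x ^ k - \<Sum>A) / 2 \<in> Oint" for k
    using residue_subset[OF X(1), of "x ^ k"] Oint_power[OF x] X(2) by blast
  then obtain A where A: "\<And>k. A k \<subseteq> X \<and> (x ^ k - \<Sum>(A k)) / 2 \<in> Oint" by metis
  have "range A \<subseteq> Pow X" using A by blast
  then have "finite (range A)" using X(1) by (meson finite_Pow_iff finite_subset)
  then have "\<not> inj A" using finite_imageD[of A UNIV] by auto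
  then obtain i j where ij: "i < j" "A i = A j" by (metis injI linorder_neqE_nat)
  define m where "m = j - i"
  have "(x ^ j - \<Sum>(A j)) / 2 - (x ^ i - \<Sum>(A i)) / 2 \<in> Oint" using A by (intro Oint_diff) auto
  then have base: "(x ^ (i + m) - x ^ i) / 2 \<in> Oint" using ij by (simp add: diff_divide_distrib m_def)
  have shift: "(x ^ (i + s + m) - x ^ (i + s)) / 2 \<in> Oint" for s
  proof -
    have "x ^ (i + s + m) - x ^ (i + s) = x ^ s * (x ^ (i + m) - x ^ i)"
      by (simp add: power_add algebra_simps)
    then show ?thesis using Oint_mult[OF Oint_power[OF x, of s] base] by simp
  qed
  have many: "(x ^ (i + s + m * r) - x ^ (i + s)) / 2 \<in> Oint" for s r
  proof (induction r)
    case 0 show ?case using Oint_0 by simp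
  next
    case (Suc r)
    from Oint_add[OF Suc shift[of "s + m * r"]] show ?case
      by (simp add: diff_divide_distrib add_ac)
  qed
  define k where "k = m * Suc i"
  have "m > 0" using ij by (simp add: m_def)
  then have k: "k > 0" "i \<le> k" by (auto simp: k_def trans_le_add2)
  have "(x ^ (k + k) - x ^ k) / 2 \<in> Oint" using many[of "k - i" "Suc i"] k by (simp add: k_def)
  then show ?thesis using k by (auto simp: power_add)
qed

text \<open>If \<open>e\<^sup>2 - e = 2 f\<close>, the roots of \<open>s\<^sup>2 + s - 2 f\<close> are \<open>- e\<close> and \<open>e - 1\<close>, and one of
  them is divisible by 2 by Hensel's lemma.\<close>

lemma power_mod_2:
  assumes x: "x \<in> Oint"
  shows "\<exists>k>0. x ^ k / 2 \<in> Oint \<or> (x ^ k - 1) / 2 \<in> Oint"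
proof -
  obtain k where k: "k > 0" "(x ^ k * x ^ k - x ^ k) / 2 \<in> Oint" using power_idempotent_mod_2[OF x] by blast
  define e f where "e = x ^ k" and "f = (e * e - e) / 2"
  have f: "f \<in> Oint" "2 * f = e * e - e" using k by (auto simp: e_def f_def)
  have "- 2 * f \<in> Oint" "(- 2 * f) ^ 1 / 2 \<in> Oint" using f(1) by (simp_all add: Oint_ring)
  then obtain t where t: "t \<in> Oint" "1 * (- 2 * f) * t\<^sup>2 + t + 1 = 0"
    using Oint_hensel[OF Oint_1] by blast
  define s where "s = - 2 * f * t"
  have "s * s + s - 2 * f = 0" using t(2) unfolding s_def by algebra
  then have "(s + e) * (s - e + 1) = 0" unfolding f(2) by (simp add: algebra_simps)
  then have "s + e = 0 \<or> s - e + 1 = 0" by (simp only: mult_eq_0_iff)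
  then have "e = - s \<or> e - 1 = s" by algebra
  moreover have "s / 2 \<in> Oint" "(- s) / 2 \<in> Oint" using f(1) t(1) by (auto simp: s_def Oint_ring)
  ultimately show ?thesis using k(1) unfolding e_def by metis
qed

text \<open>An approximate inverse \<open>a\<close> modulo \<open>2 ^ N\<close> suffices if
  \<open>2 ^ N * inverse u\<close> is integral: the error \<open>1 - u * a\<close> absorbs the
  denominator of \<open>inverse u\<close>.\<close>

lemma one_plus_even_unit:
  assumes u: "u \<in> Oint" "(u - 1) / 2 \<in> Oint"
  shows "u \<noteq> 0" "inverse u \<in> Oint"
proof -
  show u0: "u \<noteq> 0"
  proof
    assume "u = 0"
    then have "- ((u - 1) / 2) = inverse 2" by (simp add: inverse_eq_divide)
    then show False using Oint_uminus[OF u(2)] half_not_integral by (simp only:)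
  qed
  have ex: "\<exists>a\<in>Oint. (1 - u * a) / 2 ^ n \<in> Oint" for n
  proof (induction n)
    case 0 show ?case using Oint_ring by (intro bexI[of _ 0]) auto
  next
    case (Suc n)
    then obtain a where a: "a \<in> Oint" "(1 - u * a) / 2 ^ n \<in> Oint" by blast
    define r where "r = (1 - u * a) / 2 ^ n"
    have r: "1 - u * a = 2 ^ n * r" by (simp add: r_def)
    have "1 - u * (a + 2 ^ n * r) = 2 ^ n * r - 2 ^ n * r * u" using r by (simp add: algebra_simps)
    also have "\<dots> = 2 ^ Suc n * (- r * ((u - 1) / 2))" by (simp add: field_simps)
    finally have "(1 - u * (a + 2 ^ n * r)) / 2 ^ Suc n = - r * ((u - 1) / 2)" by simp
    also have "\<dots> \<in> Oint" using u a unfolding r_def by (intro Oint_mult Oint_uminus)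
    finally show ?case using a unfolding r_def[symmetric]
      by (intro bexI[of _ "a + 2 ^ n * r"]) (auto intro!: Oint_ring)
  qed
  obtain N where N: "2 ^ N * inverse u \<in> Oint" using multiple_integral by blast
  obtain a where a: "a \<in> Oint" "(1 - u * a) / 2 ^ N \<in> Oint" using ex by blast
  have "(1 - u * a) / 2 ^ N * (2 ^ N * inverse u) + a \<in> Oint" by (rule Oint_add[OF Oint_mult[OF a(2) N] a(1)])
  moreover have "(1 - u * a) / 2 ^ N * (2 ^ N * inverse u) + a = inverse u" using u0 by (simp add: field_simps)
  ultimately show "inverse u \<in> Oint" by simp
qed

section \<open>The maximal ideal and its generator\<close>

text \<open>This is the maximal ideal, described so that \<open>1 - y\<close> is inverted by a
  finite geometric series.\<close>

definition nilpotent_mod_2 :: "'a \<Rightarrow> bool" where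
  "nilpotent_mod_2 y \<longleftrightarrow> y \<in> Oint \<and> (\<exists>k. y ^ k / 2 \<in> Oint)"

lemma two_nilpotent_mod_2: "nilpotent_mod_2 2"
  unfolding nilpotent_mod_2_def using Oint_2 Oint_1 by (intro conjI exI[of _ 1]) simp_all

text \<open>Locality of \<open>Oint\<close>: some power of \<open>y\<close> is 0 or 1 modulo 2, and
  an element congruent to 1 is a unit.\<close>

lemma nilpotent_mod_2_or_unit: assumes "y \<in> Oint" shows "nilpotent_mod_2 y \<or> (y \<noteq> 0 \<and> inverse y \<in> Oint)"
proof -
  obtain k where k: "k > 0" "y ^ k / 2 \<in> Oint \<or> (y ^ k - 1) / 2 \<in> Oint" using power_mod_2[OF assms] by blast
  show ?thesis
  proof (cases "y ^ k / 2 \<in> Oint")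
    case True then show ?thesis using assms by (auto simp: nilpotent_mod_2_def)
  next
    case False
    then have "y ^ k \<noteq> 0" "inverse (y ^ k) \<in> Oint"
      using one_plus_even_unit[OF Oint_power[OF assms, of k]] k by auto
    then have y: "y \<noteq> 0" "inverse (y ^ k) * y ^ (k - 1) \<in> Oint"
      using k assms by (auto intro!: Oint_mult Oint_power)
    have "y ^ k = y * y ^ (k - 1)" using k by (cases k) auto
    then have "inverse (y ^ k) * y ^ (k - 1) = inverse y" using y(1) by (simp add: field_simps)
    then show ?thesis using y by simp
  qed
qed

lemma nilpotent_mod_2_not_unit: assumes "nilpotent_mod_2 y" "y \<noteq> 0" "inverse y \<in> Oint" shows False
proof -
  obtain k where "y ^ k / 2 \<in> Oint" using assms by (auto simp: nilpotent_mod_2_def)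
  then have "y ^ k / 2 * inverse y ^ k \<in> Oint" using assms by (intro Oint_mult Oint_power)
  moreover have "y ^ k / 2 * inverse y ^ k = inverse 2" using assms by (simp add: field_simps)
  ultimately show False using half_not_integral by simp
qed

lemma nilpotent_mod_2_mult: assumes "nilpotent_mod_2 y" "a \<in> Oint" shows "nilpotent_mod_2 (y * a)"
proof -
  obtain k where "y \<in> Oint" "y ^ k / 2 \<in> Oint" using assms by (auto simp: nilpotent_mod_2_def)
  then have "y * a \<in> Oint" "y ^ k / 2 * a ^ k \<in> Oint" using assms by (simp_all only: Oint_mult Oint_power)
  then show ?thesis unfolding nilpotent_mod_2_def by (intro conjI exI[of _ k]) (auto simp: power_mult_distrib)
qed

lemma one_minus_nilpotent_unit: assumes "nilpotent_mod_2 y" shows "1 - y \<noteq> 0" "inverse (1 - y) \<in> Oint"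
proof -
  obtain k where k: "y \<in> Oint" "y ^ k / 2 \<in> Oint" using assms by (auto simp: nilpotent_mod_2_def)
  have "1 - y ^ k \<in> Oint" "((1 - y ^ k) - 1) / 2 \<in> Oint"
    using k Oint_uminus[OF k(2)] by (auto intro!: Oint_ring)
  note u = one_plus_even_unit[OF this]
  have eq: "1 - y ^ k = (1 - y) * (\<Sum>i<k. y ^ i)" by (rule one_diff_power_eq)
  then show ny: "1 - y \<noteq> 0" using u(1) by auto
  have "inverse (1 - y ^ k) * (\<Sum>i<k. y ^ i) \<in> Oint" using u(2) k by (intro Oint_mult Oint_sum Oint_power)
  moreover have "inverse (1 - y ^ k) * (\<Sum>i<k. y ^ i) = inverse (1 - y)"
    using u(1) ny unfolding eq by (simp add: field_simps)
  ultimately show "inverse (1 - y) \<in> Oint" by simp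
qed

text \<open>\<open>z\<close> represents a nonzero socle element of the finite local ring
  \<open>Oint\<close> modulo 2. It is chosen so that its principal ideal is least, measured by the
  subset sums that fall into it. If \<open>z * w\<close> were nonzero modulo 2, it would generate
  the same ideal; then \<open>z\<close> is congruent to \<open>z * w * a\<close>, and cancelling the
  unit \<open>1 - w * a\<close> gives 0.\<close>

lemma socle_exists: "\<exists>z\<in>Oint. z / 2 \<notin> Oint \<and> (\<forall>w. nilpotent_mod_2 w \<longrightarrow> z * w / 2 \<in> Oint)"
proof -
  obtain X where X: "finite X" "Oint = zsp X" using Oint_finitely_generated by blast
  define cnt where "cnt z = {A \<in> Pow X. \<exists>a\<in>Oint. (\<Sum>A - z * a) / 2 \<in> Oint}" for z
  have fin: "finite (cnt z)" for z using X(1) by (simp add: cnt_def)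
  have "1 \<in> Oint \<and> 1 / 2 \<notin> Oint" using Oint_1 half_not_integral by (simp add: inverse_eq_divide)
  then obtain z where z: "z \<in> Oint" "z / 2 \<notin> Oint"
    "\<And>y. y \<in> Oint \<Longrightarrow> y / 2 \<notin> Oint \<Longrightarrow> card (cnt z) \<le> card (cnt y)"
    using ex_has_least_nat[of "\<lambda>z. z \<in> Oint \<and> z / 2 \<notin> Oint" 1 "\<lambda>z. card (cnt z)"] by blast
  have "z * w / 2 \<in> Oint" if w: "nilpotent_mod_2 w" for w
  proof (rule ccontr)
    assume nw: "z * w / 2 \<notin> Oint"
    have wO: "w \<in> Oint" using w by (simp add: nilpotent_mod_2_def)
    have sub: "cnt (z * w) \<subseteq> cnt z"
    proof
      fix A assume "A \<in> cnt (z * w)"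
      then obtain a where "A \<subseteq> X" "a \<in> Oint" "(\<Sum>A - z * w * a) / 2 \<in> Oint" by (auto simp: cnt_def)
      then show "A \<in> cnt z" using wO Oint_mult by (auto simp: cnt_def mult.assoc intro!: bexI[of _ "w * a"])
    qed
    have eq: "cnt (z * w) = cnt z"
      by (rule card_seteq[OF fin sub z(3)[OF Oint_mult[OF z(1) wO] nw]])
    obtain A where A: "A \<subseteq> X" "(z - \<Sum>A) / 2 \<in> Oint"
      using residue_subset[OF X(1), of z] z(1) X(2) by blast
    have "(\<Sum>A - z * 1) / 2 \<in> Oint" using Oint_uminus[OF A(2)] by (simp add: minus_divide_left)
    then have "A \<in> cnt z" using A(1) Oint_1 unfolding cnt_def by blast
    then have "A \<in> cnt (z * w)" using eq by simp
    then obtain a where a: "a \<in> Oint" "(\<Sum>A - z * w * a) / 2 \<in> Oint" by (auto simp: cnt_def)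
    note un = one_minus_nilpotent_unit[OF nilpotent_mod_2_mult[OF w a(1)]]
    have "inverse (1 - w * a) * ((z - \<Sum>A) / 2 + (\<Sum>A - z * w * a) / 2) \<in> Oint"
      using un A a by (intro Oint_mult Oint_add)
    moreover have "(z - \<Sum>A) / 2 + (\<Sum>A - z * w * a) / 2 = (1 - w * a) * (z / 2)"
      by (simp add: field_simps)
    ultimately have "(inverse (1 - w * a) * (1 - w * a)) * (z / 2) \<in> Oint" by (simp only: mult.assoc)
    then have "z / 2 \<in> Oint" using un(1) by simp
    then show False using z(2) by blast
  qed
  then show ?thesis using z by blast
qed

text \<open>The classical argument for integrally closed local rings: \<open>t = z / 2\<close> is
  not integral but multiplies the maximal ideal into \<open>Oint\<close>. If it preserved that
  ideal, all its powers would lie in one half of \<open>Oint\<close>, making \<open>t\<close>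
  integral. So some \<open>t * w\<close> is a unit, and \<open>w\<close> divides every element of
  the ideal.\<close>

lemma uniformizer_exists: "\<exists>w. nilpotent_mod_2 w \<and> w \<noteq> 0 \<and> (\<forall>y. nilpotent_mod_2 y \<longrightarrow> y / w \<in> Oint)"
proof -
  obtain z where z: "z \<in> Oint" "z / 2 \<notin> Oint" "\<And>w. nilpotent_mod_2 w \<Longrightarrow> z * w / 2 \<in> Oint"
    using socle_exists by blast
  define t where "t = z / 2"
  have t: "t \<notin> Oint" "\<And>w. nilpotent_mod_2 w \<Longrightarrow> t * w \<in> Oint" using z by (auto simp: t_def)
  have "\<exists>w. nilpotent_mod_2 w \<and> \<not> nilpotent_mod_2 (t * w)"
  proof (rule ccontr)
    assume "\<nexists>w. nilpotent_mod_2 w \<and> \<not> nilpotent_mod_2 (t * w)"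
    then have all: "nilpotent_mod_2 (t * w)" if "nilpotent_mod_2 w" for w using that by blast
    have n: "nilpotent_mod_2 (t ^ j * 2)" for j by (induction j) (auto simp: two_nilpotent_mod_2 mult.assoc intro: all)
    obtain X where X: "finite X" "Oint = zsp X" using Oint_finitely_generated by blast
    define Y where "Y = (\<lambda>(s, t). s * t) ` (X \<times> {inverse (2::'a)})"
    have "t ^ j \<in> zsp Y" for j
    proof -
      have "t ^ j * 2 \<in> zsp X" using n[of j] X(2) by (simp add: nilpotent_mod_2_def)
      then have "t ^ j * 2 * inverse 2 \<in> zsp Y"
        unfolding Y_def by (rule zsp_mult) (simp add: Z2.rspan_base)
      then show ?thesis by (simp add: mult.assoc)
    qed
    moreover have "finite Y" using X(1) by (simp add: Y_def)
    ultimately have "t \<in> Oint" unfolding integral_iff_powers by blast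
    then show False using t(1) by blast
  qed
  then obtain w where w: "nilpotent_mod_2 w" "\<not> nilpotent_mod_2 (t * w)" by blast
  then have u: "t * w \<noteq> 0" "inverse (t * w) \<in> Oint" using nilpotent_mod_2_or_unit[OF t(2)[OF w(1)]] by auto
  have "y / w \<in> Oint" if "nilpotent_mod_2 y" for y
  proof -
    have "t * y * inverse (t * w) \<in> Oint" by (rule Oint_mult[OF t(2)[OF that] u(2)])
    then show ?thesis using u(1) by (simp add: field_simps)
  qed
  then show ?thesis using w u by (intro exI[of _ w]) auto
qed

theorem ring_of_integers_dyadic_dvr: "\<exists>p. dyadic_dvr Oint p"
proof -
  obtain w where w: "nilpotent_mod_2 w" "w \<noteq> 0" "\<And>y. nilpotent_mod_2 y \<Longrightarrow> y / w \<in> Oint" using uniformizer_exists by blast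
  have wO: "w \<in> Oint" using w by (simp add: nilpotent_mod_2_def)
  obtain h where h: "w ^ h / 2 \<in> Oint" using w by (auto simp: nilpotent_mod_2_def)
  have pow: "w ^ (h * n) / 2 ^ n \<in> Oint" for n
    using Oint_power[OF h, of n] by (simp add: power_mult power_divide)
  have D: "dvr_subring Oint w"
  proof
    show "inverse w \<notin> Oint" using nilpotent_mod_2_not_unit w by blast
    fix x assume x: "x \<in> Oint" "x \<noteq> 0"
    \<comment> \<open>Since \<open>2 ^ n\<close> divides \<open>w ^ (h * n)\<close>, unlimited
      divisibility by \<open>w\<close> would contradict \<open>Oint_separated\<close>.\<close>
    have "\<exists>k. x / w ^ k \<notin> Oint"
    proof (rule ccontr)
      assume "\<nexists>k. x / w ^ k \<notin> Oint"
      then have a: "x / w ^ k \<in> Oint" for k by blast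
      have "x / 2 ^ n \<in> Oint" for n
        using Oint_mult[OF a[of "h * n"] pow[of n]] w(2) by simp
      then show False using Oint_separated x by blast
    qed
    then obtain k where k: "x / w ^ k \<notin> Oint" "\<And>j. j < k \<Longrightarrow> x / w ^ j \<in> Oint"
      using exists_least_iff[of "\<lambda>k. x / w ^ k \<notin> Oint"] by blast
    then obtain j where j: "k = Suc j" using x by (cases k) auto
    define u where "u = x / w ^ j"
    have u: "u \<in> Oint" "u / w \<notin> Oint" using k j by (simp_all add: u_def mult.commute)
    then have "u \<noteq> 0" "inverse u \<in> Oint" using nilpotent_mod_2_or_unit w(3) by blast+
    then show "\<exists>k u. u \<in> Oint \<and> inverse u \<in> Oint \<and> u \<noteq> 0 \<and> x = w ^ k * u"
      using u w(2) by (intro exI[of _ j] exI[of _ u]) (auto simp: u_def)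
  qed (use wO w(2) Oint_ring in auto)
  interpret D: dvr_subring Oint w by (rule D)
  \<comment> \<open>In residue characteristic 2, \<open>a ^ (2 * l) - 1\<close> is congruent to the
    square of \<open>a ^ l - 1\<close>, so even exponents can be halved until an odd one
    remains.\<close>
  have half_odd: "\<exists>r. odd r \<and> (a ^ r - 1) / w \<in> Oint" if "k > 0" "(a ^ k - 1) / w \<in> Oint" and a: "a \<in> Oint" for a k
    using that(1,2)
  proof (induction k rule: less_induct)
    case (less k)
    show ?case
    proof (cases "odd k")
      case False
      then obtain l where l: "k = 2 * l" by auto
      have 2: "2 / w \<in> Oint" using w(3)[OF two_nilpotent_mod_2] .
      have "(a ^ k - 1) / w - (2 / w) * (a ^ l - 1) \<in> Oint" using less 2 a by (intro Oint_ring)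
      moreover have "(a ^ k - 1) / w - (2 / w) * (a ^ l - 1) = (a ^ l - 1) * (a ^ l - 1) / w"
        unfolding l power_mult_distrib[symmetric] mult_2 power_add by (simp add: field_simps)
      ultimately have s: "(a ^ l - 1) * (a ^ l - 1) / w \<in> Oint" by simp
      have "(a ^ l - 1) / w \<in> Oint"
      proof (rule ccontr)
        assume "(a ^ l - 1) / w \<notin> Oint"
        then have "a ^ l - 1 \<noteq> 0" "inverse (a ^ l - 1) \<in> Oint"
          using D.unit_or_dvd[of "a ^ l - 1"] a Oint_ring by auto
        then have "(a ^ l - 1) * (a ^ l - 1) / w * inverse (a ^ l - 1) * inverse (a ^ l - 1) \<in> Oint"
          using s by (intro Oint_mult)
        then show False using \<open>a ^ l - 1 \<noteq> 0\<close> D.inverse_p by (simp add: inverse_eq_divide)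
      qed
      then show ?thesis using less.IH[of l] l less.prems by auto
    qed (use less in blast)
  qed
  have "dyadic_dvr Oint w"
  proof (intro dyadic_dvr.intro D dyadic_dvr_axioms.intro)
    fix x
    obtain N where "2 ^ N * x \<in> Oint" using multiple_integral by blast
    then have "w ^ (h * N) / 2 ^ N * (2 ^ N * x) \<in> Oint" by (rule Oint_mult[OF pow])
    then show "\<exists>k. w ^ k * x \<in> Oint" by (intro exI[of _ "h * N"]) simp
  next
    show "2 / w \<in> Oint" using w(3)[OF two_nilpotent_mod_2] .
  next
    fix a assume a: "a \<in> Oint"
    show "\<exists>t\<in>Oint. (a - t\<^sup>2) / w \<in> Oint"
    proof (cases "a / w \<in> Oint")
      case True then show ?thesis using Oint_0 by (intro bexI[of _ 0]) auto
    next
      case False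
      obtain k where k: "k > 0" "a ^ k / 2 \<in> Oint \<or> (a ^ k - 1) / 2 \<in> Oint" using power_mod_2[OF a] by blast
      have "a ^ k / 2 \<notin> Oint" using False w(3)[of a] a by (auto simp: nilpotent_mod_2_def)
      then have 1: "(a ^ k - 1) / 2 \<in> Oint" using k by blast
      have 2: "2 / w \<in> Oint" using w(3)[OF two_nilpotent_mod_2] .
      have "y / 2 * (2 / w) = y / w" for y :: 'a by simp
      then have "(a ^ k - 1) / w \<in> Oint" using Oint_mult[OF 1 2] by (simp only:)
      then obtain r where r: "odd r" "(a ^ r - 1) / w \<in> Oint" using half_odd k(1) a by blast
      \<comment> \<open>With \<open>a ^ r\<close> congruent to 1 for odd
        \<open>r = 2 * s + 1\<close>, the square of \<open>a ^ (s + 1)\<close>, which is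
        \<open>a ^ r * a\<close>, is congruent to \<open>a\<close>.\<close>
      then obtain s where s: "r = 2 * s + 1" by (elim oddE)
      have "a - (a ^ (s + 1))\<^sup>2 = - a * (a ^ r - 1)"
      proof -
        have "a ^ r = a ^ s * a ^ s * a" unfolding s by (simp add: power_add mult_2)
        then show ?thesis by (simp add: power2_eq_square algebra_simps)
      qed
      then have "(a - (a ^ (s + 1))\<^sup>2) / w = - a * ((a ^ r - 1) / w)" by simp
      also have "\<dots> \<in> Oint" using r a by (intro Oint_mult Oint_uminus)
      finally show ?thesis by (rule bexI) (rule Oint_power[OF a])
    qed
  next
    fix a c assume ac: "a \<in> Oint" "c \<in> Oint"
    have "(w * c) ^ h / 2 \<in> Oint" using Oint_mult[OF h Oint_power[OF ac(2), of h]] by (simp add: power_mult_distrib)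
    then obtain t where t: "a * (w * c) * t\<^sup>2 + t + 1 = 0"
      using Oint_hensel[OF ac(1) Oint_mult[OF wO ac(2)]] by blast
    \<comment> \<open>The substitution \<open>s = w * c * t\<close> turns the required equation into
      \<open>w * c\<close> times the equation solved by \<open>t\<close>.\<close>
    have "a * (w * c * t)\<^sup>2 + w * c * t + w * c = w * c * (a * (w * c) * t\<^sup>2 + t + 1)" by algebra
    then show "\<exists>s. a * s\<^sup>2 + s + w * c = 0" using t by auto
  qed
  then show ?thesis by blast
qed

end

section \<open>Quadratic lattices and the uniqueness of maximal lattices\<close>

context dyadic_dvr
begin

lemma two_dvd: "x \<in> R \<Longrightarrow> 2 * x / p \<in> R"
  using mult_in[OF two, of x] by simp

lemma one_minus_dvd_unit: assumes "x / p \<in> R" shows "1 - x \<noteq> 0" "inverse (1 - x) \<in> R"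
proof -
  have "(1 - x) / p \<notin> R"
  proof
    assume "(1 - x) / p \<in> R"
    from add_in[OF this assms] have "1 / p \<in> R" by (simp add: diff_divide_distrib)
    then show False using inverse_p by (simp add: inverse_eq_divide)
  qed
  then show "1 - x \<noteq> 0" "inverse (1 - x) \<in> R"
    using unit_or_dvd[of "1 - x"] dvd_imp_in[OF assms] diff_in one_in by blast+
qed

lemma in_or_inverse_dvd: "x \<in> R \<or> inverse x / p \<in> R"
proof (cases "x = 0")
  case False
  obtain k where k: "p ^ k * x \<in> R" using fraction by blast
  then obtain j u where j: "u \<in> R" "inverse u \<in> R" "u \<noteq> 0" "p ^ k * x = p ^ j * u"
    using factor[of "p ^ k * x"] False by auto
  show ?thesis
  proof (cases "k \<le> j")
    case True
    then have "p ^ j = p ^ k * p ^ (j - k)" by (simp flip: power_add)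
    then have "x = p ^ (j - k) * u" using j(4) by simp
    then show ?thesis using j by (simp add: ring_in)
  next
    case False
    then have "p ^ k = p ^ j * (p * p ^ (k - j - 1))" by (simp flip: power_add power_Suc)
    then have "u = p * p ^ (k - j - 1) * x" using j(4) by (simp add: mult.assoc)
    then have "inverse x / p = p ^ (k - j - 1) * inverse u" using \<open>x \<noteq> 0\<close> by (simp add: field_simps)
    then show ?thesis using j by (simp add: ring_in)
  qed
qed simp

text \<open>An even valuation that is at least -1 is nonnegative.\<close>

lemma square_in_imp: assumes "p * x\<^sup>2 \<in> R" shows "x \<in> R"
proof (rule ccontr)
  assume x: "x \<notin> R"
  then have i: "inverse x / p \<in> R" "x \<noteq> 0" using in_or_inverse_dvd by auto
  have "p * x\<^sup>2 * (inverse x / p) * (inverse x / p) \<in> R" by (rule mult_in[OF mult_in[OF assms i(1)] i(1)])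
  moreover have "p * x\<^sup>2 * (inverse x / p) * (inverse x / p) = inverse p"
    using i by (simp add: power2_eq_square field_simps)
  ultimately show False using inverse_p by simp
qed

lemma dvd_square_imp: assumes "x\<^sup>2 / p \<in> R" shows "x / p \<in> R"
  by (rule square_in_imp) (use assms in \<open>simp add: power2_eq_square\<close>)

lemma unit_mult_dvd: "u \<in> R \<Longrightarrow> u / p \<notin> R \<Longrightarrow> x * u / p \<in> R \<Longrightarrow> x / p \<in> R"
proof -
  assume u: "u \<in> R" "u / p \<notin> R" and x: "x * u / p \<in> R"
  then have "u \<noteq> 0" "inverse u \<in> R" using unit_or_dvd by blast+
  then show ?thesis using mult_in[OF x, of "inverse u"] by (simp add: field_simps)
qed

lemma one_not_dvd: "1 / p \<notin> R"
  using inverse_p by (simp add: inverse_eq_divide)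

lemma add_not_dvd: "x / p \<notin> R \<Longrightarrow> y / p \<in> R \<Longrightarrow> (x + y) / p \<notin> R"
  using diff_in[of "(x + y) / p" "y / p"] by (auto simp: add_divide_distrib)

lemma common_denominator:
  assumes "finite I" shows "\<exists>k. \<forall>i\<in>I. p ^ k * f i \<in> R"
  using assms
proof (induction I rule: finite_induct)
  case (insert i I)
  then obtain k where k: "\<forall>i\<in>I. p ^ k * f i \<in> R" by blast
  obtain l where l: "p ^ l * f i \<in> R" using fraction by blast
  have "p ^ (k + l) * f j = p ^ l * (p ^ k * f j)" "p ^ (k + l) * f j = p ^ k * (p ^ l * f j)" for j
    by (simp_all add: power_add ac_simps)
  then have "p ^ (k + l) * f j \<in> R" if "j \<in> insert i I" for j
    using that k l by (metis insert_iff mult_in power_in p_in)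
  then show ?case by blast
qed simp

end

text \<open>Symmetry and bilinearity are demanded on the ambient space, so that rewriting with them
  needs no membership conditions; only nondegeneracy refers to \<open>V\<close>. The form of a given
  lattice is brought into this shape by a projection at the end.\<close>

locale quadratic_lattices = dyadic_dvr R p + vector_space sc
  for R :: "'a::field_char_0 set" and p :: 'a and sc :: "'a \<Rightarrow> 'v::ab_group_add \<Rightarrow> 'v" +
  fixes B :: "'v \<Rightarrow> 'v \<Rightarrow> 'a" and V :: "'v set"
  assumes B_sym: "B x y = B y x"
    and B_add: "B (x + y) z = B x z + B y z"
    and B_scale: "B (sc c x) y = c * B x y"
    and V_subspace: "subspace V"
    and V_fg: "\<exists>S. finite S \<and> V = span S"
    and V_nondegenerate: "\<lbrakk>x \<in> V; \<And>y. y \<in> V \<Longrightarrow> B x y = 0\<rbrakk> \<Longrightarrow> x = 0"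
begin

sublocale dvr_module R p sc ..

text \<open>In terms of \<open>q\<close> and its polar form \<open>b\<close>, a module with \<open>q\<close> integral has \<open>b\<close> integral; for \<open>B\<close> this
  fails in residue characteristic 2.\<close>

definition q :: "'v \<Rightarrow> 'a" where "q x = B x x"
definition b :: "'v \<Rightarrow> 'v \<Rightarrow> 'a" where "b x y = 2 * B x y"

lemma b_sym: "b x y = b y x"
  by (simp add: b_def B_sym)

lemma b_left [simp]: "b (x + y) z = b x z + b y z" "b (sc c x) z = c * b x z"
  "b 0 z = 0" "b (- x) z = - b x z" "b (x - y) z = b x z - b y z"
proof -
  show a: "b (x + y) z = b x z + b y z" and s: "b (sc c x) z = c * b x z" for x y z c
    by (simp_all add: b_def B_add B_scale algebra_simps)
  show "b 0 z = 0" using s[of 0 0 z] by simp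
  show m: "b (- x) z = - b x z" for x using s[of "-1" x z] by simp
  show "b (x - y) z = b x z - b y z" using a[of x "- y" z] m by simp
qed

lemma b_right [simp]: "b z (x + y) = b z x + b z y" "b z (sc c x) = c * b z x"
  "b z 0 = 0" "b z (- x) = - b z x" "b z (x - y) = b z x - b z y"
  by (simp_all add: b_sym[of z])

lemma b_self [simp]: "b x x = 2 * q x"
  by (simp add: b_def q_def)

lemma q_add: "q (x + y) = q x + b x y + q y"
proof -
  have "B z (x + y) = B z x + B z y" for z using B_add[of x y z] by (simp only: B_sym)
  then show ?thesis by (simp add: q_def b_def B_add B_sym[of y x])
qed

lemma q_scale [simp]: "q (sc c x) = c\<^sup>2 * q x"
proof -
  have "B z (sc c x) = c * B z x" for z using B_scale[of c x z] by (simp only: B_sym)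
  then show ?thesis by (simp add: q_def B_scale power2_eq_square)
qed

lemma q_0 [simp]: "q 0 = 0" and q_uminus [simp]: "q (- x) = q x"
  using q_scale[of 0 0] q_scale[of "-1" x] by simp_all

lemma q_diff: "q (x - y) = q x - b x y + q y"
  using q_add[of x "- y"] by simp

lemma V_nondeg: "x \<in> V \<Longrightarrow> (\<And>y. y \<in> V \<Longrightarrow> b x y = 0) \<Longrightarrow> x = 0"
  using V_nondegenerate by (simp add: b_def)

lemmas V_in = subspace_add[OF V_subspace] subspace_scale[OF V_subspace]
  subspace_diff[OF V_subspace] subspace_neg[OF V_subspace] subspace_0[OF V_subspace]

lemma V_span: "S \<subseteq> V \<Longrightarrow> span S \<subseteq> V"
  using span_minimal V_subspace by blast

lemma rspan_subset_span: "rsp S \<subseteq> span S"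
  by (rule rspan_minimal) (auto simp: submod_def span_add span_scale span_zero span_base)

lemma perp_span: "(\<And>v. v \<in> S \<Longrightarrow> b v x = 0) \<Longrightarrow> w \<in> span S \<Longrightarrow> b w x = 0"
  using span_minimal[of S "{w. b w x = 0}"] by (auto simp: subspace_def)

lemma perp_rspan: "(\<And>v. v \<in> S \<Longrightarrow> b v x = 0) \<Longrightarrow> w \<in> rsp S \<Longrightarrow> b w x = 0"
  using perp_span rspan_subset_span by blast

abbreviation perp :: "'v \<Rightarrow> 'v set \<Rightarrow> bool" where "perp x A \<equiv> \<forall>v\<in>A. b v x = 0"

section \<open>Splitting off binary modular lattices\<close>

text \<open>The Gram determinant of \<open>x\<close> and \<open>y\<close> is \<open>- d * d\<close>
  times \<open>1 - 4 * X * Y\<close>, a unit because \<open>p\<close> divides 2. So the plane is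
  \<open>d\<close>-modular and splits off. Frames use \<open>d = 1\<close>; a \<open>d\<close> of
  valuation one serves the \<open>p\<close>-modular plane.\<close>

lemma split_pair:
  assumes d: "d \<noteq> 0" "b x y = d" and R: "q x / d \<in> R" "q y / d \<in> R" "b z x / d \<in> R" "b z y / d \<in> R"
  shows "\<exists>\<alpha>\<in>R. \<exists>\<beta>\<in>R. b x (z - (sc \<alpha> x + sc \<beta> y)) = 0 \<and> b y (z - (sc \<alpha> x + sc \<beta> y)) = 0"
proof -
  define X Y a c where "X = q x / d" and "Y = q y / d" and "a = b z x / d" and "c = b z y / d"
  have eqs: "q x = d * X" "q y = d * Y" "b x z = d * a" "b y z = d * c" "b y x = d"
    using d by (simp_all add: X_def Y_def a_def c_def b_sym[of _ z] b_sym[of y x])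
  have R': "X \<in> R" "Y \<in> R" "a \<in> R" "c \<in> R" using R by (simp_all add: X_def Y_def a_def c_def)
  have "2 * (2 * X * Y) / p \<in> R" using R' by (intro two_dvd ring_in)
  from one_minus_dvd_unit[OF this] have D: "1 - 4 * X * Y \<noteq> 0" "inverse (1 - 4 * X * Y) \<in> R"
    by (simp_all add: mult.assoc)
  define D where "D = inverse (1 - 4 * X * Y)"
  have D1: "D * (1 - 4 * X * Y) = 1" using D by (simp add: D_def)
  \<comment> \<open>Cramer's rule for \<open>2 * X * \<alpha> + \<beta> = a\<close> and
    \<open>\<alpha> + 2 * Y * \<beta> = c\<close>.\<close>
  define \<alpha> \<beta> where "\<alpha> = D * (c - 2 * Y * a)" and "\<beta> = D * (a - 2 * X * c)"
  have e: "2 * X * \<alpha> + \<beta> = a" "\<alpha> + 2 * Y * \<beta> = c" using D1 unfolding \<alpha>_def \<beta>_def by algebra+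
  have "d * a - (\<alpha> * (2 * (d * X)) + \<beta> * d) = 0" "d * c - (\<alpha> * d + \<beta> * (2 * (d * Y))) = 0"
    unfolding e[symmetric] by (simp_all add: algebra_simps)
  then have "b x (z - (sc \<alpha> x + sc \<beta> y)) = 0" "b y (z - (sc \<alpha> x + sc \<beta> y)) = 0"
    unfolding b_right b_self d(2) eqs .
  moreover have "\<alpha> \<in> R" "\<beta> \<in> R" using R' D(2) unfolding \<alpha>_def \<beta>_def D_def by (auto intro!: ring_in)
  ultimately show ?thesis by blast
qed

definition vecs :: "('v \<times> 'v) list \<Rightarrow> 'v set" where
  "vecs ps = fst ` set ps \<union> snd ` set ps"

lemma vecs_simps [simp]: "vecs [] = {}" "vecs ((x, y) # ps) = insert x (insert y (vecs ps))"
  by (auto simp: vecs_def)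

lemma finite_vecs [simp]: "finite (vecs ps)"
  by (simp add: vecs_def)

text \<open>A frame spans an orthogonal sum of binary lattices that are unimodular for \<open>b\<close>, so it splits off
  every integral module containing it.\<close>

fun frame :: "('v \<times> 'v) list \<Rightarrow> bool" where
  "frame [] = True"
| "frame ((x, y) # ps) \<longleftrightarrow>
     x \<in> V \<and> y \<in> V \<and> b x y = 1 \<and> q x \<in> R \<and> q y \<in> R \<and> perp x (vecs ps) \<and> perp y (vecs ps) \<and> frame ps"

lemma frame_split:
  assumes "frame ps" "\<And>v. v \<in> vecs ps \<Longrightarrow> b z v \<in> R"
  shows "\<exists>k\<in>rsp (vecs ps). perp (z - k) (vecs ps)"
  using assms
proof (induction ps)
  case Nil then show ?case by (auto simp: rspan_empty)
next
  case (Cons xy ps)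
  obtain x y where xy: "xy = (x, y)" by (cases xy)
  note f = Cons.prems[unfolded xy, simplified]
  obtain k where k: "k \<in> rsp (vecs ps)" "perp (z - k) (vecs ps)" using Cons.IH f by auto
  obtain \<alpha> \<beta> where ab: "\<alpha> \<in> R" "\<beta> \<in> R" "b x (z - (sc \<alpha> x + sc \<beta> y)) = 0" "b y (z - (sc \<alpha> x + sc \<beta> y)) = 0"
    using split_pair[of 1 x y z] f by auto
  have kx: "b x k = 0" "b y k = 0"
    using perp_rspan[of "vecs ps" x k] perp_rspan[of "vecs ps" y k] f k(1) by (auto simp: b_sym)
  have "sc \<alpha> x + (sc \<beta> y + k) \<in> rsp (insert x (insert y (vecs ps)))"
    using ab k(1) rspan_mono[of "vecs ps" "insert x (insert y (vecs ps))"]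
    by (intro rspan.step) auto
  moreover have "perp (z - (sc \<alpha> x + (sc \<beta> y + k))) (insert x (insert y (vecs ps)))"
    using ab kx k(2) f by auto
  ultimately show ?case unfolding xy vecs_simps by blast
qed

text \<open>\<open>frame_split\<close> applied to \<open>z\<close> divided by \<open>p\<close>. It
  makes a vector of the radical modulo \<open>p\<close> orthogonal to a frame at the cost of
  \<open>p\<close> times a lattice vector.\<close>

lemma frame_split_dvd:
  assumes "frame ps" "\<And>v. v \<in> vecs ps \<Longrightarrow> b z v / p \<in> R"
  shows "\<exists>k\<in>rsp (vecs ps). perp (z - sc p k) (vecs ps)"
proof -
  obtain k where k: "k \<in> rsp (vecs ps)" "perp (sc (inverse p) z - k) (vecs ps)"
    using frame_split[OF assms(1), of "sc (inverse p) z"] assms(2) by (auto simp: divide_inverse mult.commute)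
  have "z - sc p k = sc p (sc (inverse p) z - k)" by (simp add: scale_right_diff_distrib)
  then have "perp (z - sc p k) (vecs ps)" using k(2) by auto
  then show ?thesis using k by blast
qed

definition nondeg_on :: "'v set \<Rightarrow> bool" where
  "nondeg_on A \<longleftrightarrow> (\<forall>x\<in>span A. perp x A \<longrightarrow> x = 0)"

lemma nondeg_on_union:
  assumes "nondeg_on A" "nondeg_on T" "\<And>a t. a \<in> A \<Longrightarrow> t \<in> T \<Longrightarrow> b a t = 0"
  shows "nondeg_on (A \<union> T)"
  unfolding nondeg_on_def
proof (intro ballI impI)
  fix x assume x: "x \<in> span (A \<union> T)" "perp x (A \<union> T)"
  then obtain y t where yt: "y \<in> span A" "t \<in> span T" "x = y + t" by (auto simp: span_Un)
  have "b v t = 0" if "v \<in> A" for v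
    using perp_span[of T v t] yt(2) assms(3)[OF that] by (simp add: b_sym)
  then have "b v y = 0" if "v \<in> A" for v
    using bspec[OF x(2), of v] yt(3) that by simp
  moreover have "b v y = 0" if "v \<in> T" for v
    using perp_span[of A v y] yt(1) assms(3)[OF _ that] by (simp add: b_sym)
  then have "b v t = 0" if "v \<in> T" for v
    using bspec[OF x(2), of v] yt(3) that by simp
  ultimately show "x = 0" using assms(1,2) yt by (auto simp: nondeg_on_def)
qed

lemma nondeg_on_single: "q u \<noteq> 0 \<Longrightarrow> nondeg_on {u}"
  by (auto simp: nondeg_on_def span_singleton)

lemma nondeg_on_pair: assumes "4 * q x * q y \<noteq> (b x y)\<^sup>2" shows "nondeg_on {x, y}"
  unfolding nondeg_on_def
proof (intro ballI impI)
  fix z assume z: "z \<in> span {x, y}" "perp z {x, y}"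
  then obtain \<alpha> \<beta> where ab: "z = sc \<alpha> x + sc \<beta> y"
    by (auto simp: span_insert span_singleton) (metis add.commute diff_eq_eq)
  have "2 * \<alpha> * q x + \<beta> * b x y = 0" "\<alpha> * b x y + 2 * \<beta> * q y = 0"
    using z(2) unfolding ab by (auto simp: b_sym[of y x] algebra_simps)
  then have "\<alpha> * (4 * q x * q y - (b x y)\<^sup>2) = 0" "\<beta> * (4 * q x * q y - (b x y)\<^sup>2) = 0"
    by algebra+
  then show "z = 0" using assms ab by simp
qed

lemma frame_disc: assumes "x \<in> R" "y \<in> R" shows "4 * x * y \<noteq> (1 :: 'a)"
proof -
  have "2 * (2 * x * y) / p \<in> R" using assms by (intro two_dvd ring_in)
  from one_minus_dvd_unit(1)[OF this] show ?thesis by (simp add: mult.assoc)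
qed

lemma nondeg_on_empty: "nondeg_on {}"
  by (auto simp: nondeg_on_def)

lemma nondeg_on_frame: "frame ps \<Longrightarrow> nondeg_on (vecs ps)"
proof (induction ps)
  case (Cons xy ps)
  obtain x y where xy: "xy = (x, y)" by (cases xy)
  note f = Cons.prems[unfolded xy, simplified]
  have "nondeg_on ({x, y} \<union> vecs ps)"
    by (rule nondeg_on_union) (use Cons.IH f frame_disc[of "q x" "q y"] nondeg_on_pair[of x y] in \<open>auto simp: b_sym\<close>)
  then show ?case by (simp add: xy insert_commute)
qed (simp add: nondeg_on_empty)

lemma independent_insert_pair:
  assumes A: "independent A" and d: "4 * q x * q y \<noteq> (b x y)\<^sup>2" and "perp x A" "perp y A"
  shows "independent (insert x (insert y A))" "x \<notin> insert y A" "y \<notin> A"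
proof -
  have ns: "y \<notin> span A"
  proof
    assume y: "y \<in> span A"
    have "b y x = 0" "b y y = 0" using perp_span[OF _ y] assms(3,4) by blast+
    then show False using d by (simp add: b_sym[of x y])
  qed
  have "x \<notin> span (insert y A)"
  proof
    assume "x \<in> span (insert y A)"
    then obtain c where c: "x - sc c y \<in> span A" by (auto simp: span_insert)
    have "b (x - sc c y) x = 0" "b (x - sc c y) y = 0" using perp_span[OF _ c] assms(3,4) by blast+
    then have "2 * q x = c * b x y" "b x y = 2 * c * q y" by (auto simp: b_sym[of y x])
    then have "4 * q x * q y = (b x y)\<^sup>2" by algebra
    then show False using d by simp
  qed
  then show "independent (insert x (insert y A))" "x \<notin> insert y A" "y \<notin> A"
    using A ns independent_insertI span_base by blast+
qed

lemma frame_independent: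
  assumes "frame ps" "independent T" "finite T" "\<And>t. t \<in> T \<Longrightarrow> perp t (vecs ps)"
  shows "independent (vecs ps \<union> T) \<and> card (vecs ps \<union> T) = 2 * length ps + card T"
  using assms
proof (induction ps)
  case (Cons xy ps)
  obtain x y where xy: "xy = (x, y)" by (cases xy)
  note f = Cons.prems[unfolded xy, simplified]
  have IH: "independent (vecs ps \<union> T) \<and> card (vecs ps \<union> T) = 2 * length ps + card T"
    using Cons.IH f by auto
  have "4 * q x * q y \<noteq> (b x y)\<^sup>2" "perp x (vecs ps \<union> T)" "perp y (vecs ps \<union> T)"
    using f frame_disc[of "q x" "q y"] by (auto simp: b_sym)
  from independent_insert_pair[OF conjunct1[OF IH] this] show ?case
    using IH f by (simp add: xy)
qed simp

lemma V_dim_bound: assumes "A \<subseteq> V" "independent A" shows "finite A" "card A \<le> dim V"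
proof -
  obtain S where S: "finite S" "V = span S" using V_fg by blast
  obtain T where T: "T \<subseteq> V" "independent T" "V \<subseteq> span T" "card T = dim V"
    using basis_exists[of V] by blast
  have "finite T" using independent_span_bound[OF S(1) T(2)] T(1) S(2) by blast
  then show "finite A" "card A \<le> dim V" using independent_span_bound[of T A] assms T by auto
qed

lemma V_spanned: assumes "A \<subseteq> V" "independent A" "dim V \<le> card A" shows "span A = V"
proof
  show "span A \<subseteq> V" by (rule V_span[OF assms(1)])
  show "V \<subseteq> span A"
  proof
    fix v assume v: "v \<in> V"
    show "v \<in> span A"
    proof (rule ccontr)
      assume n: "v \<notin> span A"
      then have i: "independent (insert v A)" "v \<notin> A" using assms(2) independent_insertI span_base by blast+
      have "card (insert v A) \<le> dim V" using V_dim_bound(2)[of "insert v A"] i assms(1) v by blast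
      then show False using i(2) V_dim_bound(1)[OF assms(1,2)] assms(3) by simp
    qed
  qed
qed

lemma vecs_subset: "frame ps \<Longrightarrow> vecs ps \<subseteq> V"
  by (induction ps rule: frame.induct) auto

lemma frame_length: "frame ps \<Longrightarrow> 2 * length ps \<le> dim V"
  using frame_independent[of ps "{}"] V_dim_bound(2)[OF vecs_subset, of ps] by (simp add: independent_empty)

section \<open>Integral modules and their maximal extensions\<close>

definition integral :: "'v set \<Rightarrow> bool" where
  "integral L \<longleftrightarrow> submod L \<and> L \<subseteq> V \<and> (\<forall>x\<in>L. q x \<in> R)"

lemma integralD: assumes "integral L"
  shows "submod L" "L \<subseteq> V" "x \<in> L \<Longrightarrow> q x \<in> R" "x \<in> L \<Longrightarrow> y \<in> L \<Longrightarrow> b x y \<in> R"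
proof -
  show L: "submod L" "L \<subseteq> V" "x \<in> L \<Longrightarrow> q x \<in> R" for x using assms by (auto simp: integral_def)
  show "b x y \<in> R" if "x \<in> L" "y \<in> L"
    using L(3)[OF submodD(2)[OF L(1) that]] L(3)[OF that(1)] L(3)[OF that(2)] diff_in[of "q (x + y)" "q x + q y"] add_in
    by (simp add: q_add)
qed

text \<open>The last clause is maximality tested on one additional vector: \<open>x\<close>
  satisfies its premises exactly if adjoining it keeps \<open>q\<close> integral.
  \<open>maximal_iff\<close> relates this to inclusion among lattices.\<close>

definition max_lattice :: "'v set \<Rightarrow> bool" where
  "max_lattice L \<longleftrightarrow> integral L \<and> span L = V \<and> (\<forall>x\<in>V. q x \<in> R \<longrightarrow> (\<forall>m\<in>L. b x m \<in> R) \<longrightarrow> x \<in> L)"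

lemma rspan_submod: "submod L \<Longrightarrow> rsp L = L"
  using rspan_minimal[of L L] rspan_superset[of L] by blast

lemma integral_insert:
  assumes L: "integral L" and x: "x \<in> V" "q x \<in> R" "\<And>m. m \<in> L \<Longrightarrow> b x m \<in> R"
  shows "integral (rsp (insert x L))"
proof -
  note LD = integralD[OF L]
  have "q z \<in> R" "z \<in> V" if z: "z \<in> rsp (insert x L)" for z
  proof -
    obtain c w where cw: "c \<in> R" "w \<in> L" "z = sc c x + w"
      using z rspan_submod[OF LD(1)] by (auto simp: rspan_insert)
    then show "q z \<in> R" "z \<in> V" using x LD by (auto simp: q_add intro!: ring_in V_in)
  qed
  then show ?thesis unfolding integral_def using submod_rspan by blast
qed

text \<open>Pairing with a basis taken from \<open>L\<close> gives functionals that are integral on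
  \<open>L\<close> and, by nondegeneracy, separate its points.\<close>

lemma integral_spanning_fg:
  assumes "integral L" "span L = V" shows "\<exists>T. finite T \<and> L = rsp T"
proof -
  obtain T where T: "T \<subseteq> L" "independent T" "L \<subseteq> span T" "card T = dim L" by (rule basis_exists)
  note LD = integralD[OF assms(1)]
  have fT: "finite T" using V_dim_bound(1)[of T] T LD(2) by blast
  have sT: "span T = V"
    using span_minimal[OF T(3) subspace_span] span_mono[OF T(1)] assms(2) by (intro equalityI) auto
  show ?thesis
  proof (rule finitely_generated_by_functionals[OF fT LD(1), of "\<lambda>t x. b t x"])
    fix x assume x: "x \<in> L" "\<And>t. t \<in> T \<Longrightarrow> b t x = 0"
    show "x = 0"
      by (rule V_nondeg) (use x LD perp_span[of T x] sT in \<open>auto simp: b_sym\<close>)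
  qed (use T LD in auto)
qed

text \<open>Spanning vectors of \<open>V\<close> are adjoined one at a time, each scaled by a power
  of \<open>p\<close> that makes its value and its pairings integral.\<close>

lemma extend_to_spanning:
  assumes "finite S" "integral (rsp S)"
  shows "\<exists>L. integral L \<and> span L = V \<and> rsp S \<subseteq> L"
proof -
  obtain T where T: "finite T" "V = span T" using V_fg by blast
  have "\<exists>S'. finite S' \<and> integral (rsp S') \<and> rsp S \<subseteq> rsp S' \<and> T' \<subseteq> span S'" if "finite T'" "T' \<subseteq> V" for T'
    using that
  proof (induction T' rule: finite_induct)
    case empty then show ?case using assms by auto
  next
    case (insert t T')
    then obtain S' where S': "finite S'" "integral (rsp S')" "rsp S \<subseteq> rsp S'" "T' \<subseteq> span S'" by auto
    obtain k where k: "\<forall>c\<in>insert (q t) (b t ` S'). p ^ k * c \<in> R"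
      using common_denominator[of "insert (q t) (b t ` S')" "\<lambda>c. c"] S'(1) by auto
    define s where "s = sc (p ^ k) t"
    have "p ^ k * (p ^ k * q t) \<in> R" using k by (simp add: ring_in)
    then have qs: "q s \<in> R" by (simp add: s_def power2_eq_square mult.assoc)
    have "submod {w. b s w \<in> R}" by (auto simp: submod_def ring_in)
    then have bs: "b s m \<in> R" if "m \<in> rsp S'" for m
      using rspan_minimal[of "{w. b s w \<in> R}" S'] k that by (auto simp: s_def)
    have "integral (rsp (insert s (rsp S')))"
      by (rule integral_insert) (use S' qs bs insert.prems in \<open>auto simp: s_def V_in\<close>)
    moreover have "rsp (insert s (rsp S')) = rsp (insert s S')"
    proof
      show "rsp (insert s (rsp S')) \<subseteq> rsp (insert s S')"
        by (rule rspan_minimal[OF submod_rspan]) (use rspan_mono[of S' "insert s S'"] in \<open>auto intro: rspan_base\<close>)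
      show "rsp (insert s S') \<subseteq> rsp (insert s (rsp S'))"
        by (rule rspan_mono) (use rspan_superset in auto)
    qed
    moreover have "t \<in> span (insert s S')"
      using span_scale[of s "insert s S'" "inverse (p ^ k)"] by (simp add: s_def span_base)
    moreover have "T' \<subseteq> span (insert s S')" "rsp S \<subseteq> rsp (insert s S')"
      using S' span_mono[of S' "insert s S'"] rspan_mono[of S' "insert s S'"] by auto
    ultimately show ?case using S'(1) by (intro exI[of _ "insert s S'"]) auto
  qed
  from this[OF T(1)] T(2) span_superset obtain S' where
    S': "integral (rsp S')" "rsp S \<subseteq> rsp S'" "T \<subseteq> span S'" by metis
  have "span T \<subseteq> span S'" using S'(3) span_minimal subspace_span by blast
  also have "\<dots> \<subseteq> span (rsp S')" by (rule span_mono[OF rspan_superset])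
  finally have "span (rsp S') = V" using T(2) V_span integralD(2)[OF S'(1)] by blast
  then show ?thesis using S' by blast
qed

text \<open>Zorn's lemma applies because \<open>integral\<close> says nothing about finite
  generation and so passes to unions of chains; \<open>integral_spanning_fg\<close> restores it
  afterwards.\<close>

lemma extend_to_maximal:
  assumes L: "integral L" "span L = V"
  shows "\<exists>M. max_lattice M \<and> L \<subseteq> M"
proof -
  define \<A> where "\<A> = {M. integral M \<and> L \<subseteq> M}"
  have "\<exists>M\<in>\<A>. \<forall>X\<in>\<A>. M \<subseteq> X \<longrightarrow> X = M"
  proof (rule subset_Zorn)
    fix C assume C: "subset.chain \<A> C"
    show "\<exists>U\<in>\<A>. \<forall>X\<in>C. X \<subseteq> U"
    proof (cases "C = {}")
      case True then show ?thesis using L by (auto simp: \<A>_def)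
    next
      case False
      have sub: "\<And>X. X \<in> C \<Longrightarrow> integral X \<and> L \<subseteq> X" using C by (auto simp: subset.chain_def \<A>_def)
      have tot: "\<And>X Y. X \<in> C \<Longrightarrow> Y \<in> C \<Longrightarrow> X \<subseteq> Y \<or> Y \<subseteq> X"
        using C by (auto simp: subset_chain_def)
      have "submod (\<Union>C)"
        unfolding submod_def
      proof (intro conjI ballI)
        show "0 \<in> \<Union>C" using False sub integralD(1) submodD(1) by blast
        show "x + y \<in> \<Union>C" if xy: "x \<in> \<Union>C" "y \<in> \<Union>C" for x y
        proof -
          obtain X Y where "X \<in> C" "x \<in> X" "Y \<in> C" "y \<in> Y" using xy by blast
          then obtain Z where "Z \<in> C" "x \<in> Z" "y \<in> Z" using tot[of X Y] by blast
          then show ?thesis using sub integralD(1) submodD(2) by blast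
        qed
        show "sc c x \<in> \<Union>C" if "c \<in> R" "x \<in> \<Union>C" for c x
          using that sub integralD(1) submodD(3) by blast
      qed
      then have "integral (\<Union>C)" using sub unfolding integral_def by blast
      moreover have "L \<subseteq> \<Union>C" using False sub by blast
      ultimately show ?thesis by (auto simp: \<A>_def)
    qed
  qed
  then obtain M where M: "integral M" "L \<subseteq> M" "\<And>X. integral X \<Longrightarrow> M \<subseteq> X \<Longrightarrow> X = M"
    by (auto simp: \<A>_def)
  have "span M = V" using L(2) span_mono[OF M(2)] V_span[OF integralD(2)[OF M(1)]] by blast
  moreover have "x \<in> M" if x: "x \<in> V" "q x \<in> R" "\<forall>m\<in>M. b x m \<in> R" for x
  proof -
    have "integral (rsp (insert x M))" by (rule integral_insert) (use M x in auto)
    moreover have "insert x M \<subseteq> rsp (insert x M)" by (rule rspan_superset)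
    ultimately show ?thesis using M(3)[of "rsp (insert x M)"] by blast
  qed
  ultimately show ?thesis unfolding max_lattice_def using M by blast
qed

lemma frame_split_in:
  assumes "integral L" "frame ps" "vecs ps \<subseteq> L" "z \<in> L"
  shows "\<exists>k\<in>rsp (vecs ps). k \<in> L \<and> z - k \<in> L \<and> perp (z - k) (vecs ps)"
proof -
  note LD = integralD[OF assms(1)]
  obtain k where k: "k \<in> rsp (vecs ps)" "perp (z - k) (vecs ps)"
    using frame_split[OF assms(2), of z] LD(4) assms(3,4) by blast
  moreover have "k \<in> L" using k(1) rspan_minimal[OF LD(1) assms(3)] by blast
  ultimately show ?thesis using submodD(4)[OF LD(1) assms(4)] by blast
qed

section \<open>Reflections and transitivity on hyperbolic planes\<close>

definition isometry :: "('v \<Rightarrow> 'v) \<Rightarrow> bool" where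
  "isometry g \<longleftrightarrow> (\<forall>x y. g (x + y) = g x + g y) \<and> (\<forall>c x. g (sc c x) = sc c (g x)) \<and>
     (\<forall>x y. b (g x) (g y) = b x y) \<and> (\<forall>x\<in>V. g x \<in> V)"

lemma isometryD: assumes "isometry g"
  shows "g (x + y) = g x + g y" "g (sc c x) = sc c (g x)" "b (g x) (g y) = b x y" "x \<in> V \<Longrightarrow> g x \<in> V"
    "q (g x) = q x" "g 0 = 0" "g (x - y) = g x - g y"
proof -
  show a: "g (x + y) = g x + g y" "g (sc c x) = sc c (g x)" "b (g x) (g y) = b x y" "x \<in> V \<Longrightarrow> g x \<in> V" for x y c
    using assms by (auto simp: isometry_def)
  show "q (g x) = q x" using a(3)[of x x] by simp
  show "g 0 = 0" using a(2)[of 0 0] by simp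
  have "g (- y) = - g y" using a(2)[of "-1" y] by simp
  then show "g (x - y) = g x - g y" using a(1)[of x "- y"] by simp
qed

lemma isometry_comp: "isometry g \<Longrightarrow> isometry h \<Longrightarrow> isometry (g \<circ> h)"
  by (auto simp: isometry_def)

definition reflect :: "'v \<Rightarrow> 'v \<Rightarrow> 'v" where
  "reflect v x = x - sc (b x v / q v) v"

lemma isometry_reflect: assumes "v \<in> V" "q v \<noteq> 0" shows "isometry (reflect v)"
  unfolding isometry_def
proof (intro conjI allI ballI)
  fix x y c
  show "reflect v (x + y) = reflect v x + reflect v y"
    by (simp add: reflect_def add_divide_distrib scale_left_distrib)
  show "reflect v (sc c x) = sc c (reflect v x)"
    by (simp add: reflect_def scale_right_diff_distrib)
  show "b (reflect v x) (reflect v y) = b x y"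
    using assms by (simp add: reflect_def b_sym[of v] field_simps)
  show "reflect v x \<in> V" if "x \<in> V" using that assms by (simp add: reflect_def V_in)
qed

text \<open>The reflection in \<open>u - u'\<close> works unless that vector is isotropic. Then
  \<open>u + u'\<close> has value \<open>4 * q u\<close>; its reflection sends \<open>u\<close> to
  \<open>- u'\<close>, and the reflection in \<open>u'\<close> corrects the sign. Fixing everything
  orthogonal to both vectors allows vectors to be moved one after the other.\<close>

lemma witt_vector:
  assumes u: "u \<in> V" "u' \<in> V" "q u = q u'" "q u \<noteq> 0"
  shows "\<exists>g. isometry g \<and> g u = u' \<and> (\<forall>z. b z u = 0 \<and> b z u' = 0 \<longrightarrow> g z = z)"
proof (cases "q (u - u') = 0")
  case False
  have "b u (u - u') = q (u - u')" using u by (simp add: q_diff)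
  then have "reflect (u - u') u = u'" using False by (simp add: reflect_def)
  moreover have "isometry (reflect (u - u'))" using False u by (intro isometry_reflect) (auto simp: V_in)
  moreover have "\<forall>z. b z u = 0 \<and> b z u' = 0 \<longrightarrow> reflect (u - u') z = z" by (simp add: reflect_def)
  ultimately show ?thesis by blast
next
  case True
  then have bu: "b u u' = 2 * q u" using u by (simp add: q_diff)
  have qs: "q (u + u') = 4 * q u" using bu u by (simp add: q_add)
  have "b u (u + u') = q (u + u')" unfolding qs using bu by simp
  then have 1: "reflect (u + u') u = - u'" using qs u by (simp add: reflect_def)
  have 2: "reflect u' (- u') = u'" using u by (simp add: reflect_def scale_left_distrib[of 1 1, simplified])
  have "isometry (reflect u' \<circ> reflect (u + u'))"
    using u qs by (intro isometry_comp isometry_reflect) (auto simp: V_in)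
  moreover have "\<forall>z. b z u = 0 \<and> b z u' = 0 \<longrightarrow> (reflect u' \<circ> reflect (u + u')) z = z"
    by (simp add: reflect_def)
  ultimately show ?thesis using 1 2 by (intro exI[of _ "reflect u' \<circ> reflect (u + u')"]) simp
qed

definition hframe :: "('v \<times> 'v) list \<Rightarrow> bool" where
  "hframe ps \<longleftrightarrow> frame ps \<and> (\<forall>v\<in>vecs ps. q v = 0)"

lemma hframe_Cons: "hframe ((x, y) # ps) \<longleftrightarrow>
  x \<in> V \<and> y \<in> V \<and> b x y = 1 \<and> q x = 0 \<and> q y = 0 \<and> perp x (vecs ps) \<and> perp y (vecs ps) \<and> hframe ps"
  by (auto simp: hframe_def)

lemma hframe_drop: "hframe ps \<Longrightarrow> hframe (drop n ps)"
proof (induction ps arbitrary: n)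
  case (Cons xy ps)
  then show ?case by (cases n; cases xy) (auto simp: hframe_Cons)
qed simp

lemma vecs_map: "vecs (map (map_prod g g) ps) = g ` vecs ps"
  by (auto simp: vecs_def image_iff) force+

text \<open>A hyperbolic pair \<open>(x, y)\<close> is moved by moving the orthogonal anisotropic vectors \<open>x + y\<close> and
  \<open>x - y\<close> one after the other.\<close>

lemma hframe_transitive:
  assumes "length ps = length qs" "hframe ps" "hframe qs"
  shows "\<exists>g. isometry g \<and> map (map_prod g g) ps = qs"
  using assms
proof (induction ps qs rule: list_induct2)
  case Nil
  then show ?case by (intro exI[of _ "\<lambda>x. x"]) (simp add: isometry_def)
next
  case (Cons xy ps xy' qs)
  obtain x y x' y' where xy: "xy = (x, y)" "xy' = (x', y')" by (cases xy, cases xy')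
  note f = Cons.prems[unfolded xy hframe_Cons]
  obtain g1 where g1: "isometry g1" "map (map_prod g1 g1) ps = qs" using Cons.IH f by blast
  note i1 = isometryD[OF g1(1)]
  define X Y where "X = g1 x" and "Y = g1 y"
  have vq: "vecs qs = g1 ` vecs ps" using vecs_map[of g1 ps] g1(2) by simp
  have XY: "X \<in> V" "Y \<in> V" "b X Y = 1" "b Y X = 1" "q X = 0" "q Y = 0" "perp X (vecs qs)" "perp Y (vecs qs)"
    using f i1 b_sym[of y x] unfolding X_def Y_def vq by auto
  have xy': "x' \<in> V" "y' \<in> V" "b x' y' = 1" "b y' x' = 1" "q x' = 0" "q y' = 0" "perp x' (vecs qs)" "perp y' (vecs qs)"
    using f by (auto simp: b_sym[of y' x'])
  obtain g2 where g2: "isometry g2" "g2 (X + Y) = x' + y'"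
    "\<And>z. b z (X + Y) = 0 \<Longrightarrow> b z (x' + y') = 0 \<Longrightarrow> g2 z = z"
    using witt_vector[of "X + Y" "x' + y'"] XY xy' by (auto simp: q_add V_in)
  note i2 = isometryD[OF g2(1)]
  have q2: "q (g2 (X - Y)) = q (x' - y')" "q (g2 (X - Y)) \<noteq> 0"
    using XY xy' i2(5)[of "X - Y"] by (simp_all add: q_diff)
  obtain g3 where g3: "isometry g3" "g3 (g2 (X - Y)) = x' - y'"
    "\<And>z. b z (g2 (X - Y)) = 0 \<Longrightarrow> b z (x' - y') = 0 \<Longrightarrow> g3 z = z"
    using witt_vector[of "g2 (X - Y)" "x' - y'"] XY(1,2) xy'(1,2) q2 i2(4) by (auto simp: V_in)
  note i3 = isometryD[OF g3(1)]
  \<comment> \<open>\<open>g2\<close> keeps the difference orthogonal to the sum, so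
    \<open>g3\<close>, which moves the difference, leaves the sum where \<open>g2\<close> put
    it.\<close>
  have "b (x' + y') (g2 (X - Y)) = b (X + Y) (X - Y)" using i2(3)[of "X + Y" "X - Y"] g2(2) by simp
  also have "\<dots> = 0" using XY by simp
  finally have fx: "g3 (x' + y') = x' + y'" using xy' by (intro g3(3)) auto
  define g where "g = g3 \<circ> g2"
  have g: "isometry g" unfolding g_def using g2 g3 by (intro isometry_comp)
  have s: "g (X + Y) = x' + y'" "g (X - Y) = x' - y'" using g2(2) g3(2) fx by (simp_all add: g_def)
  have half: "z = sc (1 / 2) (z + w + (z - w))" "w = sc (1 / 2) (z + w - (z - w))" for z w
    by (simp_all add: scale_left_distrib[of 1 1, simplified, symmetric])
  have "g X = x'"
    using half(1)[of X Y] half(1)[of x' y'] s isometryD[OF g] by metis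
  moreover have "g Y = y'"
    using half(2)[where z = X and w = Y] half(2)[where z = x' and w = y'] s isometryD[OF g] by metis
  moreover have "g (g1 v) = g1 v" if v: "v \<in> vecs ps" for v
  proof -
    have vq': "g1 v \<in> vecs qs" using vq v by blast
    have 2: "g2 (g1 v) = g1 v" by (rule g2(3)) (use vq' XY xy' in auto)
    have "b (g1 v) (g2 (X - Y)) = b (g1 v) (X - Y)" using i2(3)[of "g1 v" "X - Y"] 2 by simp
    then have "g3 (g1 v) = g1 v" by (intro g3(3)) (use vq' XY xy' in auto)
    then show ?thesis using 2 by (simp add: g_def)
  qed
  then have "map (map_prod (g \<circ> g1) (g \<circ> g1)) ps = map (map_prod g1 g1) ps"
    by (intro map_cong) (auto simp: vecs_def map_prod_def split: prod.splits, (force simp: image_iff)+)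
  ultimately have "map (map_prod (g \<circ> g1) (g \<circ> g1)) (xy # ps) = xy' # qs"
    using g1(2) by (simp add: xy X_def Y_def)
  then show ?case using isometry_comp[OF g g1(1)] by (intro exI[of _ "g \<circ> g1"] conjI)
qed

section \<open>Isometry of maximal lattices on a space\<close>

lemma not_all_divisible: assumes "x \<noteq> 0" shows "\<exists>j. x / p ^ j \<notin> R"
proof (rule ccontr)
  assume "\<nexists>j. x / p ^ j \<notin> R"
  then have a: "x / p ^ j \<in> R" for j by blast
  then obtain k u where k: "u \<in> R" "inverse u \<in> R" "u \<noteq> 0" "x = p ^ k * u"
    using factor[of x] a[of 0] assms by auto
  then have "u / p \<in> R" using a[of "Suc k"] by simp
  then show False using k not_unit_and_dvd by blast
qed

lemma scaled_into: assumes "submod M" "x \<in> span M" shows "\<exists>k. sc (p ^ k) x \<in> M"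
  using assms(2)
proof (induction rule: span_induct_alt)
  case base then show ?case using submodD[OF assms(1)] by auto
next
  case (step c a y)
  obtain k where k: "sc (p ^ k) y \<in> M" using step by blast
  obtain l where l: "p ^ l * c \<in> R" using fraction by blast
  have "sc (p ^ k) (sc (p ^ l * c) a) + sc (p ^ l) (sc (p ^ k) y) \<in> M"
    by (rule submodD(2)[OF assms(1) submodD(3)[OF assms(1) power_in[OF p_in] submodD(3)[OF assms(1) l step(1)]]
        submodD(3)[OF assms(1) power_in[OF p_in] k]])
  then show ?case by (intro exI[of _ "k + l"]) (simp add: power_add scale_right_distrib ac_simps)
qed

text \<open>A nonzero pairing of \<open>x\<close> with some vector of \<open>M\<close> bounds how
  often a multiple of \<open>x\<close> can be divided by \<open>p\<close> inside
  \<open>M\<close>.\<close>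

lemma primitive_multiple:
  assumes M: "integral M" "span M = V" and x: "x \<in> V" "x \<noteq> 0"
  shows "\<exists>c. c \<noteq> 0 \<and> sc c x \<in> M \<and> sc (inverse p) (sc c x) \<notin> M"
proof -
  note MD = integralD[OF M(1)]
  obtain k where k: "sc (p ^ k) x \<in> M" using scaled_into[OF MD(1)] x(1) M(2) by blast
  obtain y where y: "y \<in> V" "b x y \<noteq> 0" using V_nondeg[OF x(1)] x(2) by blast
  obtain l where l: "sc (p ^ l) y \<in> M" using scaled_into[OF MD(1)] y(1) M(2) by blast
  define d where "d = b (sc (p ^ k) x) (sc (p ^ l) y)"
  have "d \<noteq> 0" using y by (simp add: d_def)
  then obtain j0 where j0: "d / p ^ j0 \<notin> R" using not_all_divisible by blast
  define P where "P j \<longleftrightarrow> sc (inverse (p ^ j)) (sc (p ^ k) x) \<notin> M" for j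
  have "P j0"
  proof (rule ccontr)
    assume "\<not> P j0"
    then have "b (sc (inverse (p ^ j0)) (sc (p ^ k) x)) (sc (p ^ l) y) \<in> R" using MD(4)[OF _ l] unfolding P_def by blast
    then show False using j0 by (simp add: d_def field_simps)
  qed
  then obtain j where j: "P j" "\<And>i. i < j \<Longrightarrow> \<not> P i" using exists_least_iff[of P] by blast
  have "j \<noteq> 0" using j(1) k by (intro notI) (simp add: P_def)
  then obtain i where i: "j = Suc i" by (cases j) auto
  show ?thesis
    using j(1) j(2)[of i] unfolding i P_def
    by (intro exI[of _ "inverse (p ^ i) * p ^ k"]) (simp add: field_simps)
qed

text \<open>For a primitive isotropic \<open>e\<close>, the vector \<open>e\<close> divided by
  \<open>p\<close> has value 0 but is not in \<open>M\<close>, so by maximality \<open>e\<close> has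
  a unit pairing with some \<open>m \<in> M\<close>. Normalizing \<open>m\<close> yields the partner
  in a hyperbolic pair.\<close>

lemma max_lattice_isotropic_extends:
  assumes M: "max_lattice M" and hs: "hframe hs" "vecs hs \<subseteq> M"
    and x: "x \<in> V" "x \<noteq> 0" "q x = 0" "perp x (vecs hs)"
  shows "\<exists>x y. hframe ((x, y) # hs) \<and> x \<in> M \<and> y \<in> M"
proof -
  have iM: "integral M" "span M = V" and mx: "\<And>x. x \<in> V \<Longrightarrow> q x \<in> R \<Longrightarrow> \<forall>m\<in>M. b x m \<in> R \<Longrightarrow> x \<in> M"
    using M by (auto simp: max_lattice_def)
  note MD = integralD[OF iM(1)]
  obtain c where c: "c \<noteq> 0" "sc c x \<in> M" "sc (inverse p) (sc c x) \<notin> M"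
    using primitive_multiple[OF iM x(1,2)] by blast
  define e where "e = sc c x"
  have e: "e \<in> M" "e \<in> V" "q e = 0" "perp e (vecs hs)" using c x by (auto simp: e_def V_in)
  have "\<exists>m\<in>M. b (sc (inverse p) e) m \<notin> R"
    using mx[of "sc (inverse p) e"] c(3) e by (auto simp: e_def[symmetric] V_in)
  then obtain m where m: "m \<in> M" "b e m / p \<notin> R" by (auto simp: divide_inverse mult.commute)
  have u: "b e m \<noteq> 0" "inverse (b e m) \<in> R" using unit_or_dvd[of "b e m"] MD(4)[OF e(1) m(1)] m(2) by auto
  define m1 where "m1 = sc (inverse (b e m)) m"
  have m1: "m1 \<in> M" "b e m1 = 1" using submodD(3)[OF MD(1) u(2) m(1)] u(1) by (auto simp: m1_def)
  obtain k where k: "k \<in> rsp (vecs hs)" "m1 - k \<in> M" "perp (m1 - k) (vecs hs)"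
    using frame_split_in[OF iM(1) _ hs(2) m1(1)] hs(1) by (auto simp: hframe_def)
  have "b k e = 0" using perp_rspan[OF _ k(1), of e] e(4) by blast
  then have be: "b e (m1 - k) = 1" using m1(2) by (simp add: b_sym[of e k])
  \<comment> \<open>As \<open>e\<close> is isotropic and pairs to 1 with \<open>m1 - k\<close>, this
    multiple of \<open>e\<close> cancels the value of \<open>m1 - k\<close>.\<close>
  define y where "y = (m1 - k) - sc (q (m1 - k)) e"
  have y: "y \<in> M" unfolding y_def
    by (rule submodD(4)[OF MD(1) k(2) submodD(3)[OF MD(1) MD(3)[OF k(2)] e(1)]])
  have "b e y = 1" "q y = 0"
    using be e(3) unfolding y_def by (simp_all add: q_diff[of "m1 - k"] b_sym[of "m1 - k" e] del: b_left(5) b_right(5)) (simp add: b_right(5) del: b_left)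
  moreover have "perp y (vecs hs)" using k(3) e(4) unfolding y_def by auto
  ultimately have "hframe ((e, y) # hs)" using e y hs MD(2) by (auto simp: hframe_Cons)
  then show ?thesis using e y by blast
qed

lemma maximal_hframe:
  assumes M: "max_lattice M"
  shows "\<exists>hs. hframe hs \<and> vecs hs \<subseteq> M \<and> (\<forall>x\<in>V. perp x (vecs hs) \<longrightarrow> q x = 0 \<longrightarrow> x = 0)"
proof -
  define P where "P hs \<longleftrightarrow> hframe hs \<and> vecs hs \<subseteq> M" for hs
  have "P []" by (simp add: P_def hframe_def)
  moreover have "length hs < Suc (dim V)" if "P hs" for hs
    using frame_length[of hs] that by (auto simp: P_def hframe_def)
  ultimately obtain hs where hs: "P hs" "\<And>ks. P ks \<Longrightarrow> length ks \<le> length hs"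
    using ex_has_greatest_nat[of P "[]" length "Suc (dim V)"] by blast
  have "x = 0" if x: "x \<in> V" "perp x (vecs hs)" "q x = 0" for x
  proof (rule ccontr)
    assume "x \<noteq> 0"
    then obtain e f where "hframe ((e, f) # hs)" "e \<in> M" "f \<in> M"
      using max_lattice_isotropic_extends[OF M _ _ x(1) _ x(3,2)] hs(1) by (auto simp: P_def)
    then have "P ((e, f) # hs)" using hs(1) by (auto simp: P_def)
    then show False using hs(2)[of "(e, f) # hs"] by simp
  qed
  then show ?thesis using hs(1) by (auto simp: P_def)
qed

text \<open>If \<open>d = b x y\<close> is not integral, dividing \<open>q (x + sc s y)\<close> by
  \<open>d\<close> gives a polynomial in \<open>s\<close> of the shape in \<open>hensel\<close>,
  since \<open>q x / d\<close> is divisible by \<open>p\<close>. A root forces \<open>x\<close> and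
  \<open>y\<close> to be proportional, and then \<open>d * d = 4 * q x * q y\<close> is
  integral.\<close>

lemma anisotropic_integral:
  assumes "q x \<in> R" "q y \<in> R" and an: "\<And>c. q (x + sc c y) = 0 \<Longrightarrow> x + sc c y = 0"
  shows "b x y \<in> R"
proof (rule ccontr)
  assume n: "b x y \<notin> R"
  define d where "d = b x y"
  have d: "inverse d / p \<in> R" "d \<noteq> 0" using in_or_inverse_dvd[of d] n by (auto simp: d_def)
  have "q y * inverse d \<in> R" "q x * (inverse d / p) \<in> R"
    by (rule mult_in[OF assms(2) dvd_imp_in[OF d(1)]], rule mult_in[OF assms(1) d(1)])
  then obtain s where s: "q y * inverse d * s\<^sup>2 + s + p * (q x * (inverse d / p)) = 0" using hensel by blast
  have "q (x + sc s y) = d * (q y * inverse d * s\<^sup>2 + s + p * (q x * (inverse d / p)))"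
    using d(2) by (simp add: q_add d_def[symmetric] field_simps)
  then have "x + sc s y = 0" using an s by simp
  then have x: "x = sc (- s) y" by (simp add: add_eq_0_iff2)
  have "d\<^sup>2 = 4 * q x * q y" unfolding d_def x by (simp add: power2_eq_square)
  then have "d\<^sup>2 \<in> R" using assms by (simp add: ring_in)
  then have "p * d\<^sup>2 \<in> R" by (simp add: ring_in)
  then show False using square_in_imp n by (auto simp: d_def)
qed

text \<open>Maximality requires integral pairings with all of \<open>M\<close>; removing the
  hyperbolic component of each vector of \<open>M\<close> reduces this to
  \<open>anisotropic_integral\<close>.\<close>

lemma max_lattice_contains_anisotropic_part:
  assumes M: "max_lattice M" and hs: "hframe hs" "vecs hs \<subseteq> M"
    and an: "\<And>x. x \<in> V \<Longrightarrow> perp x (vecs hs) \<Longrightarrow> q x = 0 \<Longrightarrow> x = 0"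
    and x: "x \<in> V" "perp x (vecs hs)" "q x \<in> R"
  shows "x \<in> M"
proof -
  have iM: "integral M" and mx: "\<And>x. x \<in> V \<Longrightarrow> q x \<in> R \<Longrightarrow> \<forall>m\<in>M. b x m \<in> R \<Longrightarrow> x \<in> M"
    using M by (auto simp: max_lattice_def)
  note MD = integralD[OF iM]
  have "b x m \<in> R" if m: "m \<in> M" for m
  proof -
    obtain k where k: "k \<in> rsp (vecs hs)" "m - k \<in> M" "perp (m - k) (vecs hs)"
      using frame_split_in[OF iM _ hs(2) m] hs(1) by (auto simp: hframe_def)
    have "b x k = 0" using perp_rspan[OF _ k(1), of x] x(2) by (auto simp: b_sym)
    moreover have "b x (m - k) \<in> R"
    proof (rule anisotropic_integral)
      have "m - k \<in> V" using k(2) MD(2) by blast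
      fix c assume "q (x + sc c (m - k)) = 0"
      then show "x + sc c (m - k) = 0"
        using \<open>m - k \<in> V\<close> k(3) x(1,2) by (intro an V_in(1)) (simp_all only: V_in b_right, simp)
    qed (use x MD(3)[OF k(2)] in auto)
    ultimately show ?thesis by simp
  qed
  then show ?thesis using mx x by blast
qed

text \<open>Invariance of the Witt index: an isometry that carries all but one pair of a longer
  frame onto \<open>hs\<close> would produce a nonzero isotropic vector orthogonal to
  \<open>hs\<close>.\<close>

lemma hframe_length_le:
  assumes hl: "hframe hl" and hs: "hframe hs"
    and an: "\<And>x. x \<in> V \<Longrightarrow> perp x (vecs hs) \<Longrightarrow> q x = 0 \<Longrightarrow> x = 0"
  shows "length hl \<le> length hs"
proof (rule ccontr)
  assume n: "\<not> length hl \<le> length hs"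
  \<comment> \<open>Exactly one pair more than \<open>hs\<close> is kept.\<close>
  define ks where "ks = drop (length hl - length hs - 1) hl"
  have ks: "hframe ks" "length ks = Suc (length hs)" using hframe_drop[OF hl] n by (auto simp: ks_def)
  then obtain x y ts where xy: "ks = (x, y) # ts" by (metis length_Suc_conv surj_pair)
  have f: "x \<in> V" "b x y = 1" "q x = 0" "perp x (vecs ts)" "hframe ts" "length ts = length hs"
    using ks unfolding xy hframe_Cons by auto
  obtain g where g: "isometry g" "map (map_prod g g) ts = hs" using hframe_transitive[OF f(6,5) hs] by blast
  note i = isometryD[OF g(1)]
  have "perp (g x) (vecs hs)" using f(4) i(3) vecs_map[of g ts] g(2) by auto
  then have "g x = 0" using f i by (intro an) auto
  then show False using i(3)[of x y] f(2) by simp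
qed

theorem maximal_lattices_isometric:
  assumes L: "max_lattice L" and M: "max_lattice M"
  shows "\<exists>g. isometry g \<and> g ` L \<subseteq> M"
proof -
  obtain hl where hl: "hframe hl" "vecs hl \<subseteq> L" "\<And>x. x \<in> V \<Longrightarrow> perp x (vecs hl) \<Longrightarrow> q x = 0 \<Longrightarrow> x = 0"
    using maximal_hframe[OF L] by blast
  obtain hs where hs: "hframe hs" "vecs hs \<subseteq> M" "\<And>x. x \<in> V \<Longrightarrow> perp x (vecs hs) \<Longrightarrow> q x = 0 \<Longrightarrow> x = 0"
    using maximal_hframe[OF M] by blast
  have "length hl = length hs"
    using hframe_length_le[OF hl(1) hs(1) hs(3)] hframe_length_le[OF hs(1) hl(1) hl(3)] by linarith
  then obtain g where g: "isometry g" "map (map_prod g g) hl = hs" using hframe_transitive hl hs by blast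
  note i = isometryD[OF g(1)]
  have iL: "integral L" and iM: "integral M" using L M by (auto simp: max_lattice_def)
  note LD = integralD[OF iL] and MD = integralD[OF iM]
  have vs: "vecs hs = g ` vecs hl" using vecs_map[of g hl] g(2) by simp
  have "g z \<in> M" if z: "z \<in> L" for z
  proof -
    obtain k where k: "k \<in> rsp (vecs hl)" "z - k \<in> L" "perp (z - k) (vecs hl)"
      using frame_split_in[OF iL _ hl(2) z] hl(1) by (auto simp: hframe_def)
    have "submod {k. g k \<in> M}"
      using submodD[OF MD(1)] by (auto simp: submod_def i)
    then have "g k \<in> M" using rspan_minimal[of "{k. g k \<in> M}" "vecs hl"] k(1) hs(2) vs by blast
    moreover have "g (z - k) \<in> M"
    proof (rule max_lattice_contains_anisotropic_part[OF M hs])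
      show "g (z - k) \<in> V" "q (g (z - k)) \<in> R"
        using i(4)[of "z - k"] i(5)[of "z - k"] k(2) LD(2) LD(3)[OF k(2)] by auto
      show "perp (g (z - k)) (vecs hs)" unfolding vs using k(3) i(3) by (auto simp del: b_left b_right)
    qed
    ultimately show ?thesis using submodD(2)[OF MD(1), of "g k" "g (z - k)"] i(1)[of k "z - k"] by simp
  qed
  then show ?thesis using g by blast
qed

end

section \<open>The structure of maximal lattices and ADC lattices\<close>

context dyadic_dvr
begin

definition valuation_one :: "'a \<Rightarrow> bool" where "valuation_one x \<longleftrightarrow> x / p \<in> R \<and> x / p / p \<notin> R"

lemma valuation_one_nonzero: "valuation_one x \<Longrightarrow> x \<noteq> 0"
  by (auto simp: valuation_one_def)

lemma unit_nonzero: "x / p \<notin> R \<Longrightarrow> x \<noteq> 0"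
  by auto

lemma dvd_mult: "x / p \<in> R \<Longrightarrow> y \<in> R \<Longrightarrow> x * y / p \<in> R" "x / p \<in> R \<Longrightarrow> y \<in> R \<Longrightarrow> y * x / p \<in> R"
  using mult_in[of "x / p" y] by (simp_all add: mult.commute)

lemma dvd_add: "x / p \<in> R \<Longrightarrow> y / p \<in> R \<Longrightarrow> (x + y) / p \<in> R"
  using add_in[of "x / p" "y / p"] by (simp add: add_divide_distrib)

lemma dvd_diff: "x / p \<in> R \<Longrightarrow> y / p \<in> R \<Longrightarrow> (x - y) / p \<in> R"
  using diff_in[of "x / p" "y / p"] by (simp add: diff_divide_distrib)

section \<open>Quadratic forms modulo the uniformizer\<close>

lemma unit_square_root:
  assumes "u \<in> R" "u / p \<notin> R" "a \<in> R"
  shows "\<exists>t\<in>R. (a + t\<^sup>2 * u) / p \<in> R"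
proof -
  have u: "u \<noteq> 0" "inverse u \<in> R" using unit_or_dvd assms by blast+
  have "- a * inverse u \<in> R" using assms u by (intro ring_in)
  then obtain t where t: "t \<in> R" "(- a * inverse u - t\<^sup>2) / p \<in> R" using residue_square by blast
  have "(- u) * ((- a * inverse u - t\<^sup>2) / p) \<in> R" using t assms by (intro ring_in)
  moreover have "(- u) * ((- a * inverse u - t\<^sup>2) / p) = (a + t\<^sup>2 * u) / p" using u by (simp add: field_simps)
  ultimately show ?thesis using t by auto
qed

text \<open>Without the mixed term the form is diagonal modulo \<open>p\<close>, hence isotropic
  over a perfect residue field of characteristic 2.\<close>

lemma binary_zero_mod:
  assumes "\<alpha> \<in> R" "\<alpha>' \<in> R" "\<beta> / p \<in> R"
  shows "\<exists>x\<in>R. \<exists>y\<in>R. (x / p \<notin> R \<or> y / p \<notin> R) \<and> (\<alpha> * x\<^sup>2 + \<alpha>' * y\<^sup>2 + \<beta> * x * y) / p \<in> R"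
proof (cases "\<alpha> / p \<in> R")
  case True
  then show ?thesis using one_not_dvd by (intro bexI[of _ 1] bexI[of _ 0]) auto
next
  case False
  then obtain t where t: "t \<in> R" "(\<alpha>' + t\<^sup>2 * \<alpha>) / p \<in> R" using unit_square_root assms by blast
  have "((\<alpha>' + t\<^sup>2 * \<alpha>) + \<beta> * t) / p \<in> R" by (rule dvd_add[OF t(2) dvd_mult(1)[OF assms(3) t(1)]])
  then show ?thesis using t one_not_dvd by (intro bexI[of _ t] bexI[of _ 1]) (auto simp: algebra_simps)
qed

text \<open>Modulo the uniformizer the vector \<open>(\<beta>23, \<beta>13, \<beta>12)\<close> spans the radical of the alternating
  polar form; adding a multiple of it to a basis vector makes the value zero.\<close>

lemma ternary_zero_mod:
  assumes \<alpha>: "\<alpha>1 \<in> R" "\<alpha>2 \<in> R" "\<alpha>3 \<in> R" and \<beta>: "\<beta>12 \<in> R" "\<beta>13 \<in> R" "\<beta>23 \<in> R"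
  shows "\<exists>x\<in>R. \<exists>y\<in>R. \<exists>z\<in>R. (x / p \<notin> R \<or> y / p \<notin> R \<or> z / p \<notin> R) \<and>
    (\<alpha>1 * x\<^sup>2 + \<alpha>2 * y\<^sup>2 + \<alpha>3 * z\<^sup>2 + \<beta>12 * x * y + \<beta>13 * x * z + \<beta>23 * y * z) / p \<in> R"
proof (cases "\<beta>12 / p \<in> R")
  case True
  obtain x y where "x \<in> R" "y \<in> R" "x / p \<notin> R \<or> y / p \<notin> R" "(\<alpha>1 * x\<^sup>2 + \<alpha>2 * y\<^sup>2 + \<beta>12 * x * y) / p \<in> R"
    using binary_zero_mod[OF \<alpha>(1,2) True] by blast
  then show ?thesis by (intro bexI[of _ x] bexI[of _ y] bexI[of _ 0]) auto
next
  case b12: False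
  show ?thesis
  proof (cases "\<beta>13 / p \<in> R")
    case True
    obtain x y where "x \<in> R" "y \<in> R" "x / p \<notin> R \<or> y / p \<notin> R" "(\<alpha>1 * x\<^sup>2 + \<alpha>3 * y\<^sup>2 + \<beta>13 * x * y) / p \<in> R"
      using binary_zero_mod[OF \<alpha>(1,3) True] by blast
    then show ?thesis by (intro bexI[of _ x] bexI[of _ 0] bexI[of _ y]) auto
  next
    case b13: False
    \<comment> \<open>The value at the radical vector; the three mixed terms there coincide, hence
      the factor 3.\<close>
    define c where "c = \<alpha>1 * \<beta>23\<^sup>2 + \<alpha>2 * \<beta>13\<^sup>2 + \<alpha>3 * \<beta>12\<^sup>2 + 3 * (\<beta>12 * \<beta>13 * \<beta>23)"
    have cR: "c \<in> R" unfolding c_def using \<alpha> \<beta> by (intro ring_in)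
    show ?thesis
    proof (cases "c / p \<in> R")
      case True
      then show ?thesis using \<beta> b12
        by (intro bexI[of _ \<beta>23] bexI[of _ \<beta>13] bexI[of _ \<beta>12]) (auto simp: c_def algebra_simps)
    next
      case False
      then obtain t where t: "t \<in> R" "(\<alpha>1 + t\<^sup>2 * c) / p \<in> R" using unit_square_root[OF cR] \<alpha> by blast
      \<comment> \<open>This is the linear term in \<open>t\<close>, namely \<open>t\<close> times
        the polar form of the first basis vector and the radical vector.\<close>
      have "(2 * (t * (\<alpha>1 * \<beta>23 + \<beta>12 * \<beta>13))) / p \<in> R" using t \<alpha> \<beta> by (intro two_dvd ring_in)
      from dvd_add[OF t(2) this]
      have "(\<alpha>1 * (1 + t * \<beta>23)\<^sup>2 + \<alpha>2 * (t * \<beta>13)\<^sup>2 + \<alpha>3 * (t * \<beta>12)\<^sup>2 + \<beta>12 * (1 + t * \<beta>23) * (t * \<beta>13)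
        + \<beta>13 * (1 + t * \<beta>23) * (t * \<beta>12) + \<beta>23 * (t * \<beta>13) * (t * \<beta>12)) / p \<in> R"
        by (simp add: c_def power2_eq_square algebra_simps)
      moreover have "(1 + t * \<beta>23) / p \<notin> R \<or> (t * \<beta>13) / p \<notin> R"
      proof (rule ccontr)
        assume "\<not> ((1 + t * \<beta>23) / p \<notin> R \<or> (t * \<beta>13) / p \<notin> R)"
        then have "t / p \<in> R" "(1 + t * \<beta>23) / p \<in> R" using unit_mult_dvd[OF \<beta>(2) b13] by auto
        then show False using add_not_dvd[OF one_not_dvd dvd_mult(1)[of t \<beta>23]] \<beta> by blast
      qed
      ultimately show ?thesis using t \<beta>
        by (intro bexI[of _ "1 + t * \<beta>23"] bexI[of _ "t * \<beta>13"] bexI[of _ "t * \<beta>12"]) (auto intro!: ring_in)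
    qed
  qed
qed

text \<open>The two diagonal terms have valuations of different parity and cannot cancel, and the
  mixed term has larger valuation than one of them. The proof compares them through the ratio
  \<open>r = y / x\<close>.\<close>

lemma eisenstein_integral:
  assumes u: "u \<in> R" "u / p \<notin> R" and c: "c / p \<in> R" and w: "valuation_one w"
    and v: "u * x\<^sup>2 + c * x * y + w * y\<^sup>2 \<in> R"
  shows "x \<in> R" "y \<in> R"
proof -
  define w' where "w' = w / p"
  have w': "w' \<in> R" "w' / p \<notin> R" "w = p * w'" using w by (auto simp: valuation_one_def w'_def)
  have cR: "c \<in> R" using dvd_imp_in c .
  have fin: "z \<in> R" if "p * z\<^sup>2 * d \<in> R" "d \<in> R" "d / p \<notin> R" for z d
  proof -
    have "d \<noteq> 0" "inverse d \<in> R" using unit_or_dvd that by blast+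
    then have "p * z\<^sup>2 * d * inverse d \<in> R" using that by (intro mult_in[OF that(1)])
    then show ?thesis using square_in_imp[of z] \<open>d \<noteq> 0\<close> by (simp add: mult.assoc)
  qed
  have "x \<in> R \<and> y \<in> R"
  proof (cases "x = 0")
    case True
    then have "p * y\<^sup>2 * w' \<in> R" using v w' by (simp add: mult_ac)
    then show ?thesis using fin[of y w'] w' True by auto
  next
    case False
    define r where "r = y / x"
    have y: "y = r * x" using False by (simp add: r_def)
    show ?thesis
    proof (cases "r \<in> R")
      case True
      define d where "d = u + (c * r + w * r\<^sup>2)"
      have "(c * r + w * r\<^sup>2) / p \<in> R"
        using c w True by (intro dvd_add dvd_mult ring_in) (auto simp: valuation_one_def)
      then have d: "d / p \<notin> R" "d \<in> R"
        unfolding d_def using add_not_dvd[OF u(2)] add_in[OF u(1)] dvd_imp_in by blast+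
      have "p * x\<^sup>2 * d = p * (u * x\<^sup>2 + c * x * y + w * y\<^sup>2)"
        unfolding y d_def by (simp add: power2_eq_square algebra_simps)
      then have "p * x\<^sup>2 * d \<in> R" using mult_in[OF p_in v] by (simp only:)
      then have "x \<in> R" using fin d by blast
      then show ?thesis using True y by (simp add: ring_in)
    next
      case n: False
      define s where "s = inverse r / p"
      have s: "s \<in> R" "r \<noteq> 0" using in_or_inverse_dvd[of r] n by (auto simp: s_def)
      have x: "x = p * s * y" using s y by (simp add: s_def)
      define d where "d = w' + (p * (s\<^sup>2 * u) + s * c)"
      have "(p * (s\<^sup>2 * u) + s * c) / p \<in> R"
        using s u by (intro dvd_add dvd_mult(2)[OF c s(1)]) (simp add: ring_in)
      then have d: "d / p \<notin> R" "d \<in> R"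
        unfolding d_def using add_not_dvd[OF w'(2)] add_in[OF w'(1)] dvd_imp_in by blast+
      have "p * y\<^sup>2 * d = u * x\<^sup>2 + c * x * y + w * y\<^sup>2"
        unfolding x d_def w'(3) by (simp add: power2_eq_square algebra_simps)
      then have "y \<in> R" using fin[of y d] d v by simp
      then show ?thesis using x s by (simp add: ring_in)
    qed
  qed
  then show "x \<in> R" "y \<in> R" by blast+
qed

end

context quadratic_lattices
begin

section \<open>The complement of a frame in a maximal lattice\<close>

lemma vecs_append [simp]: "vecs (ps @ qs) = vecs ps \<union> vecs qs"
  by (auto simp: vecs_def)

lemma frame_append: "frame (ps @ qs) \<longleftrightarrow>
  frame ps \<and> frame qs \<and> (\<forall>v\<in>vecs ps. \<forall>w\<in>vecs qs. b w v = 0)"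
  by (induction ps rule: frame.induct) auto

lemma frame_extend:
  assumes L: "integral L" and ps: "frame ps" "vecs ps \<subseteq> L"
    and xy: "x \<in> L" "y \<in> L" "perp x (vecs ps)" "perp y (vecs ps)" "b x y / p \<notin> R"
  shows "\<exists>z\<in>L. frame ((x, z) # ps)"
proof -
  note LD = integralD[OF L]
  have u: "b x y \<noteq> 0" "inverse (b x y) \<in> R" using unit_or_dvd[OF LD(4)[OF xy(1,2)]] xy(5) by auto
  define z where "z = sc (inverse (b x y)) y"
  have z: "z \<in> L" "b x z = 1" "perp z (vecs ps)"
    using submodD(3)[OF LD(1) u(2) xy(2)] u(1) xy(4) by (auto simp: z_def)
  then have "frame ((x, z) # ps)" using xy ps LD by auto
  then show ?thesis using z by blast
qed

lemma maximal_frame: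
  assumes L: "integral L" and ps0: "frame ps0" "vecs ps0 \<subseteq> L"
  shows "\<exists>ps. frame (ps @ ps0) \<and> vecs (ps @ ps0) \<subseteq> L \<and>
    (\<forall>x\<in>L. \<forall>y\<in>L. perp x (vecs (ps @ ps0)) \<longrightarrow> perp y (vecs (ps @ ps0)) \<longrightarrow> b x y / p \<in> R)"
proof -
  define P where "P ps \<longleftrightarrow> frame (ps @ ps0) \<and> vecs (ps @ ps0) \<subseteq> L" for ps
  have "P []" using ps0 by (simp add: P_def)
  moreover have "length ps < Suc (dim V)" if "P ps" for ps
    using frame_length[of "ps @ ps0"] that by (auto simp: P_def)
  ultimately obtain ps where ps: "P ps" "\<And>ks. P ks \<Longrightarrow> length ks \<le> length ps"
    using ex_has_greatest_nat[of P "[]" length "Suc (dim V)"] by blast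
  have "b x y / p \<in> R"
    if xy: "x \<in> L" "y \<in> L" "perp x (vecs (ps @ ps0))" "perp y (vecs (ps @ ps0))" for x y
  proof (rule ccontr)
    assume "b x y / p \<notin> R"
    then obtain z where "z \<in> L" "frame ((x, z) # (ps @ ps0))"
      using frame_extend[OF L _ _ xy] ps(1) unfolding P_def by blast
    then have "P ((x, z) # ps)" using ps(1) xy(1) by (auto simp: P_def)
    then show False using ps(2)[of "(x, z) # ps"] by simp
  qed
  then show ?thesis using ps(1) unfolding P_def by blast
qed

text \<open>The frame splits off, so pairings with \<open>L\<close> reduce to pairings inside the
  complement.\<close>

lemma complement_radical:
  assumes L: "integral L" and ps: "frame ps" "vecs ps \<subseteq> L"
    and cd: "\<And>x y. x \<in> L \<Longrightarrow> y \<in> L \<Longrightarrow> perp x (vecs ps) \<Longrightarrow> perp y (vecs ps) \<Longrightarrow> b x y / p \<in> R"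
    and x: "x \<in> L" "perp x (vecs ps)" and m: "m \<in> L"
  shows "b x m / p \<in> R"
proof -
  obtain k where k: "k \<in> rsp (vecs ps)" "m - k \<in> L" "perp (m - k) (vecs ps)"
    using frame_split_in[OF L ps m] by blast
  have "b x k = 0" using perp_rspan[OF _ k(1), of x] x(2) by (auto simp: b_sym)
  then show ?thesis using cd[OF x(1) k(2) x(2) k(3)] by simp
qed

lemma adjust_value:
  assumes "q x \<in> R" "q x / p \<notin> R" "q y \<in> R" "b y x / p \<in> R"
  shows "\<exists>r\<in>R. q (y + sc r x) / p \<in> R"
proof -
  obtain r where r: "r \<in> R" "(q y + r\<^sup>2 * q x) / p \<in> R" using unit_square_root assms by blast
  have "((q y + r\<^sup>2 * q x) + r * b y x) / p \<in> R" by (rule dvd_add[OF r(2) dvd_mult(2)[OF assms(4) r(1)]])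
  then have "q (y + sc r x) / p \<in> R" by (simp add: q_add algebra_simps)
  then show ?thesis using r by blast
qed

lemma full_zero:
  assumes "nondeg_on A" "independent A" "A \<subseteq> V" "dim V \<le> card A" "z \<in> V" "perp z A"
  shows "z = 0"
  using assms V_spanned[of A] by (auto simp: nondeg_on_def)

text \<open>By Nakayama's principle a generating set of least size is a basis modulo
  \<open>p\<close>: a combination in \<open>p P\<close> with a unit coefficient would make a
  generator redundant. A linear dependence, scaled to coefficients in \<open>R\<close> not all
  divisible by \<open>p\<close>, would be such a combination.\<close>

lemma minimal_generators:
  assumes "finite S" "P = rsp S"
  shows "\<exists>T. finite T \<and> P = rsp T \<and> independent T \<and>
    (\<forall>c. (\<forall>t\<in>T. c t \<in> R) \<longrightarrow> sc (inverse p) (\<Sum>t\<in>T. sc (c t) t) \<in> P \<longrightarrow> (\<forall>t\<in>T. c t / p \<in> R))"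
proof -
  obtain T where T: "finite T" "P = rsp T" "\<And>T'. finite T' \<Longrightarrow> P = rsp T' \<Longrightarrow> card T \<le> card T'"
    using ex_has_least_nat[of "\<lambda>T. finite T \<and> P = rsp T" S card] assms by blast
  have indp: "\<forall>t\<in>T. c t / p \<in> R"
    if c: "\<And>t. t \<in> T \<Longrightarrow> c t \<in> R" "sc (inverse p) (\<Sum>t\<in>T. sc (c t) t) \<in> P" for c
  proof (rule ccontr)
    assume "\<not> (\<forall>t\<in>T. c t / p \<in> R)"
    then obtain t0 where t0: "t0 \<in> T" "c t0 / p \<notin> R" by blast
    obtain d where d: "\<And>t. t \<in> T \<Longrightarrow> d t \<in> R" "sc (inverse p) (\<Sum>t\<in>T. sc (c t) t) = (\<Sum>t\<in>T. sc (d t) t)"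
      using c(2) unfolding T(2) rspan_finite[OF T(1)] by auto
    have "(\<Sum>t\<in>T. sc (c t) t) = sc p (sc (inverse p) (\<Sum>t\<in>T. sc (c t) t))" by simp
    also have "\<dots> = (\<Sum>t\<in>T. sc (p * d t) t)" unfolding d(2) by (simp add: scale_sum_right)
    finally have "(\<Sum>t\<in>T. sc (c t - p * d t) t) = 0"
      by (simp add: scale_left_diff_distrib sum_subtractf)
    moreover define a where "a t = c t - p * d t" for t
    ultimately have z: "sc (a t0) t0 + (\<Sum>t\<in>T - {t0}. sc (a t) t) = 0"
      using sum.remove[OF T(1) t0(1), of "\<lambda>t. sc (a t) t"] by simp
    have aR: "a t \<in> R" if "t \<in> T" for t using c(1) d(1) that by (simp add: a_def ring_in)
    have "(- (p * d t0)) / p \<in> R" using d(1)[OF t0(1)] by (simp add: uminus_in)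
    from add_not_dvd[OF t0(2) this] have "a t0 / p \<notin> R" by (simp add: a_def)
    then have u: "a t0 \<noteq> 0" "inverse (a t0) \<in> R" using unit_or_dvd[OF aR[OF t0(1)]] by auto
    have "t0 = sc (inverse (a t0)) (sc (a t0) t0)" using u by simp
    also have "sc (a t0) t0 = - (\<Sum>t\<in>T - {t0}. sc (a t) t)" using z by (simp add: add_eq_0_iff2)
    finally have t0e: "t0 = (\<Sum>t\<in>T - {t0}. sc (- inverse (a t0) * a t) t)"
      by (simp add: scale_sum_right sum_negf)
    have "(\<Sum>t\<in>T - {t0}. sc (- inverse (a t0) * a t) t) \<in> rsp (T - {t0})"
      using aR u by (intro rspan_sum rspan_scale rspan_base ring_in) auto
    then have "t0 \<in> rsp (T - {t0})" using t0e by (simp only:)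
    then have "T \<subseteq> rsp (T - {t0})" using rspan_base[of _ "T - {t0}"] by auto
    then have "rsp T \<subseteq> rsp (T - {t0})" by (rule rspan_minimal[OF submod_rspan])
    then have "P = rsp (T - {t0})" using T(2) rspan_mono[of "T - {t0}" T] by auto
    then have "card T \<le> card (T - {t0})" using T(1) by (intro T(3)) auto
    then show False using card_Diff1_less[OF T(1) t0(1)] by simp
  qed
  have "independent T"
  proof (rule ccontr)
    assume "\<not> independent T"
    then obtain c t1 where c: "(\<Sum>t\<in>T. sc (c t) t) = 0" "t1 \<in> T" "c t1 \<noteq> 0"
      using dependent_finite[OF T(1)] by auto
    obtain K where K: "\<forall>t\<in>T. p ^ K * c t \<in> R" using common_denominator[OF T(1)] by blast
    \<comment> \<open>The least \<open>j\<close> with \<open>Q j\<close> is one more than the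
      largest power of \<open>p\<close> dividing all coefficients; dividing by that power makes the
      relation primitive.\<close>
    define Q where "Q j \<longleftrightarrow> (\<exists>t\<in>T. p ^ K * c t / p ^ j \<notin> R)" for j
    have "\<exists>j. Q j" using not_all_divisible[of "p ^ K * c t1"] c by (auto simp: Q_def)
    then obtain j where j: "Q j" "\<And>i. i < j \<Longrightarrow> \<not> Q i" using exists_least_iff[of Q] by blast
    have "j \<noteq> 0" using j(1) K by (intro notI) (simp add: Q_def)
    then obtain i where i: "j = Suc i" by (cases j) auto
    define a where "a t = p ^ K * c t / p ^ i" for t
    have "(\<Sum>t\<in>T. sc (a t) t) = sc (p ^ K / p ^ i) (\<Sum>t\<in>T. sc (c t) t)"
      by (simp add: scale_sum_right a_def)
    then have "sc (inverse p) (\<Sum>t\<in>T. sc (a t) t) \<in> P" using c(1) T(2) by (simp add: rspan.zero)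
    moreover have "a t \<in> R" if "t \<in> T" for t using j(2)[of i] i that by (auto simp: Q_def a_def)
    ultimately have "\<forall>t\<in>T. a t / p \<in> R" by (intro indp)
    then show False using j(1) i by (auto simp: Q_def a_def mult.commute)
  qed
  then show ?thesis using T(1,2) indp by blast
qed

text \<open>The pairing \<open>b u e\<close> is left free, so that the plane may be unimodular; this
  covers unimodular maximal lattices as well.\<close>

definition unit_prime_complement :: "'v set \<Rightarrow> ('v \<times> 'v) list \<Rightarrow> bool" where
  "unit_prime_complement M ps \<longleftrightarrow>
     (\<exists>u\<in>M. \<exists>e\<in>M. perp u (vecs ps) \<and> perp e (vecs ps) \<and> q u / p \<notin> R \<and> valuation_one (q e))"

text \<open>The last clause puts \<open>e\<close> into the radical modulo \<open>p\<close> of all of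
  \<open>M\<close>. The exact valuation of \<open>q e\<close> shows that \<open>e\<close> is not
  \<open>p\<close> times a vector of \<open>M\<close>, and lets \<open>e\<close> serve as a vector
  of an Eisenstein form.\<close>

definition modular_complement :: "'v set \<Rightarrow> ('v \<times> 'v) list \<Rightarrow> bool" where
  "modular_complement M ps \<longleftrightarrow>
     (\<exists>e\<in>M. \<exists>f\<in>M. perp e (vecs ps) \<and> perp f (vecs ps) \<and> valuation_one (q e) \<and> q f / p \<in> R \<and> valuation_one (b e f) \<and>
       (\<forall>m\<in>M. b e m / p \<in> R))"

text \<open>On the complement \<open>P\<close> the form \<open>b\<close> vanishes modulo
  \<open>p\<close>, so \<open>q\<close> modulo \<open>p\<close> is diagonal and all generators but
  one can be given values divisible by \<open>p\<close>. On those, \<open>q\<close> divided by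
  \<open>p\<close> is anisotropic modulo \<open>p\<close> by maximality, so
  \<open>ternary_zero_mod\<close> allows at most two of them. Hence \<open>P\<close> has at most
  three generators, and two by parity.\<close>

lemma frame_complement_structure:
  assumes M: "max_lattice M" and ps: "frame ps" "vecs ps \<subseteq> M"
    and cd: "\<And>x y. x \<in> M \<Longrightarrow> y \<in> M \<Longrightarrow> perp x (vecs ps) \<Longrightarrow> perp y (vecs ps) \<Longrightarrow> b x y / p \<in> R"
    and dim: "dim V = 2 * l + 2"
    and nz: "x0 \<in> M" "perp x0 (vecs ps)" "x0 \<noteq> 0"
  shows "length ps = l \<and> (unit_prime_complement M ps \<or> modular_complement M ps)"
proof -
  have iM: "integral M" "span M = V" and mx: "\<And>x. x \<in> V \<Longrightarrow> q x \<in> R \<Longrightarrow> \<forall>m\<in>M. b x m \<in> R \<Longrightarrow> x \<in> M"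
    using M by (auto simp: max_lattice_def)
  note MD = integralD[OF iM(1)] and sub = submodD[OF MD(1)]
  define P where "P = {x \<in> M. perp x (vecs ps)}"
  have P: "submod P" "P \<subseteq> M" "P \<subseteq> V" using sub MD(2) by (auto simp: P_def submod_def)
  note subP = submodD[OF P(1)]
  have bP: "b x y / p \<in> R" if "x \<in> P" "y \<in> P" for x y using cd that by (auto simp: P_def)
  have qP: "q x \<in> R" if "x \<in> P" for x using MD(3) P(2) that by blast
  have rad: "b x m / p \<in> R" if xm: "x \<in> P" "m \<in> M" for x m
  proof (rule complement_radical[OF iM(1) ps])
    show "b x y / p \<in> R" if "x \<in> M" "y \<in> M" "perp x (vecs ps)" "perp y (vecs ps)" for x y
      by (rule cd[OF that])
  qed (use xm in \<open>simp_all add: P_def\<close>)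
  \<comment> \<open>This is where maximality enters: a vector of \<open>P\<close> whose value is
    divisible by the square of \<open>p\<close> is itself divisible by \<open>p\<close>.\<close>
  have div: "sc (inverse p) y \<in> P" if y: "y \<in> P" "q y / p / p \<in> R" for y
  proof -
    have yV: "y \<in> V" using y P by blast
    have "sc (inverse p) y \<in> M"
    proof (rule mx)
      show "sc (inverse p) y \<in> V" using yV V_in by blast
      show "q (sc (inverse p) y) \<in> R" using y(2) by (simp add: power2_eq_square field_simps)
      show "\<forall>m\<in>M. b (sc (inverse p) y) m \<in> R" using rad[OF y(1)] by (simp add: field_simps)
    qed
    then show ?thesis using y(1) by (simp add: P_def)
  qed
  obtain S where S: "finite S" "P = rsp S"
    using integral_spanning_fg[OF iM] submod_of_finitely_generated[OF _ P(1)] P(2) by metis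
  obtain T where T: "finite T" "P = rsp T" "independent T"
    and Tp: "\<And>c. \<forall>t\<in>T. c t \<in> R \<Longrightarrow> sc (inverse p) (\<Sum>t\<in>T. sc (c t) t) \<in> P \<Longrightarrow> \<forall>t\<in>T. c t / p \<in> R"
    using minimal_generators[OF S] by metis
  have TP: "T \<subseteq> P" using rspan_superset[of T] T(2) by simp
  have prim: "q (\<Sum>t\<in>A. sc (c t) t) / p / p \<notin> R"
    if A: "A \<subseteq> T" "\<And>t. t \<in> A \<Longrightarrow> c t \<in> R" "t0 \<in> A" "c t0 / p \<notin> R" for A c t0
  proof
    define c' where "c' t = (if t \<in> A then c t else 0)" for t
    have eq: "(\<Sum>t\<in>A. sc (c t) t) = (\<Sum>t\<in>T. sc (c' t) t)"
      by (rule sum.mono_neutral_cong_left) (use A T in \<open>auto simp: c'_def\<close>)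
    assume "q (\<Sum>t\<in>A. sc (c t) t) / p / p \<in> R"
    then have "sc (inverse p) (\<Sum>t\<in>T. sc (c' t) t) \<in> P"
      unfolding eq using A TP by (intro div submod_sum[OF P(1)] subP(3)) (auto simp: c'_def)
    then have "\<forall>t\<in>T. c' t / p \<in> R" using A by (intro Tp) (auto simp: c'_def)
    then have "c' t0 / p \<in> R" using A(1,3) by blast
    then show False using A(3,4) by (simp add: c'_def)
  qed
  have indep: "independent (vecs ps \<union> T)" "card (vecs ps \<union> T) = 2 * length ps + card T"
    using frame_independent[OF ps(1) T(3,1)] TP by (auto simp: P_def)
  have VT: "vecs ps \<union> T \<subseteq> V" using ps(2) MD(2) TP P(3) by blast
  have "M \<subseteq> span (vecs ps \<union> T)"
  proof
    fix m assume m: "m \<in> M"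
    obtain k where k: "k \<in> rsp (vecs ps)" "m - k \<in> M" "perp (m - k) (vecs ps)"
      using frame_split_in[OF iM(1) ps m] by blast
    then have "m - k \<in> rsp T" unfolding T(2)[symmetric] P_def by blast
    then have "k \<in> span (vecs ps \<union> T)" "m - k \<in> span (vecs ps \<union> T)"
      using k(1) rspan_subset_span[of "vecs ps"] rspan_subset_span[of T] span_mono[of _ "vecs ps \<union> T"] by blast+
    from span_add[OF this] show "m \<in> span (vecs ps \<union> T)" by simp
  qed
  then have "V \<subseteq> span (vecs ps \<union> T)" using span_minimal[OF _ subspace_span] iM(2) by blast
  then have "dim V \<le> card (vecs ps \<union> T)" using T(1) by (intro dim_le_card) auto
  then have cnt: "2 * l + 2 = 2 * length ps + card T"
    using V_dim_bound(2)[OF VT indep(1)] indep(2) dim by simp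
  have "T \<noteq> {}" using nz T(2) by (auto simp: rspan_empty P_def)
  \<comment> \<open>\<open>t1\<close> has unit value if some generator has; otherwise all values are
    divisible by \<open>p\<close> and any generator will do.\<close>
  then have "\<exists>t1\<in>T. q t1 / p \<notin> R \<or> (\<forall>t\<in>T. q t / p \<in> R)" by blast
  then obtain t1 where t1: "t1 \<in> T" "q t1 / p \<notin> R \<or> (\<forall>t\<in>T. q t / p \<in> R)" by blast
  have "\<exists>r\<in>R. q (t + sc r t1) / p \<in> R" if t: "t \<in> T" for t
  proof (cases "q t1 / p \<in> R")
    case True
    then show ?thesis using t1 t by (intro bexI[of _ 0]) auto
  next
    case False
    then show ?thesis using adjust_value[of t1 t] qP bP t t1 TP by blast
  qed
  then obtain r where r: "\<And>t. t \<in> T \<Longrightarrow> r t \<in> R \<and> q (t + sc (r t) t1) / p \<in> R" by metis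
  obtain ts where ts: "distinct ts" "set ts = T - {t1}" using finite_distinct_list[of "T - {t1}"] T(1) by auto
  have lts: "length ts + 1 = card T"
    using distinct_card[OF ts(1)] ts(2) card_Suc_Diff1[OF T(1) t1(1)] by simp
  have "length ts < 3"
  proof (rule ccontr)
    assume "\<not> length ts < 3"
    then obtain t2 t3 t4 rest where tsq: "ts = t2 # t3 # t4 # rest"
      by (auto simp: not_less numeral_3_eq_3 Suc_le_length_iff)
    have t: "t2 \<in> T" "t3 \<in> T" "t4 \<in> T" "distinct [t1, t2, t3, t4]" using ts unfolding tsq by auto
    define w where "w t = t + sc (r t) t1" for t
    have wP: "w t \<in> P" if "t \<in> T" for t using that r t1 TP unfolding w_def by (auto intro!: subP)
    have wq: "q (w t) / p \<in> R" if "t \<in> T" for t using r that by (simp add: w_def)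
    obtain x y z where xyz: "x \<in> R" "y \<in> R" "z \<in> R" "x / p \<notin> R \<or> y / p \<notin> R \<or> z / p \<notin> R"
      "(q (w t2) / p * x\<^sup>2 + q (w t3) / p * y\<^sup>2 + q (w t4) / p * z\<^sup>2 + b (w t2) (w t3) / p * x * y
        + b (w t2) (w t4) / p * x * z + b (w t3) (w t4) / p * y * z) / p \<in> R"
      using ternary_zero_mod[of "q (w t2) / p" "q (w t3) / p" "q (w t4) / p" "b (w t2) (w t3) / p"
        "b (w t2) (w t4) / p" "b (w t3) (w t4) / p"] wq bP wP t by blast
    \<comment> \<open>The coordinates of the zero in the original generators; \<open>t1\<close>
      collects the corrections made in the \<open>w t\<close>.\<close>
    define c where "c = (\<lambda>_. 0) (t1 := x * r t2 + y * r t3 + z * r t4, t2 := x, t3 := y, t4 := z)"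
    have vec: "sc x (w t2) + sc y (w t3) + sc z (w t4) = (\<Sum>t\<in>{t1, t2, t3, t4}. sc (c t) t)"
      using t(4) by (simp add: c_def w_def scale_right_distrib scale_left_distrib add_ac)
    have "q (sc x (w t2) + sc y (w t3) + sc z (w t4)) / p / p = (q (w t2) / p * x\<^sup>2 + q (w t3) / p * y\<^sup>2
      + q (w t4) / p * z\<^sup>2 + b (w t2) (w t3) / p * x * y
      + b (w t2) (w t4) / p * x * z + b (w t3) (w t4) / p * y * z) / p"
      by (simp add: q_add add_divide_distrib distrib_left mult_ac)
    then have in': "q (\<Sum>t\<in>{t1, t2, t3, t4}. sc (c t) t) / p / p \<in> R" using xyz(5) vec by simp
    have cR: "c t \<in> R" for t using xyz(1-3) r t t1 by (auto simp: c_def intro!: ring_in)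
    have "\<exists>t0\<in>{t1, t2, t3, t4}. c t0 / p \<notin> R" using xyz(4) t(4) by (auto simp: c_def)
    then show False using prim[of "{t1, t2, t3, t4}" c] in' cR t t1 by blast
  qed
  then have lT: "card T = 2" "length ps = l" using cnt lts by presburger+
  then obtain t2 where tsq: "ts = [t2]" using lts by (cases ts) auto
  have t2: "t2 \<in> T" "t2 \<noteq> t1" "T = {t1, t2}" using ts t1 unfolding tsq by auto
  have prim2: "q (sc x t1 + sc y t2) / p / p \<notin> R" if xy: "x \<in> R" "y \<in> R" "x / p \<notin> R \<or> y / p \<notin> R" for x y
  proof -
    define c where "c = (\<lambda>_. 0) (t1 := x, t2 := y)"
    have "sc x t1 + sc y t2 = (\<Sum>t\<in>{t1, t2}. sc (c t) t)" using t2 by (simp add: c_def)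
    moreover have "\<exists>t0\<in>{t1, t2}. c t0 / p \<notin> R" using xy t2 by (auto simp: c_def)
    moreover have "c t \<in> R" for t using xy by (simp add: c_def)
    ultimately show ?thesis using prim[of "{t1, t2}" c] t2 by auto
  qed
  have tP: "t1 \<in> P" "t2 \<in> P" using t1 t2 TP by blast+
  show ?thesis
  proof (cases "q t1 / p \<in> R")
    case False
    define e where "e = t2 + sc (r t2) t1"
    have "valuation_one (q e)" using r[OF t2(1)] prim2[of "r t2" 1] one_not_dvd by (simp add: valuation_one_def e_def add.commute)
    moreover have "e \<in> P" unfolding e_def using tP r[OF t2(1)] by (intro subP) auto
    ultimately have "unit_prime_complement M ps"
      unfolding unit_prime_complement_def using False tP by (intro bexI[of _ t1] bexI[of _ e]) (auto simp: P_def)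
    then show ?thesis using lT by blast
  next
    case True
    then have q12: "q t1 / p \<in> R" "q t2 / p \<in> R" using t1(2) t2(1) by auto
    have "valuation_one (q t1)" using q12 prim2[of 1 0] one_not_dvd by (simp add: valuation_one_def)
    moreover have "valuation_one (b t1 t2)"
    proof (rule ccontr)
      assume "\<not> valuation_one (b t1 t2)"
      then have "b t1 t2 / p / p \<in> R" using bP tP by (auto simp: valuation_one_def)
      then obtain x y where xy: "x \<in> R" "y \<in> R" "x / p \<notin> R \<or> y / p \<notin> R"
        "(q t1 / p * x\<^sup>2 + q t2 / p * y\<^sup>2 + b t1 t2 / p * x * y) / p \<in> R"
        using binary_zero_mod[OF q12] by blast
      have "q (sc x t1 + sc y t2) / p / p = (q t1 / p * x\<^sup>2 + q t2 / p * y\<^sup>2 + b t1 t2 / p * x * y) / p"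
        by (simp add: q_add add_divide_distrib distrib_left mult_ac)
      then show False using prim2[OF xy(1-3)] xy(4) by simp
    qed
    moreover have "\<forall>m\<in>M. b t1 m / p \<in> R" using rad tP by blast
    ultimately have "modular_complement M ps"
      unfolding modular_complement_def using tP q12 by (intro bexI[of _ t1] bexI[of _ t2]) (auto simp: P_def)
    then show ?thesis using lT by blast
  qed
qed

text \<open>If a maximal frame leaves no complement, \<open>M\<close> is unimodular with
  \<open>l + 1 \<ge> 2\<close> pairs. One pair \<open>(e, z)\<close> is then chosen anew with
  \<open>q e\<close> of valuation one and placed at the end of a frame; if the frame is full again,
  this pair is dropped and its plane supplies both required vectors.\<close>

lemma maximal_structure:
  assumes M: "max_lattice M" and dim: "dim V = 2 * l + 2" and l: "l \<ge> 1"
  shows "\<exists>ps. frame ps \<and> vecs ps \<subseteq> M \<and> length ps = l \<and> (unit_prime_complement M ps \<or> modular_complement M ps)"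
proof -
  have iM: "integral M" "span M = V" using M by (auto simp: max_lattice_def)
  note MD = integralD[OF iM(1)] and sub = submodD[OF MD(1)]
  define triv where "triv ps \<longleftrightarrow> (\<forall>x\<in>M. perp x (vecs ps) \<longrightarrow> x = 0)" for ps
  have full: "length ps = l + 1" if ps: "frame ps" "vecs ps \<subseteq> M" "triv ps" for ps
  proof -
    have "M \<subseteq> span (vecs ps)"
    proof
      fix m assume m: "m \<in> M"
      obtain k where k: "k \<in> rsp (vecs ps)" "m - k \<in> M" "perp (m - k) (vecs ps)"
        using frame_split_in[OF iM(1) ps(1,2) m] by blast
      then have "m - k = 0" using ps(3) by (auto simp: triv_def)
      then show "m \<in> span (vecs ps)" using k(1) rspan_subset_span by auto
    qed
    then have "V \<subseteq> span (vecs ps)" using span_minimal[OF _ subspace_span] iM(2) by blast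
    then have "dim V \<le> card (vecs ps)" by (intro dim_le_card) auto
    moreover have "card (vecs ps) = 2 * length ps" using frame_independent[OF ps(1), of "{}"] by (simp add: independent_empty)
    ultimately show ?thesis using frame_length[OF ps(1)] dim by linarith
  qed
  have step: ?thesis
    if ps: "frame ps" "vecs ps \<subseteq> M" "\<not> triv ps"
      "\<forall>x\<in>M. \<forall>y\<in>M. perp x (vecs ps) \<longrightarrow> perp y (vecs ps) \<longrightarrow> b x y / p \<in> R" for ps
    using frame_complement_structure[OF M ps(1,2) _ dim] ps(3,4) ps(1,2) unfolding triv_def by blast
  obtain ps where ps: "frame ps" "vecs ps \<subseteq> M"
    "\<forall>x\<in>M. \<forall>y\<in>M. perp x (vecs ps) \<longrightarrow> perp y (vecs ps) \<longrightarrow> b x y / p \<in> R"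
    using maximal_frame[OF iM(1), of "[]"] by auto
  show ?thesis
  proof (cases "triv ps")
    case False
    then show ?thesis using step ps by blast
  next
    case True
    then have "length ps = l + 1" using full ps by blast
    then have "Suc (Suc 0) \<le> length ps" using l by simp
    then obtain x1 y1 x2 y2 rest where psq: "ps = (x1, y1) # (x2, y2) # rest"
      by (auto simp: Suc_le_length_iff)
    have v: "x1 \<in> M" "y1 \<in> M" "x2 \<in> M" "y2 \<in> M" "b x1 y1 = 1" "b x2 y2 = 1" "b x1 x2 = 0" "b x2 y1 = 0"
      using ps(1,2) unfolding psq by (auto simp: b_sym[of x1 x2])
    \<comment> \<open>The second pair is needed here: a multiple of \<open>x2\<close> corrects the
      value of \<open>x1\<close> without changing its pairing with \<open>y1\<close>.\<close>
    have "\<exists>x\<in>M. \<exists>y\<in>M. b x y = 1 \<and> q x / p \<in> R"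
    proof (cases "q x2 / p \<in> R")
      case True then show ?thesis using v by blast
    next
      case False
      then obtain r where r: "r \<in> R" "q (x1 + sc r x2) / p \<in> R"
        using adjust_value[of x2 x1] MD(3) v by auto
      moreover have "x1 + sc r x2 \<in> M" using r v sub by blast
      moreover have "b (x1 + sc r x2) y1 = 1" using v by simp
      ultimately show ?thesis using v by blast
    qed
    then obtain x y where xy: "x \<in> M" "y \<in> M" "b x y = 1" "q x / p \<in> R" by blast
    have "\<exists>e\<in>M. valuation_one (q e) \<and> b e y / p \<notin> R"
    proof (cases "valuation_one (q x)")
      case True then show ?thesis using xy one_not_dvd by auto
    next
      case False
      then have q2: "q x / p / p \<in> R" using xy by (simp add: valuation_one_def)
      \<comment> \<open>Adding \<open>p y\<close> contributes \<open>p * b x y = p\<close> to the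
        value, while \<open>q x\<close> and the remaining term are divisible by the square of
        \<open>p\<close>.\<close>
      define e where "e = x + sc p y"
      have e: "e \<in> M" unfolding e_def using xy sub p_in by blast
      have "q e / p = q x / p + (1 + p * q y)"
        by (simp add: e_def q_add xy(3) add_divide_distrib power2_eq_square)
      moreover have "(p * q y + q x / p) / p \<in> R" using q2 MD(3)[OF xy(2)] by (intro dvd_add) auto
      then have "(1 + (p * q y + q x / p)) / p \<notin> R" by (rule add_not_dvd[OF one_not_dvd])
      ultimately have "valuation_one (q e)" using xy MD(3)[OF xy(2)] by (simp add: valuation_one_def ring_in add_ac)
      moreover have "2 * (p * q y) / p \<in> R" using MD(3)[OF xy(2)] by (intro two_dvd ring_in) auto
      then have "b e y / p \<notin> R"
        using add_not_dvd[OF one_not_dvd, of "2 * (p * q y)"] xy(3) by (simp add: e_def mult_ac)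
      ultimately show ?thesis using e by blast
    qed
    then obtain e where e: "e \<in> M" "valuation_one (q e)" "b e y / p \<notin> R" by blast
    obtain z where z: "z \<in> M" "frame [(e, z)]"
      using frame_extend[OF iM(1), of "[]" e y] e xy by auto
    \<comment> \<open>If \<open>p\<close> divides \<open>q z\<close>, then \<open>q (e + z)\<close>
      is congruent to \<open>b e z = 1\<close>.\<close>
    have "\<exists>u\<in>M. u \<in> {z, e + z} \<and> q u / p \<notin> R"
    proof (cases "q z / p \<in> R")
      case True
      then have "(1 + (q e + q z)) / p \<notin> R"
        using e by (intro add_not_dvd one_not_dvd dvd_add) (auto simp: valuation_one_def)
      then have "q (e + z) / p \<notin> R" using z(2) by (simp add: q_add add_ac)
      then show ?thesis using sub(2)[OF e(1) z(1)] by blast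
    qed (use z in auto)
    then obtain u where u: "u \<in> M" "u \<in> {z, e + z}" "q u / p \<notin> R" by blast
    obtain qs where qs: "frame (qs @ [(e, z)])" "vecs (qs @ [(e, z)]) \<subseteq> M"
      "\<forall>x\<in>M. \<forall>y\<in>M. perp x (vecs (qs @ [(e, z)])) \<longrightarrow> perp y (vecs (qs @ [(e, z)])) \<longrightarrow> b x y / p \<in> R"
      using maximal_frame[OF iM(1) z(2)] e z by auto
    show ?thesis
    proof (cases "triv (qs @ [(e, z)])")
      case False then show ?thesis using step qs by blast
    next
      case True
      then have len: "length qs = l" using full[OF qs(1,2)] by simp
      have fq: "frame qs" "vecs qs \<subseteq> M" "perp e (vecs qs)" "perp z (vecs qs)"
        using qs(1,2) by (auto simp: frame_append b_sym)
      then have "perp u (vecs qs)" using u(2) by auto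
      then have "unit_prime_complement M qs"
        unfolding unit_prime_complement_def using u e fq by blast
      then show ?thesis using fq len by blast
    qed
  qed
qed

section \<open>Criteria for maximality\<close>

text \<open>A frame of full rank spans a module equal to its dual for \<open>b\<close>, which leaves
  no room for an integral extension.\<close>

lemma full_frame_maximal:
  assumes M: "integral M" "span M = V" and qs: "frame qs" "vecs qs \<subseteq> M" "dim V \<le> 2 * length qs"
  shows "max_lattice M"
  unfolding max_lattice_def
proof (intro conjI M ballI impI)
  note MD = integralD[OF M(1)]
  fix z assume z: "z \<in> V" "q z \<in> R" "\<forall>m\<in>M. b z m \<in> R"
  obtain k where k: "k \<in> rsp (vecs qs)" "perp (z - k) (vecs qs)"
    using frame_split[OF qs(1), of z] z(3) qs(2) by blast
  have kM: "k \<in> M" using k(1) rspan_minimal[OF MD(1) qs(2)] by blast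
  have "z - k = 0"
  proof (rule full_zero)
    show "nondeg_on (vecs qs)" by (rule nondeg_on_frame[OF qs(1)])
    show "independent (vecs qs)" "dim V \<le> card (vecs qs)"
      using frame_independent[OF qs(1), of "{}"] qs(3) by (auto simp: independent_empty)
    show "z - k \<in> V" using z(1) kM MD(2) V_in(3) by blast
  qed (use qs MD(2) k(2) in blast)+
  then show "z \<in> M" using kM by simp
qed

text \<open>A unit pairing in the binary complement would complete the frame to full rank.\<close>

lemma nonmaximal_complement:
  assumes M: "integral M" "span M = V" "\<not> max_lattice M" and qs: "frame qs" "vecs qs \<subseteq> M" "dim V = 2 * length qs + 2"
    and xy: "x \<in> M" "y \<in> M" "perp x (vecs qs)" "perp y (vecs qs)"
  shows "b x y / p \<in> R"
proof (rule ccontr)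
  assume "b x y / p \<notin> R"
  then obtain z where z: "z \<in> M" "frame ((x, z) # qs)" using frame_extend[OF M(1) qs(1,2) xy] by blast
  have "max_lattice M" by (rule full_frame_maximal[OF M(1,2) z(2)]) (use qs xy z in auto)
  then show False using M(3) by blast
qed

text \<open>A vector that could be adjoined may be taken orthogonal to the frame, hence in the span
  of \<open>u\<close> and \<open>e\<close>; there \<open>eisenstein_integral\<close> makes the
  coordinates of every vector of integral value integral.\<close>

lemma eisenstein_complement_maximal:
  assumes M: "integral M" "span M = V" and qs: "frame qs" "vecs qs \<subseteq> M" "dim V = 2 * length qs + 2"
    and ue: "u \<in> M" "e \<in> M" "perp u (vecs qs)" "perp e (vecs qs)" "q u / p \<notin> R" "valuation_one (q e)" "b u e / p \<in> R"
  shows "max_lattice M"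
  unfolding max_lattice_def
proof (intro conjI M ballI impI)
  note MD = integralD[OF M(1)] and sub = submodD[OF integralD(1)[OF M(1)]]
  have val: "x \<in> R \<and> y \<in> R" if "q (sc x u + sc y e) \<in> R" for x y
  proof -
    have "q u * x\<^sup>2 + b u e * x * y + q e * y\<^sup>2 \<in> R" using that by (simp add: q_add mult_ac)
    from eisenstein_integral[OF MD(3)[OF ue(1)] ue(5,7,6) this] show ?thesis by blast
  qed
  have e0: "e \<noteq> 0" using valuation_one_nonzero[OF ue(6)] by auto
  have us: "u \<notin> span {e}"
  proof
    assume "u \<in> span {e}"
    then obtain c where c: "u = sc c e" by (auto simp: span_singleton)
    \<comment> \<open>The zero vector would have the non-integral coefficient \<open>1 / p\<close>,
      against \<open>val\<close>.\<close>
    have "sc (1 / p) u + sc (- c / p) e = 0" unfolding c by (simp flip: scale_left_distrib)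
    then have "1 / p \<in> R" using val[of "1 / p" "- c / p"] by simp
    then show False using one_not_dvd by blast
  qed
  then have ue2: "independent {u, e}" "card {u, e} = 2"
    using e0 independent_insertI[OF us] span_base[of e "{e}"] by (auto simp: dependent_single card_insert_if)
  have ind: "independent (vecs qs \<union> {u, e})" "card (vecs qs \<union> {u, e}) = 2 * length qs + 2"
    using frame_independent[OF qs(1) ue2(1)] ue ue2 by auto
  have "vecs qs \<union> {u, e} \<subseteq> V" using qs(2) ue MD(2) by blast
  from V_spanned[OF this ind(1)] have sp: "span (vecs qs \<union> {u, e}) = V" using ind(2) qs(3) by simp
  fix z assume z: "z \<in> V" "q z \<in> R" "\<forall>m\<in>M. b z m \<in> R"
  obtain k where k: "k \<in> rsp (vecs qs)" "perp (z - k) (vecs qs)"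
    using frame_split[OF qs(1), of z] z(3) qs(2) by blast
  have kM: "k \<in> M" using k(1) rspan_minimal[OF MD(1) qs(2)] by blast
  have "z - k \<in> V" using z(1) kM MD(2) V_in(3) by blast
  then obtain v t where vt: "v \<in> span (vecs qs)" "t \<in> span {u, e}" "z - k = v + t"
    unfolding sp[symmetric] span_Un by auto
  have "b w v = 0" if w: "w \<in> vecs qs" for w
  proof -
    have "b t w = 0" by (rule perp_span[OF _ vt(2)]) (use ue w in \<open>auto simp: b_sym[of _ w]\<close>)
    moreover have "b w (z - k) = 0" using k(2) w by blast
    ultimately show ?thesis unfolding vt(3) by (simp add: b_sym[of w t])
  qed
  then have "v = 0" using nondeg_on_frame[OF qs(1)] vt(1) by (auto simp: nondeg_on_def)
  moreover obtain x y where "t = sc x u + sc y e"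
    using vt(2) by (auto simp: span_insert span_singleton) (metis add.commute diff_eq_eq)
  ultimately have t: "z - k = sc x u + sc y e" using vt(3) by simp
  have "q (z - k) \<in> R" using z kM MD(3)[OF kM] unfolding q_diff by (intro add_in diff_in) auto
  then have "x \<in> R" "y \<in> R" using val unfolding t by blast+
  then have "z - k \<in> M" unfolding t using ue sub by blast
  from sub(2)[OF this kM] show "z \<in> M" by simp
qed

lemma frame_map:
  assumes "frame ps" "\<And>v w. v \<in> vecs ps \<Longrightarrow> w \<in> vecs ps \<Longrightarrow> b (\<sigma> v) (\<sigma> w) = b v w"
    "\<And>v. v \<in> vecs ps \<Longrightarrow> q (\<sigma> v) = q v" "\<And>v. v \<in> vecs ps \<Longrightarrow> \<sigma> v \<in> V"
  shows "frame (map (map_prod \<sigma> \<sigma>) ps)"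
  using assms by (induction ps rule: frame.induct) (auto simp: vecs_map)

section \<open>ADC lattices are maximal\<close>

text \<open>The consequence of \<open>n_ADC\<close> used below: test lattices are given by bases
  inside \<open>V\<close>, and representations by their values on these bases.\<close>

definition adc :: "nat \<Rightarrow> 'v set \<Rightarrow> bool" where
  "adc n M \<longleftrightarrow> (\<forall>A. finite A \<longrightarrow> A \<subseteq> V \<longrightarrow> nondeg_on A \<longrightarrow> independent A \<longrightarrow> card A = n \<longrightarrow> integral (rsp A) \<longrightarrow>
     (\<exists>\<sigma>. (\<forall>v\<in>A. \<sigma> v \<in> M \<and> q (\<sigma> v) = q v) \<and> (\<forall>v\<in>A. \<forall>w\<in>A. b (\<sigma> v) (\<sigma> w) = b v w)))"

lemma integral_rspan_subset:
  assumes "integral L" "A \<subseteq> L" shows "integral (rsp A)"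
  using rspan_minimal[OF integralD(1)[OF assms(1)] assms(2)] integralD[OF assms(1)] submod_rspan
  unfolding integral_def by blast

lemma adc_frame:
  assumes "adc n M" and M: "integral M" and L: "integral L" and ps: "frame ps" "vecs ps \<subseteq> L"
    and T: "finite T" "T \<subseteq> L" "nondeg_on T" "independent T" "\<And>t. t \<in> T \<Longrightarrow> perp t (vecs ps)" "2 * length ps + card T = n"
  shows "\<exists>qs \<sigma>. frame qs \<and> vecs qs \<subseteq> M \<and> length qs = length ps \<and>
    (\<forall>t\<in>T. \<sigma> t \<in> M \<and> q (\<sigma> t) = q t \<and> perp (\<sigma> t) (vecs qs)) \<and> (\<forall>s\<in>T. \<forall>t\<in>T. b (\<sigma> s) (\<sigma> t) = b s t)"
proof -
  let ?A = "vecs ps \<union> T"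
  have "nondeg_on ?A" using T(3,5) nondeg_on_frame[OF ps(1)] by (intro nondeg_on_union) auto
  moreover have "independent ?A" "card ?A = n" using frame_independent[OF ps(1) T(4,1,5)] T(6) by auto
  moreover have "integral (rsp ?A)" by (rule integral_rspan_subset[OF L]) (use ps T in auto)
  moreover have "?A \<subseteq> V" using ps(2) T(2) integralD(2)[OF L] by blast
  ultimately obtain \<sigma> where s: "\<And>v. v \<in> ?A \<Longrightarrow> \<sigma> v \<in> M" "\<And>v. v \<in> ?A \<Longrightarrow> q (\<sigma> v) = q v"
    "\<And>v w. v \<in> ?A \<Longrightarrow> w \<in> ?A \<Longrightarrow> b (\<sigma> v) (\<sigma> w) = b v w"
    using assms(1) T(1) unfolding adc_def by (metis finite_UnI finite_vecs)
  have "frame (map (map_prod \<sigma> \<sigma>) ps)"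
    by (rule frame_map[OF ps(1)]) (use s integralD(2)[OF M] in auto)
  then show ?thesis
    using s T(5) by (intro exI[of _ "map (map_prod \<sigma> \<sigma>) ps"] exI[of _ \<sigma>]) (auto simp: vecs_map)
qed

text \<open>The images of \<open>u\<close> and \<open>e\<close> are orthogonal to different frames
  \<open>qs\<close> and \<open>rs\<close>. If \<open>M\<close> is not maximal, the image of
  \<open>u\<close> is radical modulo \<open>p\<close>, so it can be made orthogonal to
  \<open>rs\<close> with its value still a unit; with the image of \<open>e\<close> it then gives an
  Eisenstein form.\<close>

lemma adc_imp_maximal_unit_prime:
  assumes M: "integral M" "span M = V" and adc: "adc (2 * l + 1) M" and dim: "dim V = 2 * l + 2"
    and L: "integral L" and ps: "frame ps" "vecs ps \<subseteq> L" "length ps = l" and up: "unit_prime_complement L ps"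
  shows "max_lattice M"
proof (rule ccontr)
  assume nm: "\<not> max_lattice M"
  note MD = integralD[OF M(1)] and sub = submodD[OF integralD(1)[OF M(1)]]
  have cd: "b x y / p \<in> R" if "frame qs" "vecs qs \<subseteq> M" "length qs = l"
    "x \<in> M" "y \<in> M" "perp x (vecs qs)" "perp y (vecs qs)" for qs x y
    using nonmaximal_complement[OF M nm that(1,2) _ that(4-7)] dim that(3) by simp
  obtain u e where ue: "u \<in> L" "e \<in> L" "perp u (vecs ps)" "perp e (vecs ps)" "q u / p \<notin> R" "valuation_one (q e)"
    using up by (auto simp: unit_prime_complement_def)
  have u0: "q u \<noteq> 0" "u \<noteq> 0" and e0: "q e \<noteq> 0" "e \<noteq> 0" using unit_nonzero[OF ue(5)] valuation_one_nonzero[OF ue(6)] by auto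
  obtain qs \<sigma> where 1: "frame qs" "vecs qs \<subseteq> M" "length qs = l" "\<sigma> u \<in> M" "q (\<sigma> u) = q u" "perp (\<sigma> u) (vecs qs)"
    using adc_frame[OF adc M(1) L ps(1,2), of "{u}"] ue u0 ps(3) nondeg_on_single by auto
  obtain rs \<tau> where 2: "frame rs" "vecs rs \<subseteq> M" "length rs = l" "\<tau> e \<in> M" "q (\<tau> e) = q e" "perp (\<tau> e) (vecs rs)"
    using adc_frame[OF adc M(1) L ps(1,2), of "{e}"] ue e0 ps(3) nondeg_on_single by auto
  have rad: "b (\<sigma> u) m / p \<in> R" if "m \<in> M" for m
    by (rule complement_radical[OF M(1) 1(1,2) cd[OF 1(1-3)] 1(4,6) that])
  obtain k where k: "k \<in> rsp (vecs rs)" "perp (\<sigma> u - sc p k) (vecs rs)"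
    using frame_split_dvd[OF 2(1), of "\<sigma> u"] rad 2(2) by blast
  have kM: "k \<in> M" using k(1) rspan_minimal[OF MD(1) 2(2)] by blast
  define w where "w = \<sigma> u - sc p k"
  have wM: "w \<in> M" unfolding w_def using 1(4) kM sub p_in by blast
  have "(p * (p * q k - b (\<sigma> u) k)) / p \<in> R"
    using MD(3)[OF kM] MD(4)[OF 1(4) kM] by (simp add: ring_in)
  from add_not_dvd[OF ue(5) this] have "q w / p \<notin> R"
    by (simp add: w_def q_diff 1(5) power2_eq_square algebra_simps)
  then have "max_lattice M"
    using eisenstein_complement_maximal[OF M 2(1,2) _ wM 2(4) _ 2(6)] cd[OF 2(1-3) wM 2(4) _ 2(6)] k(2) dim 2(3,5) ue(6)
    unfolding w_def[symmetric] by simp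
  then show False using nm by blast
qed

text \<open>Once \<open>b\<close> is known to vanish modulo \<open>p\<close> on the complement of
  \<open>qs\<close> in \<open>L\<close>, \<open>split_pair\<close> splits the plane of
  \<open>x\<close> and \<open>y\<close> off that complement and, by dimension, exhausts it.\<close>

lemma modular_complement_split:
  assumes M: "integral M" and L: "integral L" "M \<subseteq> L" and qs: "frame qs" "vecs qs \<subseteq> M" "dim V = 2 * length qs + 2"
    and e: "e \<in> L" "valuation_one (q e)" "\<And>m. m \<in> L \<Longrightarrow> b e m / p \<in> R"
    and xy: "x \<in> M" "y \<in> M" "perp x (vecs qs)" "perp y (vecs qs)" "valuation_one (b x y)" "q x / p \<in> R" "q y / p \<in> R"
  shows "L \<subseteq> M"
proof
  note MD = integralD[OF M] and sub = submodD[OF integralD(1)[OF M]] and LD = integralD[OF L(1)]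
  fix w assume w: "w \<in> L"
  have qL: "vecs qs \<subseteq> L" using qs(2) L(2) by blast
  \<comment> \<open>A unit pairing would give a frame of full rank in \<open>L\<close>; then
    \<open>e\<close>, being radical modulo \<open>p\<close>, would be \<open>p\<close> times a
    vector of \<open>L\<close>, against the valuation of \<open>q e\<close>.\<close>
  have cd: "b r z / p \<in> R" if rz: "r \<in> L" "z \<in> L" "perp r (vecs qs)" "perp z (vecs qs)" for r z
  proof (rule ccontr)
    assume "b r z / p \<notin> R"
    then obtain t where t: "t \<in> L" "frame ((r, t) # qs)" using frame_extend[OF L(1) qs(1) qL rz] by blast
    let ?f = "(r, t) # qs"
    have fL: "vecs ?f \<subseteq> L" using rz t qL by auto
    obtain k where k: "k \<in> rsp (vecs ?f)" "perp (e - sc p k) (vecs ?f)"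
      using frame_split_dvd[OF t(2), of e] e(3) fL by blast
    have kL: "k \<in> L" using k(1) rspan_minimal[OF LD(1) fL] by blast
    have "e - sc p k = 0"
    proof (rule full_zero)
      show "nondeg_on (vecs ?f)" by (rule nondeg_on_frame[OF t(2)])
      show "independent (vecs ?f)" "dim V \<le> card (vecs ?f)"
        using frame_independent[OF t(2), of "{}"] qs(3) by (auto simp: independent_empty)
      show "e - sc p k \<in> V" using e(1) kL LD(2) V_in(2,3) by blast
      show "vecs ?f \<subseteq> V" using fL LD(2) by blast
    qed (use k(2) in blast)
    then have "q e = p\<^sup>2 * q k" by simp
    then show False using e(2) LD(3)[OF kL] by (simp add: valuation_one_def power2_eq_square)
  qed
  obtain k where k: "k \<in> rsp (vecs qs)" "k \<in> L" "w - k \<in> L" "perp (w - k) (vecs qs)"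
    using frame_split_in[OF L(1) qs(1) qL w] by blast
  have kM: "k \<in> M" using k(1) rspan_minimal[OF MD(1) qs(2)] by blast
  define r d where "r = w - k" and "d = b x y"
  have xyL: "x \<in> L" "y \<in> L" using xy L(2) by blast+
  have d0: "d \<noteq> 0" using valuation_one_nonzero xy(5) by (simp add: d_def)
  have "d / p \<noteq> 0 \<and> inverse (d / p) \<in> R" using unit_or_dvd[of "d / p"] xy(5) by (auto simp: valuation_one_def d_def)
  then have quo: "z / d \<in> R" if "z / p \<in> R" for z
    using mult_in[OF that, of "inverse (d / p)"] by simp
  have R: "q x / d \<in> R" "q y / d \<in> R" "b r x / d \<in> R" "b r y / d \<in> R"
    using quo xy(6,7) cd[OF k(3) xyL(1) k(4) xy(3)] cd[OF k(3) xyL(2) k(4) xy(4)] by (auto simp: r_def)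
  obtain \<alpha> \<beta> where ab: "\<alpha> \<in> R" "\<beta> \<in> R" "b x (r - (sc \<alpha> x + sc \<beta> y)) = 0" "b y (r - (sc \<alpha> x + sc \<beta> y)) = 0"
    using split_pair[OF d0 d_def[symmetric] R] by blast
  have "4 * (q x / d) * (q y / d) \<noteq> 1" by (rule frame_disc[OF R(1,2)])
  then have disc: "4 * q x * q y \<noteq> (b x y)\<^sup>2" using d0 by (simp add: d_def[symmetric] power2_eq_square field_simps)
  have ind: "independent {x, y}" "card {x, y} = 2"
    using independent_insert_pair[OF independent_empty disc] by auto
  have "r - (sc \<alpha> x + sc \<beta> y) = 0"
  proof (rule full_zero)
    show "nondeg_on ({x, y} \<union> vecs qs)"
      using nondeg_on_pair[OF disc] nondeg_on_frame[OF qs(1)] xy(3,4) by (intro nondeg_on_union) (auto simp: b_sym)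
    have "perp t (vecs qs)" if "t \<in> {x, y}" for t using that xy(3,4) by blast
    from frame_independent[OF qs(1) ind(1) _ this]
    show "independent ({x, y} \<union> vecs qs)" "dim V \<le> card ({x, y} \<union> vecs qs)"
      unfolding Un_commute[of "{x, y}"] ind(2) qs(3) by auto
    show "{x, y} \<union> vecs qs \<subseteq> V" using xy qs(2) MD(2) by blast
    show "r - (sc \<alpha> x + sc \<beta> y) \<in> V"
      using k(3) xy(1,2) MD(2) LD(2) unfolding r_def by (intro V_in(1,2,3)[of "w - k"] V_in(1,2)) blast+
    have "b v (r - (sc \<alpha> x + sc \<beta> y)) = 0" if "v \<in> vecs qs" for v
      using k(4) xy(3,4) that by (simp add: r_def)
    then show "perp (r - (sc \<alpha> x + sc \<beta> y)) ({x, y} \<union> vecs qs)" using ab(3,4) by blast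
  qed
  then have "w - k \<in> M" unfolding r_def using ab xy sub by simp
  from sub(2)[OF this kM] show "w \<in> M" by simp
qed

text \<open>Two frames again: \<open>qs\<close> comes with an image of \<open>e\<close>, whereas
  \<open>qs0\<close> comes with images of \<open>e\<close>, \<open>f\<close> and \<open>z\<close>
  and is one pair shorter. The unit value of \<open>z\<close> completes \<open>qs0\<close> to length
  \<open>l\<close> and forces the images of \<open>e\<close> and \<open>f\<close> into the radical,
  from where they are moved to the complement of \<open>qs\<close>.\<close>

lemma adc_imp_maximal_modular:
  assumes M: "integral M" "span M = V" and adc: "adc (2 * l + 1) M" and dim: "dim V = 2 * l + 2" and l: "l \<ge> 1"
    and L: "max_lattice L" "M \<subseteq> L" and ps: "frame ps" "vecs ps \<subseteq> L" "length ps = l" and mc: "modular_complement L ps"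
  shows "max_lattice M"
proof (rule ccontr)
  assume nm: "\<not> max_lattice M"
  note MD = integralD[OF M(1)] and sub = submodD[OF integralD(1)[OF M(1)]]
  have iL: "integral L" using L by (simp add: max_lattice_def)
  note LD = integralD[OF iL]
  have cd: "b x y / p \<in> R" if "frame qs" "vecs qs \<subseteq> M" "length qs = l"
    "x \<in> M" "y \<in> M" "perp x (vecs qs)" "perp y (vecs qs)" for qs x y
    using nonmaximal_complement[OF M nm that(1,2) _ that(4-7)] dim that(3) by simp
  define rad where "rad x \<longleftrightarrow> x \<in> M \<and> (\<forall>m\<in>M. b x m / p \<in> R)" for x
  have crad: "rad x" if fr: "frame qs" "vecs qs \<subseteq> M" "length qs = l" and x: "x \<in> M" "perp x (vecs qs)" for qs x
    unfolding rad_def using complement_radical[OF M(1) fr(1,2) cd[OF fr] x] x by blast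
  obtain e f where ef: "e \<in> L" "f \<in> L" "perp e (vecs ps)" "perp f (vecs ps)" "valuation_one (q e)" "q f / p \<in> R"
    "valuation_one (b e f)" "\<And>m. m \<in> L \<Longrightarrow> b e m / p \<in> R"
    using mc by (auto simp: modular_complement_def)
  have e0: "q e \<noteq> 0" "e \<noteq> 0" using valuation_one_nonzero[OF ef(5)] by auto
  obtain qs \<tau> where 2: "frame qs" "vecs qs \<subseteq> M" "length qs = l" "\<tau> e \<in> M" "q (\<tau> e) = q e" "perp (\<tau> e) (vecs qs)"
    using adc_frame[OF adc M(1) iL ps(1,2), of "{e}"] ef e0 ps(3) nondeg_on_single by auto
  \<comment> \<open>A unit value here would form an Eisenstein complement together with the image of
    \<open>e\<close>.\<close>
  have qdiv: "q x / p \<in> R" if x: "x \<in> M" "perp x (vecs qs)" for x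
  proof (rule ccontr)
    assume "q x / p \<notin> R"
    then have "max_lattice M"
      using eisenstein_complement_maximal[OF M 2(1,2) _ x(1) 2(4) x(2) 2(6)] cd[OF 2(1-3) x(1) 2(4) x(2) 2(6)]
        dim 2(3,5) ef(5) by simp
    then show False using nm by blast
  qed
  have rsplit: "\<exists>k\<in>M. \<exists>y\<in>M. k \<in> rsp (vecs qs) \<and> x = sc p k + y \<and> perp y (vecs qs)" if x: "rad x" for x
  proof -
    obtain k where k: "k \<in> rsp (vecs qs)" "perp (x - sc p k) (vecs qs)"
      using frame_split_dvd[OF 2(1), of x] x 2(2) unfolding rad_def by blast
    have kM: "k \<in> M" using k(1) rspan_minimal[OF MD(1) 2(2)] by blast
    moreover have "x - sc p k \<in> M" using x kM sub p_in unfolding rad_def by blast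
    ultimately show ?thesis using k by (intro bexI[of _ k] bexI[of _ "x - sc p k"]) auto
  qed
  have qrad: "q x / p \<in> R" if x: "rad x" for x
  proof -
    obtain k y where k: "k \<in> M" "y \<in> M" "k \<in> rsp (vecs qs)" "x = sc p k + y" "perp y (vecs qs)" using rsplit[OF x] by blast
    have "b k y = 0" using perp_rspan[OF _ k(3), of y] k(5) by blast
    then have "q x = p * (p * q k) + q y" unfolding k(4) by (simp add: q_add power2_eq_square)
    then show ?thesis using qdiv[OF k(2,5)] MD(3)[OF k(1)] by (simp add: add_divide_distrib ring_in)
  qed
  obtain x1 y1 ps0 where psq: "ps = (x1, y1) # ps0" using ps(3) l by (cases ps) auto
  have fp: "frame ps0" "vecs ps0 \<subseteq> L" "x1 \<in> L" "y1 \<in> L" "b x1 y1 = 1" "perp x1 (vecs ps0)" "perp y1 (vecs ps0)"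
    "perp e (vecs ps0)" "perp f (vecs ps0)" "b x1 e = 0" "b y1 e = 0" "b x1 f = 0" "b y1 f = 0"
    using ps ef unfolding psq by auto
  \<comment> \<open>Since \<open>b x1 y1 = 1\<close>, the three values cannot all be divisible by
    \<open>p\<close>.\<close>
  have "\<exists>z\<in>{x1, y1, x1 + y1}. q z / p \<notin> R"
  proof (cases "q x1 / p \<in> R \<and> q y1 / p \<in> R")
    case True
    then have "(1 + (q x1 + q y1)) / p \<notin> R" by (intro add_not_dvd one_not_dvd dvd_add) auto
    then show ?thesis using fp(5) by (auto simp: q_add add_ac)
  qed auto
  then obtain z where z: "z \<in> {x1, y1, x1 + y1}" "q z / p \<notin> R" by blast
  have zL: "z \<in> L" "perp z (vecs ps0)" "b z e = 0" "b z f = 0"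
    using z(1) fp submodD(2)[OF LD(1)] by auto
  have z0: "q z \<noteq> 0" using unit_nonzero[OF z(2)] .
  define d where "d = b e f"
  have du: "d \<noteq> 0" "q e / d \<in> R" "q f / d \<in> R"
  proof -
    show d0: "d \<noteq> 0" using valuation_one_nonzero ef(7) by (simp add: d_def)
    have "d / p \<noteq> 0 \<and> inverse (d / p) \<in> R" using unit_or_dvd[of "d / p"] ef(7) by (auto simp: valuation_one_def d_def)
    then have "c / d \<in> R" if "c / p \<in> R" for c using mult_in[OF that, of "inverse (d / p)"] by simp
    then show "q e / d \<in> R" "q f / d \<in> R" using ef(5,6) by (auto simp: valuation_one_def)
  qed
  have "4 * (q e / d) * (q f / d) \<noteq> 1" by (rule frame_disc[OF du(2,3)])
  then have disc: "4 * q e * q f \<noteq> (b e f)\<^sup>2" using du(1) by (simp add: d_def[symmetric] power2_eq_square field_simps)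
  have "independent {z}" using z0 by auto
  from independent_insert_pair[OF this disc] zL(3,4)
  have ind: "independent {e, f, z}" "card {e, f, z} = 3" by auto
  have "nondeg_on ({e, f} \<union> {z})" using nondeg_on_pair[OF disc] nondeg_on_single[OF z0] zL(3,4) by (intro nondeg_on_union) (auto simp: b_sym)
  then have nd3: "nondeg_on {e, f, z}" by (simp add: insert_commute)
  define T where "T = {e, f, z}"
  have T: "e \<in> T" "f \<in> T" "z \<in> T" by (simp_all add: T_def)
  have "\<exists>qs0 \<sigma>. frame qs0 \<and> vecs qs0 \<subseteq> M \<and> length qs0 = length ps0 \<and>
    (\<forall>t\<in>T. \<sigma> t \<in> M \<and> q (\<sigma> t) = q t \<and> perp (\<sigma> t) (vecs qs0)) \<and>
    (\<forall>s\<in>T. \<forall>t\<in>T. b (\<sigma> s) (\<sigma> t) = b s t)"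
    unfolding T_def
  proof (rule adc_frame[OF adc M(1) iL fp(1,2) _ _ nd3 ind(1)])
    show "perp t (vecs ps0)" if "t \<in> {e, f, z}" for t using that zL(2) fp(8,9) by blast
    show "2 * length ps0 + card {e, f, z} = 2 * l + 1" using ind(2) ps(3) psq by simp
  qed (use ef(1,2) zL(1) in auto)
  then obtain qs0 \<sigma> where 3: "frame qs0" "vecs qs0 \<subseteq> M" "length qs0 = length ps0"
    "\<And>t. t \<in> T \<Longrightarrow> \<sigma> t \<in> M \<and> q (\<sigma> t) = q t \<and> perp (\<sigma> t) (vecs qs0)"
    "\<And>s t. s \<in> T \<Longrightarrow> t \<in> T \<Longrightarrow> b (\<sigma> s) (\<sigma> t) = b s t"
    by blast
  have len0: "length qs0 + 1 = l" using 3(3) ps(3) psq by simp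
  have zM: "\<sigma> z \<in> M" "q (\<sigma> z) = q z" "perp (\<sigma> z) (vecs qs0)" using 3(4)[OF T(3)] by auto
  \<comment> \<open>Radical vectors have values divisible by \<open>p\<close>, but
    \<open>q z\<close> is a unit; so the image of \<open>z\<close> has a partner \<open>w\<close> in
    \<open>M\<close>.\<close>
  have "\<not> rad (\<sigma> z)" using qrad[of "\<sigma> z"] z(2) zM(2) by auto
  then obtain m where m: "m \<in> M" "b (\<sigma> z) m / p \<notin> R" using zM(1) by (auto simp: rad_def)
  obtain k where k: "k \<in> rsp (vecs qs0)" "m - k \<in> M" "perp (m - k) (vecs qs0)"
    using frame_split_in[OF M(1) 3(1,2) m(1)] by blast
  have "b k (\<sigma> z) = 0" by (rule perp_rspan[OF _ k(1)]) (use zM(3) in blast)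
  then have "b (\<sigma> z) (m - k) / p \<notin> R" using m(2) by (simp add: b_sym[of "\<sigma> z" k])
  then obtain w where w: "w \<in> M" "frame ((\<sigma> z, w) # qs0)"
    using frame_extend[OF M(1) 3(1,2) zM(1) k(2) zM(3) k(3)] by blast
  have wf: "b (\<sigma> z) w = 1" "perp w (vecs qs0)" "q w \<in> R" using w(2) by auto
  \<comment> \<open>Up to the radical vector \<open>g - h\<close>, \<open>g\<close> is
    \<open>h = sc \<alpha> (\<sigma> z) + sc \<beta> w\<close>. Orthogonality to the image of
    \<open>z\<close> makes \<open>\<beta>\<close> divisible by 2, hence by \<open>p\<close>; then
    comparing values modulo \<open>p\<close> forces the square of \<open>\<alpha>\<close>, and so
    \<open>\<alpha>\<close>, to be divisible by \<open>p\<close>.\<close>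
  have gr: "rad g" if g: "g \<in> M" "perp g (vecs qs0)" "b (\<sigma> z) g = 0" "q g / p \<in> R" for g
  proof -
    obtain \<alpha> \<beta> where ab: "\<alpha> \<in> R" "\<beta> \<in> R"
      "b (\<sigma> z) (g - (sc \<alpha> (\<sigma> z) + sc \<beta> w)) = 0" "b w (g - (sc \<alpha> (\<sigma> z) + sc \<beta> w)) = 0"
      using split_pair[of 1 "\<sigma> z" w g] wf MD(3)[OF zM(1)] MD(4)[OF g(1) zM(1)] MD(4)[OF g(1) w(1)] by auto
    define h where "h = sc \<alpha> (\<sigma> z) + sc \<beta> w"
    have hM: "h \<in> M" unfolding h_def using ab(1,2) zM(1) w(1) sub by blast
    have ghM: "g - h \<in> M" using sub(4)[OF g(1) hM] .
    have "perp (g - h) (vecs qs0)" using g(2) zM(3) wf(2) by (auto simp: h_def)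
    then have "perp (g - h) (vecs ((\<sigma> z, w) # qs0))" using ab(3,4) by (simp add: h_def[symmetric])
    then have rgh: "rad (g - h)" using crad[OF w(2)] 3(2) zM(1) w(1) len0 ghM by auto
    have "2 * (- \<alpha> * q z) = \<beta>" using ab(3) g(3) wf(1) zM(2) by (simp add: add_eq_0_iff2 mult_ac)
    moreover have "2 * (- \<alpha> * q z) / p \<in> R"
      using ab(1) MD(3)[OF zM(1)] zM(2) by (intro two_dvd ring_in) auto
    ultimately have \<beta>: "\<beta> / p \<in> R" by simp
    have "b h (g - h) = \<alpha> * b (\<sigma> z) (g - h) + \<beta> * b w (g - h)" by (simp only: h_def b_left(1,2))
    also have "\<dots> = 0" using ab(3,4) by (simp only: h_def[symmetric] mult_zero_right add_0_left)
    finally have "q g = q h + q (g - h)" using q_add[of h "g - h"] by simp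
    moreover have "q h = \<alpha>\<^sup>2 * q z + \<beta> * (\<alpha> + \<beta> * q w)"
      using wf(1) zM(2) b_sym[of w "\<sigma> z"] by (simp add: h_def q_add power2_eq_square algebra_simps)
    ultimately have "\<alpha>\<^sup>2 * q z = q g - q (g - h) - \<beta> * (\<alpha> + \<beta> * q w)" by simp
    moreover have "(q g - q (g - h) - \<beta> * (\<alpha> + \<beta> * q w)) / p \<in> R"
      using g(4) qrad[OF rgh] \<beta> ab(1,2) wf(3) by (intro dvd_diff dvd_mult(1) ring_in)
    ultimately have "\<alpha>\<^sup>2 * q z / p \<in> R" by simp
    then have "\<alpha>\<^sup>2 / p \<in> R" using unit_mult_dvd[of "q z" "\<alpha>\<^sup>2"] z(2) MD(3)[OF zM(1)] zM(2) by simp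
    then have \<alpha>: "\<alpha> / p \<in> R" by (rule dvd_square_imp)
    have "b g m / p \<in> R" if m: "m \<in> M" for m
    proof -
      have "b g m = \<alpha> * b (\<sigma> z) m + \<beta> * b w m + b (g - h) m" by (simp add: h_def)
      moreover have "(\<alpha> * b (\<sigma> z) m + \<beta> * b w m + b (g - h) m) / p \<in> R"
        using \<alpha> \<beta> MD(4)[OF zM(1) m] MD(4)[OF w(1) m] rgh m by (intro dvd_add dvd_mult(1)) (auto simp: rad_def)
      ultimately show ?thesis by (simp only:)
    qed
    then show ?thesis using g(1) by (simp add: rad_def)
  qed
  have re: "rad (\<sigma> e)"
    by (rule gr) (use 3(4)[OF T(1)] 3(5)[OF T(3,1)] zL(3) ef(5) in \<open>auto simp: valuation_one_def\<close>)
  have rf: "rad (\<sigma> f)"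
    by (rule gr) (use 3(4)[OF T(2)] 3(5)[OF T(3,2)] zL(4) ef(6) in auto)
  obtain k x where kx: "k \<in> M" "x \<in> M" "k \<in> rsp (vecs qs)" "\<sigma> e = sc p k + x" "perp x (vecs qs)"
    using rsplit[OF re] by blast
  obtain k' y where ky: "k' \<in> M" "y \<in> M" "k' \<in> rsp (vecs qs)" "\<sigma> f = sc p k' + y" "perp y (vecs qs)"
    using rsplit[OF rf] by blast
  have "b k y = 0" "b k' x = 0" using perp_rspan[OF _ kx(3), of y] perp_rspan[OF _ ky(3), of x] kx(5) ky(5) by blast+
  \<comment> \<open>The frame components are multiples of \<open>p\<close>, so they contribute to
    the pairing only modulo the square of \<open>p\<close>, and \<open>b x y\<close> inherits
    valuation one from \<open>b e f\<close>.\<close>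
  then have "b (\<sigma> e) (\<sigma> f) = p * (p * b k k') + b x y"
    unfolding kx(4) ky(4) by (simp add: b_sym[of x k'])
  then have bxy: "b e f = p * (p * b k k') + b x y" using 3(5)[OF T(1,2)] by simp
  have "valuation_one (b x y)"
  proof -
    have "b x y / p / p \<notin> R"
    proof
      assume "b x y / p / p \<in> R"
      then have "b k k' + b x y / p / p \<in> R" using MD(4)[OF kx(1) ky(1)] by (intro add_in)
      then have "b e f / p / p \<in> R" unfolding bxy by (simp add: add_divide_distrib)
      then show False using ef(7) by (simp add: valuation_one_def)
    qed
    then show ?thesis using cd[OF 2(1-3) kx(2) ky(2) kx(5) ky(5)] by (simp add: valuation_one_def)
  qed
  then have "L \<subseteq> M"
    using modular_complement_split[OF M(1) iL L(2) 2(1,2) _ ef(1,5,8) kx(2) ky(2) kx(5) ky(5)]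
      qdiv[OF kx(2,5)] qdiv[OF ky(2,5)] dim 2(3) by simp
  then show False using L nm by (simp add: subset_antisym)
qed

theorem adc_imp_maximal:
  assumes "integral M" "span M = V" "adc (2 * l + 1) M" "dim V = 2 * l + 2" "l \<ge> 1"
  shows "max_lattice M"
proof -
  obtain L where L: "max_lattice L" "M \<subseteq> L" using extend_to_maximal[OF assms(1,2)] by blast
  obtain ps where ps: "frame ps" "vecs ps \<subseteq> L" "length ps = l"
    "unit_prime_complement L ps \<or> modular_complement L ps"
    using maximal_structure[OF L(1) assms(4,5)] by blast
  show ?thesis
    using ps(4) adc_imp_maximal_unit_prime[OF assms(1-4) _ ps(1-3)] adc_imp_maximal_modular[OF assms L ps(1-3)] L(1)
    by (auto simp: max_lattice_def)
qed

end

section \<open>Lattices in an arbitrary ambient space\<close>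

lemma (in vector_space) projection_exists:
  assumes "finite S"
  shows "\<exists>f. Vector_Spaces.linear scale scale f \<and> (\<forall>x. f x \<in> span S) \<and> (\<forall>x\<in>span S. f x = x)"
proof -
  interpret P: vector_space_pair scale scale ..
  obtain T where T: "T \<subseteq> S" "independent T" "span T = span S"
    using maximal_independent_subset[of S] by (metis span_minimal span_mono subset_antisym subspace_span)
  define f where "f = P.construct T (\<lambda>x. x)"
  have lin: "Vector_Spaces.linear scale scale f" unfolding f_def by (rule P.linear_construct[OF T(2)])
  interpret L: Vector_Spaces.linear scale scale f by (rule lin)
  have bas: "f t = t" if "t \<in> T" for t unfolding f_def by (rule P.construct_basis[OF T(2) that])
  have "f x = x" if "x \<in> span T" for x
    using that by (induction rule: span_induct_alt) (simp_all add: L.add L.scale bas)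
  moreover have "f x \<in> span T" for x
    using P.construct_in_span[OF T(2), of "\<lambda>x. x" x] by (simp add: f_def)
  ultimately show ?thesis using lin T(3) by auto
qed

lemma (in dvr_subring) norm_ideal_subset_iff: "norm_ideal R B L \<subseteq> R \<longleftrightarrow> (\<forall>x\<in>L. B x x \<in> R)"
proof
  assume *: "norm_ideal R B L \<subseteq> R"
  show "\<forall>x\<in>L. B x x \<in> R"
  proof
    fix x assume "x \<in> L"
    then have "B x x \<in> norm_ideal R B L"
      unfolding norm_ideal_def by (intro CollectI exI[of _ "{x}"] exI[of _ "\<lambda>_. 1"]) auto
    then show "B x x \<in> R" using * by blast
  qed
next
  assume "\<forall>x\<in>L. B x x \<in> R"
  then show "norm_ideal R B L \<subseteq> R"
    unfolding norm_ideal_def by (auto intro!: sum_in mult_in)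
qed

locale dyadic_lattice = dyadic_dvr R p for R :: "'a::field_char_0 set" and p :: 'a +
  fixes sc :: "'a \<Rightarrow> 'v::ab_group_add \<Rightarrow> 'v" and B :: "'v \<Rightarrow> 'v \<Rightarrow> 'a" and M :: "'v set"
  assumes lattice: "integral_lattice R sc B M"
begin

sublocale vector_space sc
  using lattice by (simp add: integral_lattice_def nondegenerate_quadratic_space_def)

abbreviation "W \<equiv> span M"

lemma W_props:
  shows W_fg: "\<exists>S. finite S \<and> W = span S"
    and W_sym: "x \<in> W \<Longrightarrow> y \<in> W \<Longrightarrow> B x y = B y x"
    and W_add: "x \<in> W \<Longrightarrow> y \<in> W \<Longrightarrow> z \<in> W \<Longrightarrow> B (x + y) z = B x z + B y z"
    and W_scale: "x \<in> W \<Longrightarrow> y \<in> W \<Longrightarrow> B (sc c x) y = c * B x y"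
    and W_nondegenerate: "x \<in> W \<Longrightarrow> (\<And>y. y \<in> W \<Longrightarrow> B x y = 0) \<Longrightarrow> x = 0"
  using lattice unfolding integral_lattice_def nondegenerate_quadratic_space_def by blast+

text \<open>The form \<open>B\<close> is meaningful on \<open>F M\<close> only; composing it with a projection makes it bilinear
  on the ambient space.\<close>

definition pr :: "'v \<Rightarrow> 'v" where
  "pr = (SOME f. Vector_Spaces.linear sc sc f \<and> (\<forall>x. f x \<in> W) \<and> (\<forall>x\<in>W. f x = x))"

lemma pr: "Vector_Spaces.linear sc sc pr" "pr x \<in> W" "x \<in> W \<Longrightarrow> pr x = x"
proof -
  obtain S where S: "finite S" "W = span S" using W_fg by blast
  have "\<exists>f. Vector_Spaces.linear sc sc f \<and> (\<forall>x. f x \<in> W) \<and> (\<forall>x\<in>W. f x = x)"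
    unfolding S(2) by (rule projection_exists[OF S(1)])
  from someI_ex[OF this] have "Vector_Spaces.linear sc sc pr \<and> (\<forall>x. pr x \<in> W) \<and> (\<forall>x\<in>W. pr x = x)"
    unfolding pr_def .
  then show "Vector_Spaces.linear sc sc pr" "pr x \<in> W" "x \<in> W \<Longrightarrow> pr x = x" by blast+
qed

definition B0 :: "'v \<Rightarrow> 'v \<Rightarrow> 'a" where "B0 x y = B (pr x) (pr y)"

sublocale Q: quadratic_lattices R p sc B0 W
proof
  interpret L: Vector_Spaces.linear sc sc pr by (rule pr)
  show "B0 x y = B0 y x" for x y unfolding B0_def by (rule W_sym[OF pr(2) pr(2)])
  show "B0 (x + y) z = B0 x z + B0 y z" for x y z unfolding B0_def L.add by (rule W_add[OF pr(2) pr(2) pr(2)])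
  show "B0 (sc c x) y = c * B0 x y" for c x y unfolding B0_def L.scale by (rule W_scale[OF pr(2) pr(2)])
  show "subspace W" by (rule subspace_span)
  show "\<exists>S. finite S \<and> W = span S" by (rule W_fg)
  fix x assume x: "x \<in> W" "\<And>y. y \<in> W \<Longrightarrow> B0 x y = 0"
  show "x = 0" by (rule W_nondegenerate[OF x(1)]) (use x(2) pr(3) x(1) in \<open>simp add: B0_def\<close>)
qed

lemma q_eq: "x \<in> W \<Longrightarrow> Q.q x = B x x" and b_eq: "x \<in> W \<Longrightarrow> y \<in> W \<Longrightarrow> Q.b x y = 2 * B x y"
  by (simp_all add: Q.q_def Q.b_def B0_def pr)

lemma integral_iff: "L \<subseteq> W \<Longrightarrow> fg_submodule R sc L \<Longrightarrow> norm_ideal R B L \<subseteq> R \<longleftrightarrow> Q.integral L"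
proof -
  assume L: "L \<subseteq> W" "fg_submodule R sc L"
  have "Q.submod L" using L(2) Q.submod_rspan unfolding Q.fg_submodule_iff by blast
  moreover have "(\<forall>x\<in>L. B x x \<in> R) \<longleftrightarrow> (\<forall>x\<in>L. Q.q x \<in> R)" using q_eq[OF subsetD[OF L(1)]] by simp
  ultimately show ?thesis using L(1) by (simp add: norm_ideal_subset_iff Q.integral_def)
qed

lemma M_integral: "Q.integral M"
  using lattice integral_iff[of M] span_superset by (auto simp: integral_lattice_def)

lemma maximal_iff: "maximal_lattice R sc B M \<longleftrightarrow> Q.max_lattice M"
proof
  assume mx: "maximal_lattice R sc B M"
  show "Q.max_lattice M"
    unfolding Q.max_lattice_def
  proof (intro conjI M_integral refl ballI impI)
    fix x assume x: "x \<in> W" "Q.q x \<in> R" "\<forall>m\<in>M. Q.b x m \<in> R"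
    let ?L = "Q.rsp (insert x M)"
    have L: "Q.integral ?L" by (rule Q.integral_insert[OF M_integral]) (use x in auto)
    have sub: "insert x M \<subseteq> ?L" by (rule Q.rspan_superset)
    have sp: "span ?L = W"
      using Q.integralD(2)[OF L] span_mono[of M ?L] sub span_minimal[OF _ subspace_span, of ?L M] by blast
    have fg: "fg_submodule R sc ?L" using Q.integral_spanning_fg[OF L sp] by (simp add: Q.fg_submodule_iff)
    have "norm_ideal R B ?L \<subseteq> R" using integral_iff[OF Q.integralD(2)[OF L] fg] L by blast
    then have "?L = M" using mx fg sp sub unfolding maximal_lattice_def by blast
    then show "x \<in> M" using sub by blast
  qed
next
  assume mx: "Q.max_lattice M"
  show "maximal_lattice R sc B M"
    unfolding maximal_lattice_def
  proof (intro conjI lattice allI impI; elim conjE)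
    fix L assume L: "fg_submodule R sc L" "span L = W" "norm_ideal R B L \<subseteq> R" "M \<subseteq> L"
    have LW: "L \<subseteq> W" using L(2) span_superset by blast
    have "Q.integral L" using integral_iff[OF LW L(1)] L(3) by blast
    note LD = Q.integralD[OF this]
    have "L \<subseteq> M" using mx LD LW L(4) unfolding Q.max_lattice_def by blast
    then show "L = M" using L(4) by blast
  qed
qed

text \<open>The test lattices lie in the space of \<open>M\<close> itself, where the identity
  represents their spaces; \<open>n_ADC_any_space\<close> moves them to the space of
  sequences.\<close>

lemma n_ADC_imp_adc: assumes "n_ADC R sc B n M" shows "Q.adc n M"
  unfolding Q.adc_def
proof (intro allI impI)
  fix A assume A: "finite A" "A \<subseteq> W" "Q.nondeg_on A" "independent A" "card A = n" "Q.integral (Q.rsp A)"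
  let ?N = "Q.rsp A"
  have sp: "span ?N = span A"
    using span_mono[OF Q.rspan_superset, of A] span_minimal[OF Q.rspan_subset_span subspace_span, of A] by blast
  have AW: "span A \<subseteq> W" using A(2) span_minimal subspace_span by blast
  have nq: "nondegenerate_quadratic_space sc (span ?N) B"
    unfolding nondegenerate_quadratic_space_def sp
  proof (intro conjI ballI allI impI)
    show "vector_space sc" by (rule vector_space_axioms)
    show "\<exists>S. finite S \<and> span A = span S" using A(1) by blast
    fix x assume x: "x \<in> span A" "\<forall>y\<in>span A. B x y = 0"
    have "Q.b v x = 0" if "v \<in> A" for v
    proof -
      have v: "v \<in> span A" using that by (rule span_base)
      then have "B x v = 0" using x(2) by blast
      then show ?thesis using b_eq[of v x] W_sym[of v x] v x(1) AW by auto
    qed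
    then show "x = 0" using A(3) x(1) by (auto simp: Q.nondeg_on_def)
  qed (use AW in \<open>auto intro!: W_sym W_add W_scale\<close>)
  have fg: "fg_submodule R sc ?N" using A(1) by (auto simp: Q.fg_submodule_iff)
  have il: "integral_lattice R sc B ?N"
    unfolding integral_lattice_def using nq fg integral_iff[OF Q.integralD(2)[OF A(6)] fg] A(6) by blast
  have rk: "lattice_rank sc ?N = n"
    unfolding lattice_rank_def sp using A(4,5) dim_eq_card_independent by simp
  have "space_represents sc B W sc B (span ?N)"
    unfolding space_represents_def is_representation_def sp using AW by (intro exI[of _ "\<lambda>x. x"]) auto
  from n_ADC_any_space[OF zero_in one_in assms il rk this]
  obtain \<tau> where t: "is_representation sc B (span A) sc B W \<tau>" "\<tau> ` ?N \<subseteq> M"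
    unfolding lattice_represents_def sp by blast
  have tA: "\<tau> v \<in> M" "\<tau> v \<in> W" if "v \<in> A" for v
    using t(2) Q.rspan_base[OF that] span_base[of "\<tau> v" M] by blast+
  have qA: "Q.q (\<tau> x) = Q.q x" if "x \<in> span A" for x
    using t(1) that AW q_eq unfolding is_representation_def by (metis image_subset_iff subsetD)
  \<comment> \<open>Representations preserve values only; the pairing is recovered by
    polarization.\<close>
  have "Q.b (\<tau> v) (\<tau> w) = Q.b v w" if vw: "v \<in> A" "w \<in> A" for v w
  proof -
    have s: "v \<in> span A" "w \<in> span A" "v + w \<in> span A" using vw by (auto intro: span_base span_add)
    then have "\<tau> (v + w) = \<tau> v + \<tau> w" using t(1) by (simp add: is_representation_def)
    then show ?thesis using qA[OF s(3)] qA[OF s(1)] qA[OF s(2)] by (simp add: Q.q_add)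
  qed
  then show "\<exists>\<sigma>. (\<forall>v\<in>A. \<sigma> v \<in> M \<and> Q.q (\<sigma> v) = Q.q v) \<and> (\<forall>v\<in>A. \<forall>w\<in>A. Q.b (\<sigma> v) (\<sigma> w) = Q.b v w)"
    using tA qA span_base by (intro exI[of _ \<tau>]) blast
qed

text \<open>The image of \<open>N\<close> in the space of \<open>M\<close> is enlarged to a maximal
  lattice \<open>K\<close> there, and an isometry carrying \<open>K\<close> into \<open>M\<close> is
  composed with the given representation of spaces.\<close>

lemma maximal_imp_n_ADC: assumes "Q.max_lattice M" shows "n_ADC R sc B n M"
  unfolding n_ADC_def
proof (intro allI impI; elim conjE)
  fix B' and N :: "(nat \<Rightarrow> 'a) set"
  assume N: "integral_lattice R fun_scale B' N"
    and rep: "space_represents sc B W fun_scale B' (module.span fun_scale N)"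
  interpret FV: vector_space "fun_scale :: 'a \<Rightarrow> _" by (rule vector_space_fun_scale)
  interpret F: dvr_module R p "fun_scale :: 'a \<Rightarrow> _" ..
  obtain S where S: "finite S" "N = F.rsp S"
    using N by (auto simp: integral_lattice_def F.fg_submodule_iff)
  obtain \<sigma> where s: "is_representation fun_scale B' (FV.span N) sc B W \<sigma>"
    using rep by (auto simp: space_represents_def)
  have sW: "\<sigma> x \<in> W" if "x \<in> FV.span N" for x using s that by (auto simp: is_representation_def)
  have sadd: "\<sigma> (x + y) = \<sigma> x + \<sigma> y" if "x \<in> FV.span N" "y \<in> FV.span N" for x y
    using s that by (simp add: is_representation_def)
  have sscale: "\<sigma> (fun_scale c x) = sc c (\<sigma> x)" if "x \<in> FV.span N" for x c
    using s that by (simp add: is_representation_def)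
  have sq: "Q.q (\<sigma> x) = B' x x" if "x \<in> FV.span N" for x
    using s that q_eq[OF sW[OF that]] by (simp add: is_representation_def)
  have s0: "\<sigma> 0 = 0" using sscale[of 0 0] FV.span_zero by simp
  have Nsp: "x \<in> FV.span N" if "x \<in> N" for x using that by (rule FV.span_base)
  have SN: "S \<subseteq> N" unfolding S(2) by (rule F.rspan_superset)
  have subN: "F.submod N" unfolding S(2) by (rule F.submod_rspan)
  have sub: "Q.submod (\<sigma> ` N)"
    unfolding Q.submod_def
  proof (intro conjI ballI)
    show "0 \<in> \<sigma> ` N" using s0 F.submodD(1)[OF subN] by (metis image_eqI)
    show "x + y \<in> \<sigma> ` N" if "x \<in> \<sigma> ` N" "y \<in> \<sigma> ` N" for x y
      using that sadd Nsp F.submodD(2)[OF subN] by (auto simp flip: sadd)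
    show "sc c x \<in> \<sigma> ` N" if "c \<in> R" "x \<in> \<sigma> ` N" for c x
      using that Nsp F.submodD(3)[OF subN] by (auto simp flip: sscale)
  qed
  have norm: "\<forall>x\<in>N. B' x x \<in> R" using N by (simp add: integral_lattice_def norm_ideal_subset_iff)
  have "Q.rsp (\<sigma> ` S) \<subseteq> \<sigma> ` N" by (rule Q.rspan_minimal[OF sub]) (use SN in blast)
  then have int: "Q.integral (Q.rsp (\<sigma> ` S))"
    unfolding Q.integral_def using Q.submod_rspan sW sq norm Nsp by fastforce
  have sN: "\<sigma> x \<in> Q.rsp (\<sigma> ` S)" if x: "x \<in> N" for x
  proof -
    from x have "x \<in> F.rsp S" by (simp add: S(2))
    then have "x \<in> N \<and> \<sigma> x \<in> Q.rsp (\<sigma> ` S)"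
    proof (induction rule: rspan.induct)
      case zero show ?case unfolding s0 by (intro conjI F.submodD(1)[OF subN] rspan.zero)
    next
      case (step v c w)
      have v: "v \<in> N" "fun_scale c v \<in> N" using step SN F.submodD(3)[OF subN] by blast+
      have "\<sigma> (fun_scale c v + w) = sc c (\<sigma> v) + \<sigma> w" using v step by (simp add: sadd sscale Nsp)
      moreover have "sc c (\<sigma> v) + \<sigma> w \<in> Q.rsp (\<sigma> ` S)" using step by (intro rspan.step) auto
      moreover have "fun_scale c v + w \<in> N" using F.submodD(2)[OF subN v(2)] step(4) by blast
      ultimately show ?case by (simp only: simp_thms)
    qed
    then show ?thesis by blast
  qed
  obtain L where L: "Q.integral L" "span L = W" "Q.rsp (\<sigma> ` S) \<subseteq> L"
    using Q.extend_to_spanning[OF _ int] S(1) by auto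
  obtain K where K: "Q.max_lattice K" "L \<subseteq> K" using Q.extend_to_maximal[OF L(1,2)] by blast
  obtain g where g: "Q.isometry g" "g ` K \<subseteq> M" using Q.maximal_lattices_isometric[OF K(1) assms] by blast
  have gs: "(g \<circ> \<sigma>) ` N \<subseteq> M"
  proof (rule image_subsetI)
    fix x assume "x \<in> N"
    then have "\<sigma> x \<in> K" using sN L(3) K(2) by blast
    then show "(g \<circ> \<sigma>) x \<in> M" using g(2) by auto
  qed
  note i = Q.isometryD[OF g(1)]
  have "is_representation fun_scale B' (FV.span N) sc B W (g \<circ> \<sigma>)"
    unfolding is_representation_def
  proof (intro conjI ballI allI)
    show "(g \<circ> \<sigma>) ` FV.span N \<subseteq> W" using sW i(4) by auto
    show "B ((g \<circ> \<sigma>) x) ((g \<circ> \<sigma>) x) = B' x x" if "x \<in> FV.span N" for x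
      using sq[OF that] i(5)[of "\<sigma> x"] q_eq[OF i(4)[OF sW[OF that]]] by simp
  qed (simp_all add: sadd sscale i)
  then show "lattice_represents sc B M fun_scale B' N"
    unfolding lattice_represents_def using gs by blast
qed

end

theorem theorem5p1:
  fixes Q2 :: "'a::field_char_0 set" and nrm :: "'a \<Rightarrow> real"
    and sc :: "'a \<Rightarrow> 'v::ab_group_add \<Rightarrow> 'v" and B :: "'v \<Rightarrow> 'v \<Rightarrow> 'a"
    and M :: "'v set" and n :: nat
  assumes "dyadic_local_field Q2 nrm"
    and "n \<ge> 3" and "odd n"
    and "integral_lattice (ring_of_integers Q2 nrm) sc B M"
    and "lattice_rank sc M = n + 1"
  shows "n_ADC (ring_of_integers Q2 nrm) sc B n M \<longleftrightarrow>
         maximal_lattice (ring_of_integers Q2 nrm) sc B M"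
proof -
  obtain p where "dyadic_dvr (ring_of_integers Q2 nrm) p"
    using dyadic_local_field.ring_of_integers_dyadic_dvr[OF assms(1)] by blast
  then interpret dyadic_lattice "ring_of_integers Q2 nrm" p sc B M
    using assms(4) by (intro dyadic_lattice.intro dyadic_lattice_axioms.intro)
  obtain l where l: "n = 2 * l + 1" using assms(3) by (elim oddE)
  have "dim (span M) = 2 * l + 2" "l \<ge> 1" using assms(2,5) l by (simp_all add: lattice_rank_def)
  then show ?thesis
    using Q.adc_imp_maximal[OF M_integral refl] n_ADC_imp_adc[of n] maximal_imp_n_ADC[of n] l
    unfolding maximal_iff by blast
qed

end
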